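(* Assume Hypotheses (H2) hold and, in addition, $B$ is bounded, i.e. $B\in UC_b(H;U)$. Then weak uniqueness holds for $$dX(t)=AX(t)\,dt+\mathcal V B(X(t))\,dt+G\,dW(t),\quad t>0,\qquad X(0)=x\in H.$$
   Context: $U,H$ are real separable Hilbert spaces. Hypotheses (H1): (I) $W$ is a $U$-cylindrical Wiener process; (II) $A:D(A)\subseteq H\to H$ generates a compact strongly continuous semigroup $(e^{tA})_{t\ge0}$, $\mathcal V,G\in\mathcal L(U;H)$, and $B:H\to U$ is uniformly continuous; (III) there is $\eta\in(0,1)$ with $\int_0^t s^{-\eta}\mathrm{Tr}_H[e^{sA}GG^*e^{sA^*}]ds<\infty$ for every $t>0$. $Q_t:=\int_0^t e^{sA}GG^*e^{sA^*}ds$, $Q_t^{-1/2}$ is the pseudo-inverse of $Q_t^{1/2}$, $\Gamma_s:=Q_s^{-1/2}e^{sA}$. Hypotheses (H2): (H1) and (i) there are finite-dimensional subspaces $H_n$, $n\in\mathbb N$, $H_0=\{0\}$, $H_{n-1}\subseteq H_n\subseteq D(A)\cap D(A^* )$, $A(H_n\setminus H_{n-1})\subseteq (H_n\setminus H_{n-1})\cup\{0\}$, $\bigcup_nH_n$ dense in $H$; (ii) for every $t>0$, $e^{tA}(H)\subseteq Q_t^{1/2}(H)$ and $\int_0^t\|\Gamma_s\mathcal V\|_{\mathcal L(U;H)}ds<\infty$. A weak mild solution with initial datum $x$ is a pair $(X,W)$, $W$ a $U$-cylindrical Wiener process on a complete filtered probability space, $X$ adapted, $H$-valued, with a.s. continuous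 paths, satisfying a.s. for each $t\ge0$: $X(t)=e^{tA}x+\int_0^te^{(t-s)A}\mathcal VB(X(s))ds+\int_0^te^{(t-s)A}G\,dW(s)$. Weak uniqueness: any two weak mild solutions with the same initial datum have the same law on $C(\mathbb R_+;H)$. *)

theory Defs
  imports "HOL-Probability.Probability"
begin

definition adj :: "('a::real_inner \<Rightarrow>\<^sub>L 'b::real_inner) \<Rightarrow> ('b \<Rightarrow>\<^sub>L 'a)" where
  "adj L = (THE M. \<forall>x y. inner (blinfun_apply L x) y = inner x (blinfun_apply M y))"

text \<open>Strongly continuous semigroup (values for negative times are irrelevant).\<close>
definition strongly_cont_semigroup :: "(real \<Rightarrow> ('h::real_normed_vector \<Rightarrow>\<^sub>L 'h)) \<Rightarrow> bool" where
  "strongly_cont_semigroup T \<longleftrightarrow>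
     T 0 = id_blinfun \<and>
     (\<forall>s\<ge>0. \<forall>t\<ge>0. T (s + t) = T s o\<^sub>L T t) \<and>
     (\<forall>x. ((\<lambda>t. blinfun_apply (T t) x) \<longlongrightarrow> x) (at_right 0))"

text \<open>(DA, A) is the infinitesimal generator of T (A is only meaningful on DA).\<close>
definition is_generator ::
    "(real \<Rightarrow> ('h::real_normed_vector \<Rightarrow>\<^sub>L 'h)) \<Rightarrow> 'h set \<Rightarrow> ('h \<Rightarrow> 'h) \<Rightarrow> bool" where
  "is_generator T DA A \<longleftrightarrow>
     DA = {x. \<exists>y. ((\<lambda>h. (1 / h) *\<^sub>R (blinfun_apply (T h) x - x)) \<longlongrightarrow> y) (at_right 0)} \<and>
     (\<forall>x\<in>DA. ((\<lambda>h. (1 / h) *\<^sub>R (blinfun_apply (T h) x - x)) \<longlongrightarrow> A x) (at_right 0))"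

definition adj_domain :: "'h::real_inner set \<Rightarrow> ('h \<Rightarrow> 'h) \<Rightarrow> 'h set" where
  "adj_domain DA A = {y. \<exists>z. \<forall>x\<in>DA. inner (A x) y = inner x z}"

definition compact_operator :: "('a::real_normed_vector \<Rightarrow>\<^sub>L 'b::real_normed_vector) \<Rightarrow> bool" where
  "compact_operator L \<longleftrightarrow> compact (closure (blinfun_apply L ` cball 0 1))"

text \<open>Trace of a positive bounded operator (supremum over finite orthonormal families;
  equals the sum over any orthonormal basis, possibly infinite).\<close>
definition trace_pos :: "('h::real_inner \<Rightarrow> 'h) \<Rightarrow> ennreal" where
  "trace_pos S = (SUP F \<in> {F. finite F \<and> (\<forall>e\<in>F. norm e = 1) \<and> pairwise orthogonal F}.
                    \<Sum>e\<in>F. ennreal (inner (S e) e))"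

definition Qop :: "(real \<Rightarrow> ('h::{real_inner,banach,second_countable_topology} \<Rightarrow>\<^sub>L 'h))
                   \<Rightarrow> ('u::real_inner \<Rightarrow>\<^sub>L 'h) \<Rightarrow> real \<Rightarrow> 'h \<Rightarrow> 'h" where
  "Qop T G t x = (LINT s:{0..t}|lborel.
      blinfun_apply (T s) (blinfun_apply G (blinfun_apply (adj G) (blinfun_apply (adj (T s)) x))))"

definition op_sqrt :: "('h::real_inner \<Rightarrow> 'h) \<Rightarrow> ('h \<Rightarrow> 'h)" where
  "op_sqrt Q = (THE R. bounded_linear R \<and> (\<forall>x y. inner (R x) y = inner x (R y)) \<and>
                       (\<forall>x. 0 \<le> inner (R x) x) \<and> (\<forall>x. R (R x) = Q x))"

definition pinv :: "('h::real_inner \<Rightarrow> 'h) \<Rightarrow> 'h \<Rightarrow> 'h" where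
  "pinv R y = (THE x. R x = y \<and> (\<forall>z. R z = 0 \<longrightarrow> inner x z = 0))"

definition Gamma :: "(real \<Rightarrow> ('h::{real_inner,banach,second_countable_topology} \<Rightarrow>\<^sub>L 'h))
                   \<Rightarrow> ('u::real_inner \<Rightarrow>\<^sub>L 'h) \<Rightarrow> real \<Rightarrow> 'h \<Rightarrow> 'h" where
  "Gamma T G s y = pinv (op_sqrt (Qop T G s)) (blinfun_apply (T s) y)"

definition opnorm_e :: "('a::real_normed_vector \<Rightarrow> 'b::real_normed_vector) \<Rightarrow> ennreal" where
  "opnorm_e f = (SUP u \<in> cball 0 1. ennreal (norm (f u)))"

definition H1 ::
  "('h::{real_inner,banach,second_countable_topology} set) \<Rightarrow> ('h \<Rightarrow> 'h) \<Rightarrow> (real \<Rightarrow> ('h \<Rightarrow>\<^sub>L 'h))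
   \<Rightarrow> ('u::{real_inner,banach,second_countable_topology} \<Rightarrow>\<^sub>L 'h) \<Rightarrow> ('u \<Rightarrow>\<^sub>L 'h) \<Rightarrow> ('h \<Rightarrow> 'u) \<Rightarrow> bool" where
  "H1 DA A T V G B \<longleftrightarrow>
     strongly_cont_semigroup T \<and> is_generator T DA A \<and>
     (\<forall>t>0. compact_operator (T t)) \<and>
     uniformly_continuous_on UNIV B \<and>
     (\<exists>\<eta>. 0 < \<eta> \<and> \<eta> < 1 \<and>
        (\<forall>t>0. (\<integral>\<^sup>+ s\<in>{0<..t}. ennreal (s powr (-\<eta>)) *
                   trace_pos (\<lambda>y. blinfun_apply (T s) (blinfun_apply G (blinfun_apply (adj G)
                                     (blinfun_apply (adj (T s)) y)))) \<partial>lborel) < \<infinity>))"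

definition H2 ::
  "('h::{real_inner,banach,second_countable_topology} set) \<Rightarrow> ('h \<Rightarrow> 'h) \<Rightarrow> (real \<Rightarrow> ('h \<Rightarrow>\<^sub>L 'h))
   \<Rightarrow> ('u::{real_inner,banach,second_countable_topology} \<Rightarrow>\<^sub>L 'h) \<Rightarrow> ('u \<Rightarrow>\<^sub>L 'h) \<Rightarrow> ('h \<Rightarrow> 'u) \<Rightarrow> bool" where
  "H2 DA A T V G B \<longleftrightarrow>
     H1 DA A T V G B \<and>
     (\<exists>Hs :: nat \<Rightarrow> 'h set.
        Hs 0 = {0} \<and>
        (\<forall>n. \<exists>S. finite S \<and> Hs n = span S) \<and>
        (\<forall>n. Hs n \<subseteq> Hs (Suc n)) \<and>
        (\<forall>n. Hs n \<subseteq> DA \<inter> adj_domain DA A) \<and>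
        (\<forall>n. A ` (Hs (Suc n) - Hs n) \<subseteq> (Hs (Suc n) - Hs n) \<union> {0}) \<and>
        closure (\<Union>n. Hs n) = UNIV) \<and>
     (\<forall>t>0. range (blinfun_apply (T t)) \<subseteq> range (op_sqrt (Qop T G t)) \<and>
            (\<integral>\<^sup>+ s\<in>{0<..t}. opnorm_e (\<lambda>u. Gamma T G s (blinfun_apply V u)) \<partial>lborel) < \<infinity>)"

definition filtered_cprob_space :: "'a measure \<Rightarrow> (real \<Rightarrow> 'a measure) \<Rightarrow> bool" where
  "filtered_cprob_space M F \<longleftrightarrow>
     prob_space M \<and> complete_measure M \<and>
     (\<forall>t. subalgebra M (F t)) \<and>
     (\<forall>s t. s \<le> t \<longrightarrow> sets (F s) \<subseteq> sets (F t)) \<and>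
     null_sets M \<subseteq> sets (F 0)"

text \<open>U-cylindrical Wiener process w.r.t. F: W t u is the real process "<W(t),u>".\<close>
definition cyl_wiener :: "'a measure \<Rightarrow> (real \<Rightarrow> 'a measure) \<Rightarrow> (real \<Rightarrow> 'u::real_inner \<Rightarrow> 'a \<Rightarrow> real) \<Rightarrow> bool" where
  "cyl_wiener M F W \<longleftrightarrow>
     (\<forall>t\<ge>0. \<forall>u. W t u \<in> borel_measurable (F t)) \<and>
     (\<forall>u. AE \<omega> in M. W 0 u \<omega> = 0) \<and>
     (\<forall>u. AE \<omega> in M. continuous_on {0..} (\<lambda>t. W t u \<omega>)) \<and>
     (\<forall>t\<ge>0. \<forall>a b u v. AE \<omega> in M. W t (a *\<^sub>R u + b *\<^sub>R v) \<omega> = a * W t u \<omega> + b * W t v \<omega>) \<and>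
     (\<forall>s t u. 0 \<le> s \<and> s < t \<and> u \<noteq> 0 \<longrightarrow>
        distributed M lborel (\<lambda>\<omega>. W t u \<omega> - W s u \<omega>) (normal_density 0 (sqrt (t - s) * norm u))) \<and>
     (\<forall>s t u. 0 \<le> s \<and> s \<le> t \<longrightarrow>
        (\<forall>A\<in>sets (F s). \<forall>C\<in>sets borel.
           measure M (A \<inter> ((\<lambda>\<omega>. W t u \<omega> - W s u \<omega>) -` C \<inter> space M)) =
           measure M A * measure M ((\<lambda>\<omega>. W t u \<omega> - W s u \<omega>) -` C \<inter> space M)))"

definition stepint :: "(real \<Rightarrow> 'u \<Rightarrow> 'a \<Rightarrow> real) \<Rightarrow> nat \<Rightarrow> (nat \<Rightarrow> real) \<Rightarrow> (nat \<Rightarrow> 'u) \<Rightarrow> 'a \<Rightarrow> real" where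
  "stepint W n ts us \<omega> = (\<Sum>i<n. W (ts (Suc i)) (us i) \<omega> - W (ts i) (us i) \<omega>)"

definition stepfun :: "nat \<Rightarrow> (nat \<Rightarrow> real) \<Rightarrow> (nat \<Rightarrow> 'u::real_vector) \<Rightarrow> real \<Rightarrow> 'u" where
  "stepfun n ts us s = (\<Sum>i<n. indicator {ts i..<ts (Suc i)} s *\<^sub>R us i)"

text \<open>Y is (a version of) the Wiener integral \<integral>_0^t g(s) dW(s) of a deterministic U-valued g:
  characterised by the Ito isometry against all step integrands (this determines Y a.s.
  as the L^2-limit of the elementary integrals).\<close>
definition is_wiener_integral ::
  "'a measure \<Rightarrow> (real \<Rightarrow> 'u::real_normed_vector \<Rightarrow> 'a \<Rightarrow> real) \<Rightarrow> real \<Rightarrow> (real \<Rightarrow> 'u) \<Rightarrow> ('a \<Rightarrow> real) \<Rightarrow> bool" where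
  "is_wiener_integral M W t g Y \<longleftrightarrow>
     Y \<in> borel_measurable M \<and>
     (\<forall>n ts us. ts 0 = 0 \<and> ts n = t \<and> (\<forall>i<n. ts i \<le> ts (Suc i)) \<longrightarrow>
        (\<integral>\<^sup>+ \<omega>. ennreal ((Y \<omega> - stepint W n ts us \<omega>)\<^sup>2) \<partial>M) =
        (\<integral>\<^sup>+ s\<in>{0..t}. ennreal ((norm (g s - stepfun n ts us s))\<^sup>2) \<partial>lborel))"

text \<open>Z is (a version of) the stochastic convolution \<integral>_0^t e^{(t-s)A} G dW(s):
  <Z, h> = \<integral>_0^t G* e^{(t-s)A*} h dW(s) for every h.\<close>
definition is_stoch_conv ::
  "'a measure \<Rightarrow> (real \<Rightarrow> 'u::real_inner \<Rightarrow> 'a \<Rightarrow> real) \<Rightarrow> (real \<Rightarrow> ('h::{real_inner,banach,second_countable_topology} \<Rightarrow>\<^sub>L 'h))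
   \<Rightarrow> ('u \<Rightarrow>\<^sub>L 'h) \<Rightarrow> real \<Rightarrow> ('a \<Rightarrow> 'h) \<Rightarrow> bool" where
  "is_stoch_conv M W T G t Z \<longleftrightarrow>
     Z \<in> borel_measurable M \<and>
     (\<forall>h. is_wiener_integral M W t (\<lambda>s. blinfun_apply (adj G) (blinfun_apply (adj (T (t - s))) h))
                             (\<lambda>\<omega>. inner (Z \<omega>) h))"

definition weak_mild_solution ::
  "'a measure \<Rightarrow> (real \<Rightarrow> 'a measure) \<Rightarrow> (real \<Rightarrow> 'u::{real_inner,banach,second_countable_topology} \<Rightarrow> 'a \<Rightarrow> real)
   \<Rightarrow> (real \<Rightarrow> 'a \<Rightarrow> 'h::{real_inner,banach,second_countable_topology})
   \<Rightarrow> (real \<Rightarrow> ('h \<Rightarrow>\<^sub>L 'h)) \<Rightarrow> ('u \<Rightarrow>\<^sub>L 'h) \<Rightarrow> ('u \<Rightarrow>\<^sub>L 'h) \<Rightarrow> ('h \<Rightarrow> 'u) \<Rightarrow> 'h \<Rightarrow> bool" where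
  "weak_mild_solution M F W X T V G B x \<longleftrightarrow>
     filtered_cprob_space M F \<and> cyl_wiener M F W \<and>
     (\<forall>t\<ge>0. X t \<in> borel_measurable (F t)) \<and>
     (AE \<omega> in M. continuous_on {0..} (\<lambda>t. X t \<omega>)) \<and>
     (\<forall>t\<ge>0. \<exists>Z. is_stoch_conv M W T G t Z \<and>
        (AE \<omega> in M. X t \<omega> = blinfun_apply (T t) x
            + (LINT s:{0..t}|lborel. blinfun_apply (T (t - s)) (blinfun_apply V (B (X s \<omega>))))
            + Z \<omega>))"

text \<open>Law of the path process on the path space over [0,\<infinity>) (product \<sigma>-algebra, which
  on continuous paths coincides with the Borel \<sigma>-algebra of C(R_+;H)).\<close>
definition path_law :: "'a measure \<Rightarrow> (real \<Rightarrow> 'a \<Rightarrow> 'h::topological_space) \<Rightarrow> (real \<Rightarrow> 'h) measure" where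
  "path_law M X = distr M (PiM {0..} (\<lambda>_. borel)) (\<lambda>\<omega>. \<lambda>t\<in>{0..}. X t \<omega>)"

end

theory Submission
  imports Defs
begin

text \<open>
  Two solutions are compared directly through the Ornstein--Uhlenbeck semigroup \<open>P\<close>
  of the linear equation, without solving a Kolmogorov equation. For a trigonometric sum \<open>f\<close>
  and an event \<open>E\<close> of the past at time \<open>s\<close>, an elementary computation with Wiener integrals gives
  Duhamel's formula: \<open>E[1\<^sub>E f(X(t))] - E[1\<^sub>E (P(t-s)f)(X(s))]\<close> is the integral over \<open>r\<close> in
  \<open>[s,t]\<close> of \<open>E[1\<^sub>E g(t-r, X(r))]\<close> with \<open>g(r,y) = D(P(r)f)(y) V B(y)\<close>. One-dimensional Gaussian
  smoothing bounds \<open>g(r, _)\<close> by \<open>sup |B|\<close> times the operator norm of \<open>\<Gamma>\<^sub>r V\<close> times \<open>sup |f|\<close>.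
  Trigonometric sums bounded by \<open>1\<close> are norming for finite signed measures, so the total variation
  distance of the laws of two solutions that agree at time \<open>s\<close> satisfies a linear Volterra inequality
  with integrable kernel and vanishes. Letting \<open>E\<close> fix the past at finitely many times gives the
  finite-dimensional distributions.
\<close>

section \<open>Hilbert space preliminaries\<close>

text \<open>No Gaussian measure on \<open>'h\<close> and no function space for P is built. A cosine
  stays a cosine under P: the frequency \<open>h\<close> becomes \<open>adj (T t) h\<close> and the
  amplitude is damped by exp(-<Q_t h, h>/2), so P acts on finite lists of amplitudes, frequencies
  and phases. The obstacle is that the Duhamel integrand contains B and so is not a trigonometric
  sum, while laws are compared on such sums. The norming property closes this circle, provided the
  integrand is bounded through sup |f| alone and not through the frequencies of f. That bound rests
  on the range condition: e^{tA} V u = Q_t^{1/2} k with k = \<Gamma>_t V u, so the derivative is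
  taken in a direction along which the Gaussian smooths, and the first absolute moment of a standard
  normal variable, at most 1, leaves no constant. The kernel may blow up at 0, so the Volterra
  inequality is used as a halving step on intervals of a length d over which b times the kernel
  integrates to at most 1/2; d depends neither on the starting time nor on the event. As the
  solutions live on different spaces, their past events are matched only by equality of unnormalised
  laws.\<close>

lemma subspace_projection_exists:
  fixes S :: "'a::{real_inner,banach} set"
  assumes S: "subspace S" "closed S"
  obtains p where "p \<in> S" "\<And>z. z \<in> S \<Longrightarrow> inner (x - p) z = 0"
proof -
  define d where "d = infdist x S"
  have ne: "S \<noteq> {}" using subspace_0[OF S(1)] by auto
  have dle: "d \<le> norm (x - z)" if "z \<in> S" for z
    using infdist_le[OF that, of x] by (simp add: d_def dist_norm)
  have "d \<ge> 0" by (simp add: d_def infdist_nonneg)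
  have "\<exists>z\<in>S. norm (x - z) < d + 1 / (real n + 1)" for n
  proof -
    have "Inf (dist x ` S) < d + 1 / (real n + 1)"
      using ne by (simp add: d_def infdist_def)
    then obtain z where "z \<in> S" "dist x z < d + 1 / (real n + 1)"
      using cInf_lessD[of "dist x ` S"] ne by auto
    then show ?thesis by (auto simp: dist_norm)
  qed
  then obtain z where z: "\<And>n. z n \<in> S" "\<And>n. norm (x - z n) < d + 1 / (real n + 1)"
    by metis
  \<comment> \<open>The midpoint of \<open>z m\<close> and \<open>z n\<close> lies in
    \<open>S\<close>, hence has distance at least \<open>d\<close> from \<open>x\<close>; the
    parallelogram law then makes any minimising sequence Cauchy.\<close>
  have par: "norm (z m - z n)^2 \<le> 2 * (norm (x - z m)^2 - d^2) + 2 * (norm (x - z n)^2 - d^2)" for m n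
  proof -
    let ?a = "x - z m" and ?b = "x - z n"
    have "(1/2) *\<^sub>R (z m + z n) \<in> S" using S(1) z(1) by (simp add: subspace_add subspace_mul)
    from dle[OF this] have "d \<le> norm ((1/2) *\<^sub>R (?a + ?b))"
      by (simp add: algebra_simps scaleR_left_distrib[symmetric] flip: scaleR_2)
    then have "d^2 \<le> norm ((1/2) *\<^sub>R (?a + ?b))^2" using \<open>d \<ge> 0\<close> by (rule power_mono)
    then have 1: "4 * d^2 \<le> norm (?a + ?b)^2" by (simp add: power_mult_distrib power_divide)
    have 2: "norm (?a + ?b)^2 + norm (?b - ?a)^2 = 2 * norm ?a^2 + 2 * norm ?b^2"
      unfolding power2_norm_eq_inner by (simp add: inner_add_left inner_add_right inner_diff_left inner_diff_right inner_commute)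
    have 3: "?b - ?a = z m - z n" by simp
    show ?thesis using 1 2 unfolding 3 by (simp add: algebra_simps)
  qed
  have sq: "norm (x - z n)^2 - d^2 \<le> (2 * d + 1) / (real n + 1)" for n
  proof -
    let ?e = "1 / (real n + 1)"
    have e: "0 < ?e" "?e \<le> 1" by auto
    have "norm (x - z n)^2 \<le> (d + ?e)^2" using z(2)[of n] by (intro power_mono) auto
    also have "\<dots> = d^2 + (2 * d + ?e) * ?e" by (simp add: power2_eq_square algebra_simps)
    also have "\<dots> \<le> d^2 + (2 * d + 1) * ?e" using e \<open>d \<ge> 0\<close> by (intro add_mono mult_right_mono) auto
    finally show ?thesis by simp
  qed
  have "Cauchy z"
  proof (rule metric_CauchyI)
    fix e :: real assume "e > 0"
    obtain N where N: "4 * (2 * d + 1) / e^2 < real N" using reals_Archimedean2 by blast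
    have "dist (z m) (z n) < e" if "m \<ge> N" "n \<ge> N" for m n
    proof -
      have b: "(2 * d + 1) / (real k + 1) < e^2 / 4" if "k \<ge> N" for k
      proof -
        have "4 * (2 * d + 1) / e^2 < real k + 1" using N that by linarith
        then show ?thesis using \<open>e > 0\<close> by (simp add: field_simps)
      qed
      have "norm (z m - z n)^2 < e^2" using par[of m n] sq[of m] sq[of n] b[OF that(1)] b[OF that(2)] by argo
      then show ?thesis using \<open>e > 0\<close> by (simp add: dist_norm power_less_imp_less_base)
    qed
    then show "\<exists>M. \<forall>m\<ge>M. \<forall>n\<ge>M. dist (z m) (z n) < e" by blast
  qed
  then obtain p where p: "z \<longlonglongrightarrow> p" using Cauchy_convergent convergent_def by blast
  have pS: "p \<in> S" using closed_sequentially[OF S(2), of z p] z(1) p by auto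
  have "(\<lambda>n. norm (x - z n)) \<longlonglongrightarrow> norm (x - p)" using p by (intro tendsto_intros)
  moreover have "(\<lambda>n. d + 1 / (real n + 1)) \<longlonglongrightarrow> d + 0"
    using LIMSEQ_inverse_real_of_nat by (intro tendsto_intros) (simp add: inverse_eq_divide add.commute)
  ultimately have "norm (x - p) \<le> d + 0"
    by (rule LIMSEQ_le) (use z(2) in \<open>auto intro: less_imp_le\<close>)
  then have min: "norm (x - p) \<le> norm (x - w)" if "w \<in> S" for w using dle[OF that] by linarith
  have "inner (x - p) w = 0" if w: "w \<in> S" for w
  proof (cases "w = 0")
    case False
    \<comment> \<open>The multiple of \<open>w\<close> closest to \<open>x - p\<close>; moving
      \<open>p\<close> by it would beat the minimum unless \<open>inner (x - p) w\<close>
      vanishes.\<close>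
    define c where "c = inner (x - p) w / inner w w"
    have ww: "inner w w > 0" using False by simp
    have "norm (x - p)^2 \<le> norm (x - (p + c *\<^sub>R w))^2"
      using min[of "p + c *\<^sub>R w"] pS w S(1) by (intro power_mono) (auto simp: subspace_add subspace_mul)
    also have "x - (p + c *\<^sub>R w) = (x - p) - c *\<^sub>R w" by simp
    also have "norm ((x - p) - c *\<^sub>R w)^2 = norm (x - p)^2 - 2 * c * inner (x - p) w + c^2 * inner w w"
      unfolding power2_norm_eq_inner
      by (simp add: inner_diff_left inner_diff_right inner_commute power2_eq_square algebra_simps)
    also have "\<dots> = norm (x - p)^2 - (inner (x - p) w)^2 / inner w w"
      using ww by (simp add: c_def power2_eq_square)
    finally have "(inner (x - p) w)^2 / inner w w \<le> 0" by simp
    then have "(inner (x - p) w)^2 \<le> 0" using ww by (simp add: divide_le_0_iff)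
    then show ?thesis by simp
  qed simp
  with pS show ?thesis using that by blast
qed

text \<open>A vector outside the kernel, minus its projection to the kernel, is orthogonal to it; as
  the kernel has codimension one, a multiple of that difference represents \<open>f\<close>.\<close>

lemma riesz_representation:
  fixes f :: "'a::{real_inner,banach} \<Rightarrow> real"
  assumes f: "bounded_linear f"
  obtains z where "\<And>x. f x = inner x z"
proof (cases "\<forall>x. f x = 0")
  case True then show ?thesis using that[of 0] by simp
next
  case False
  interpret f: bounded_linear f by fact
  obtain x where x: "f x \<noteq> 0" using False by auto
  let ?S = "{y. f y = 0}"
  have sub: "subspace ?S" by (auto simp: subspace_def f.add f.scaleR f.zero)
  have cl: "closed ?S" by (intro closed_Collect_eq f.continuous_on continuous_intros)
  obtain p where p: "p \<in> ?S" "\<And>z. z \<in> ?S \<Longrightarrow> inner (x - p) z = 0"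
    using subspace_projection_exists[OF sub cl, of x] by blast
  define w where "w = x - p"
  have fw: "f w \<noteq> 0" using x p by (simp add: w_def f.diff)
  have "f y = inner y ((f w / inner w w) *\<^sub>R w)" for y
  proof -
    have "y - (f y / f w) *\<^sub>R w \<in> ?S" using fw by (simp add: f.diff f.scaleR)
    then have "inner w (y - (f y / f w) *\<^sub>R w) = 0" using p(2) w_def by blast
    then have "inner y w = f y / f w * inner w w" by (simp add: inner_diff_right inner_commute)
    moreover have "inner w w \<noteq> 0" using fw f.zero by auto
    ultimately show ?thesis using fw by (simp add: field_simps)
  qed
  then show ?thesis using that by blast
qed

lemma inner_ext_right: "(\<And>x. inner x y = inner x z) \<Longrightarrow> y = z"
  by (metis inner_diff_right inner_eq_zero_iff right_minus_eq)

lemma inner_ext_left: "(\<And>x. inner y x = inner z x) \<Longrightarrow> y = z"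
  by (rule inner_ext_right) (simp add: inner_commute)

text \<open>\<open>adj\<close> is a definite description, so nothing is known about it until
  existence, which is Riesz applied for each \<open>y\<close>, and uniqueness of the adjoint are
  established.\<close>

lemma adj_inner:
  fixes L :: "'a::{real_inner,banach} \<Rightarrow>\<^sub>L 'b::real_inner"
  shows "inner (blinfun_apply L x) y = inner x (blinfun_apply (adj L) y)"
proof -
  have "\<exists>z. \<forall>x. inner (L x) y = inner x z" for y
    by (rule riesz_representation[of "\<lambda>x. inner (L x) y"])
       (auto intro: bounded_linear_compose[OF bounded_linear_inner_left] blinfun.bounded_linear_right)
  then obtain m where m: "\<And>x y. inner (L x) y = inner x (m y)" by metis
  have "bounded_linear m"
  proof (rule bounded_linear_intro[where K = "norm L"])
    show "m (a + b) = m a + m b" for a b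
      by (rule inner_ext_right) (simp add: inner_add_right flip: m)
    show "m (r *\<^sub>R a) = r *\<^sub>R m a" for r a
      by (rule inner_ext_right) (simp flip: m)
    show "norm (m a) \<le> norm a * norm L" for a
    proof -
      have "norm (m a)^2 = inner (L (m a)) a" by (simp add: m power2_norm_eq_inner)
      also have "\<dots> \<le> norm (L (m a)) * norm a" by (rule norm_cauchy_schwarz)
      also have "\<dots> \<le> norm L * norm (m a) * norm a" by (intro mult_right_mono norm_blinfun) auto
      finally have "norm (m a) * norm (m a) \<le> (norm a * norm L) * norm (m a)" by (simp add: power2_eq_square mult_ac)
      then show ?thesis by (cases "m a = 0") auto
    qed
  qed
  then have "\<forall>x y. inner (L x) y = inner x (Blinfun m y)" by (simp add: bounded_linear_Blinfun_apply m)
  moreover have "N = N'" if "\<forall>x y. inner (L x) y = inner x (blinfun_apply N y)"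
    "\<forall>x y. inner (L x) y = inner x (blinfun_apply N' y)" for N N'
    by (rule blinfun_eqI, rule inner_ext_right) (metis that)
  ultimately have "\<exists>!M. \<forall>x y. inner (L x) y = inner x (blinfun_apply M y)" by blast
  from theI'[OF this] show ?thesis unfolding adj_def by blast
qed

lemma adj_inner': "inner (blinfun_apply (adj L) y) x = inner y (blinfun_apply L x)"
  for L :: "'a::{real_inner,banach} \<Rightarrow>\<^sub>L 'b::real_inner"
  using adj_inner[of L x y] by (simp add: inner_commute)

lemma adj_eqI:
  fixes L :: "'a::{real_inner,banach} \<Rightarrow>\<^sub>L 'b::real_inner"
  assumes "\<And>x y. inner (L x) y = inner x (blinfun_apply M y)"
  shows "adj L = M"
  by (rule blinfun_eqI, rule inner_ext_right) (simp add: assms flip: adj_inner)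

lemma adj_id: "adj (id_blinfun :: 'a::{real_inner,banach} \<Rightarrow>\<^sub>L 'a) = id_blinfun"
  by (rule adj_eqI) simp

lemma adj_compose: "adj (L o\<^sub>L K) = adj K o\<^sub>L adj L"
  for L :: "'b::{real_inner,banach} \<Rightarrow>\<^sub>L 'c::real_inner" and K :: "'a::{real_inner,banach} \<Rightarrow>\<^sub>L 'b"
  by (rule adj_eqI) (simp add: adj_inner)

lemma norm_le_inner_bound:
  fixes v :: "'a::real_inner"
  assumes C: "0 \<le> C" and le: "\<And>x. \<bar>inner x v\<bar> \<le> C * norm x"
  shows "norm v \<le> C"
proof (cases "v = 0")
  case True
  then show ?thesis using C by simp
next
  case False
  have "norm v * norm v \<le> C * norm v" using le[of v] by (simp add: power2_norm_eq_inner flip: power2_eq_square)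
  then show ?thesis using False by simp
qed

lemma norm_adj_le: "norm (adj L) \<le> norm L"
  for L :: "'a::{real_inner,banach} \<Rightarrow>\<^sub>L 'b::real_inner"
proof (rule norm_blinfun_bound)
  fix y
  have "norm (adj L y)^2 = inner (L (adj L y)) y" by (simp add: adj_inner power2_norm_eq_inner)
  also have "\<dots> \<le> norm (L (adj L y)) * norm y" by (rule norm_cauchy_schwarz)
  also have "\<dots> \<le> norm L * norm (adj L y) * norm y" by (intro mult_right_mono norm_blinfun) auto
  finally have "norm (adj L y) * norm (adj L y) \<le> (norm L * norm y) * norm (adj L y)" by (simp add: power2_eq_square mult_ac)
  then show "norm (adj L y) \<le> norm L * norm y" by (cases "adj L y = 0") auto
qed auto

section \<open>Positive operators, their square roots and pseudo-inverses\<close>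

lemma psd_cauchy_schwarz:
  fixes S :: "'a::real_inner \<Rightarrow>\<^sub>L 'a"
  assumes sym: "\<And>x y. inner (S x) y = inner x (S y)" and pos: "\<And>x. 0 \<le> inner (S x) x"
  shows "(inner (S x) y)^2 \<le> inner (S x) x * inner (S y) y"
proof -
  have q: "0 \<le> inner (S x) x + 2 * t * inner (S x) y + t^2 * inner (S y) y" for t
  proof -
    have "0 \<le> inner (S (x + t *\<^sub>R y)) (x + t *\<^sub>R y)" by (rule pos)
    also have "\<dots> = inner (S x) x + t * inner (S x) y + t * inner (S y) x + t * t * inner (S y) y"
      by (simp add: blinfun.add_right blinfun.scaleR_right inner_add_left inner_add_right algebra_simps)
    also have "inner (S y) x = inner (S x) y" by (metis sym inner_commute)
    finally show ?thesis by (simp add: power2_eq_square algebra_simps)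
  qed
  show ?thesis
  proof (cases "inner (S y) y = 0")
    case True
    have "inner (S x) y = 0"
    proof (rule ccontr)
      assume n: "inner (S x) y \<noteq> 0"
      \<comment> \<open>This \<open>t\<close> gives the quadratic, here affine in \<open>t\<close>,
        the value -1.\<close>
      show False using q[of "- (inner (S x) x + 1) / (2 * inner (S x) y)"] True n by (simp add: field_simps)
    qed
    then show ?thesis using True by simp
  next
    case False
    then have p: "inner (S y) y > 0" using pos[of y] by simp
    \<comment> \<open>The minimiser of the quadratic in \<open>t\<close>.\<close>
    show ?thesis using q[of "- inner (S x) y / inner (S y) y"] p
      by (simp add: power2_eq_square field_simps)
  qed
qed

text \<open>Cauchy-Schwarz for the form of \<open>S\<close>, applied to \<open>S x\<close> and
  \<open>x\<close>, gives norm (S x)^4 \<le> norm x^2 * norm (S x)^2. A bound on the quadratic form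
  alone thus becomes one on the operator norm.\<close>

lemma psd_norm_le_1:
  fixes S :: "'a::real_inner \<Rightarrow>\<^sub>L 'a"
  assumes sym: "\<And>x y. inner (S x) y = inner x (S y)" and pos: "\<And>x. 0 \<le> inner (S x) x"
    and le: "\<And>x. inner (S x) x \<le> inner x x"
  shows "norm S \<le> 1"
proof (rule norm_blinfun_bound)
  fix x
  let ?y = "S x"
  have "(inner ?y ?y)^2 \<le> inner ?y x * inner (S ?y) ?y" by (rule psd_cauchy_schwarz[OF sym pos])
  also have "\<dots> \<le> inner x x * inner ?y ?y" by (intro mult_mono le pos) auto
  finally have "inner ?y ?y * inner ?y ?y \<le> inner x x * inner ?y ?y" by (simp add: power2_eq_square)
  then have "inner ?y ?y \<le> inner x x" by (cases "?y = 0") auto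
  then show "norm ?y \<le> 1 * norm x" by (simp add: norm_eq_sqrt_inner)
qed auto

text \<open>Picard iteration for a square root: if Y = (S + Y^2)/2, then (1 - Y)^2 = 1 - S. The
  iterates are polynomials in \<open>S\<close>, so symmetry and commutation with whatever commutes
  with \<open>S\<close> pass to the limit; commutation is what uniqueness of the root needs.\<close>

lemma contraction_half_square_fixpoint:
  fixes S :: "'a::{real_inner,banach} \<Rightarrow>\<^sub>L 'a"
  assumes sym: "\<And>x y. inner (S x) y = inner x (S y)" and S1: "norm S \<le> 1"
  obtains Y where "\<And>x y. inner (blinfun_apply Y x) y = inner x (Y y)" "norm Y \<le> 1"
    "Y = (1/2) *\<^sub>R (S + (Y o\<^sub>L Y))"
    "\<And>K. K o\<^sub>L S = S o\<^sub>L K \<Longrightarrow> K o\<^sub>L Y = Y o\<^sub>L K"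
proof -
  define Y where "Y = rec_nat 0 (\<lambda>_ Z. (1/2) *\<^sub>R (S + (Z o\<^sub>L Z)))"
  \<comment> \<open>The same iteration for the scalar 1 in place of \<open>S\<close>. It increases,
    stays below 1 and majorises both the norms and the increments of \<open>Y\<close>, which makes
    \<open>Y\<close> Cauchy in operator norm.\<close>
  define y :: "nat \<Rightarrow> real" where "y = rec_nat 0 (\<lambda>_ z. (1 + z^2) / 2)"
  have Y0: "Y 0 = 0" and YS: "Y (Suc n) = (1/2) *\<^sub>R (S + (Y n o\<^sub>L Y n))" for n by (simp_all add: Y_def)
  have y0: "y 0 = 0" and yS: "y (Suc n) = (1 + (y n)^2) / 2" for n by (simp_all add: y_def)
  have y01: "0 \<le> y n \<and> y n \<le> 1" for n
  proof (induction n)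
    case (Suc n)
    then have "(y n)^2 \<le> 1" by (simp add: power_le_one)
    then show ?case by (simp add: yS)
  qed (simp add: y0)
  have nY: "norm (Y n) \<le> y n" for n
  proof (induction n)
    case (Suc n)
    have "norm (Y (Suc n)) \<le> (1/2) * (norm S + norm (Y n o\<^sub>L Y n))"
      unfolding YS by (simp add: norm_triangle_ineq)
    also have "norm (Y n o\<^sub>L Y n) \<le> y n * y n"
      by (rule order_trans[OF norm_blinfun_compose]) (intro mult_mono Suc y01[THEN conjunct1] norm_ge_zero)
    finally show ?case using S1 by (simp add: yS power2_eq_square)
  qed (simp add: y0 Y0)
  have dY: "norm (Y (Suc n) - Y n) \<le> y (Suc n) - y n" for n
  proof (induction n)
    case 0
    show ?case using nY[of 1] by (simp add: Y0 y0)
  next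
    case (Suc n)
    have comp_diff: "(Y (Suc n) o\<^sub>L Y (Suc n)) - (Y n o\<^sub>L Y n)
        = (Y (Suc n) o\<^sub>L (Y (Suc n) - Y n)) + ((Y (Suc n) - Y n) o\<^sub>L Y n)"
      by (rule blinfun_eqI) (simp add: blinfun.diff_left blinfun.add_left blinfun.diff_right)
    have "Y (Suc (Suc n)) - Y (Suc n) = (1/2) *\<^sub>R ((Y (Suc n) o\<^sub>L Y (Suc n)) - (Y n o\<^sub>L Y n))"
      by (simp only: YS[of "Suc n"] YS[of n]) (simp add: scaleR_diff_right scaleR_add_right flip: YS)
    then have "norm (Y (Suc (Suc n)) - Y (Suc n))
        = (1/2) * norm ((Y (Suc n) o\<^sub>L (Y (Suc n) - Y n)) + ((Y (Suc n) - Y n) o\<^sub>L Y n))"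
      by (simp add: comp_diff)
    also have "\<dots> \<le> (1/2) * (norm (Y (Suc n)) * norm (Y (Suc n) - Y n) + norm (Y (Suc n) - Y n) * norm (Y n))"
      by (intro mult_left_mono order_trans[OF norm_triangle_ineq] add_mono norm_blinfun_compose) auto
    also have "\<dots> \<le> (1/2) * (y (Suc n) * (y (Suc n) - y n) + (y (Suc n) - y n) * y n)"
      using Suc order_trans[OF norm_ge_zero Suc]
      by (intro mult_left_mono add_mono mult_mono nY) (auto simp: y01)
    also have "\<dots> = y (Suc (Suc n)) - y (Suc n)"
      by (simp add: yS[of "Suc n"]) (simp add: yS power2_eq_square field_simps)
    finally show ?case .
  qed
  have "incseq y" using order_trans[OF norm_ge_zero dY] by (intro incseq_SucI) simp
  then have "convergent y"
    using incseq_convergent[of y 1] y01 by (metis convergent_def)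
  then have Cy: "Cauchy y" by (rule convergent_Cauchy)
  have dYm: "norm (Y m - Y n) \<le> y m - y n" if "n \<le> m" for m n
    using that
  proof (induction rule: dec_induct)
    case (step k)
    have "norm (Y (Suc k) - Y n) \<le> norm (Y (Suc k) - Y k) + norm (Y k - Y n)"
      using norm_triangle_ineq[of "Y (Suc k) - Y k" "Y k - Y n"] by simp
    then show ?case using step.IH dY[of k] by linarith
  qed simp
  have "Cauchy Y"
  proof (rule metric_CauchyI)
    fix e :: real assume "e > 0"
    then obtain N where N: "\<And>m n. m \<ge> N \<Longrightarrow> n \<ge> N \<Longrightarrow> dist (y m) (y n) < e"
      using Cy unfolding Cauchy_def by blast
    have "dist (Y m) (Y n) < e" if "m \<ge> N" "n \<ge> N" for m n
    proof -
      have "dist (Y m) (Y n) \<le> dist (y m) (y n)"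
        using dYm[of n m] dYm[of m n] by (cases "n \<le> m") (auto simp: dist_norm norm_minus_commute abs_if)
      then show ?thesis using N[OF that] by linarith
    qed
    then show "\<exists>M. \<forall>m\<ge>M. \<forall>n\<ge>M. dist (Y m) (Y n) < e" by blast
  qed
  then obtain Z where Z: "Y \<longlonglongrightarrow> Z" using Cauchy_convergent convergent_def by blast
  have Ysym: "inner (Y n x) y = inner x (Y n y)" for n x y
    by (induction n arbitrary: x y)
       (simp_all add: Y0 YS blinfun.scaleR_left blinfun.add_left inner_add_left inner_add_right sym)
  have Ycomm: "K o\<^sub>L Y n = Y n o\<^sub>L K" if "K o\<^sub>L S = S o\<^sub>L K" for K n
  proof (induction n)
    case (Suc n)
    have K1: "K (S x) = S (K x)" for x using that by (metis blinfun_apply_blinfun_compose)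
    have K2: "K (Y n x) = Y n (K x)" for x using Suc by (metis blinfun_apply_blinfun_compose)
    show ?case by (rule blinfun_eqI)
      (simp add: YS blinfun.scaleR_left blinfun.add_left blinfun.scaleR_right blinfun.add_right K1 K2)
  qed (simp add: Y0 bounded_bilinear.zero_left[OF bounded_bilinear_blinfun_compose] bounded_bilinear.zero_right[OF bounded_bilinear_blinfun_compose])
  have ap: "(\<lambda>n. Y n x) \<longlonglongrightarrow> Z x" for x by (intro tendsto_intros Z)
  show ?thesis
  proof
    show "inner (Z x) y = inner x (Z y)" for x y
    proof (rule LIMSEQ_unique)
      show "(\<lambda>n. inner (Y n x) y) \<longlonglongrightarrow> inner (Z x) y" by (intro tendsto_intros ap)
      show "(\<lambda>n. inner (Y n x) y) \<longlonglongrightarrow> inner x (Z y)" unfolding Ysym by (intro tendsto_intros ap)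
    qed
    show "norm Z \<le> 1"
      by (rule LIMSEQ_le_const2[OF tendsto_norm[OF Z]]) (use nY y01 order_trans in blast)
    show "Z = (1/2) *\<^sub>R (S + (Z o\<^sub>L Z))"
    proof (rule LIMSEQ_unique)
      show "(\<lambda>n. Y (Suc n)) \<longlonglongrightarrow> Z" using Z by (rule LIMSEQ_Suc)
      show "(\<lambda>n. Y (Suc n)) \<longlonglongrightarrow> (1/2) *\<^sub>R (S + (Z o\<^sub>L Z))" unfolding YS
        by (intro tendsto_intros bounded_bilinear.tendsto[OF bounded_bilinear_blinfun_compose] Z)
    qed
    show "K o\<^sub>L Z = Z o\<^sub>L K" if "K o\<^sub>L S = S o\<^sub>L K" for K
    proof (rule LIMSEQ_unique)
      show "(\<lambda>n. K o\<^sub>L Y n) \<longlonglongrightarrow> (K o\<^sub>L Z)"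
        by (intro bounded_bilinear.tendsto[OF bounded_bilinear_blinfun_compose] Z tendsto_const)
      show "(\<lambda>n. K o\<^sub>L Y n) \<longlonglongrightarrow> (Z o\<^sub>L K)" unfolding Ycomm[OF that]
        by (intro bounded_bilinear.tendsto[OF bounded_bilinear_blinfun_compose] Z tendsto_const)
    qed
  qed
qed

text \<open>For c above the norm of \<open>Q\<close> the operator S = 1 - Q/c is a positive
  contraction. Its fixed point \<open>Y\<close> gives the root sqrt c times (1 - Y), which is
  positive because \<open>Y\<close> has norm at most 1.\<close>

lemma psd_sqrt_exists:
  fixes Q :: "'a::{real_inner,banach} \<Rightarrow>\<^sub>L 'a"
  assumes sym: "\<And>x y. inner (Q x) y = inner x (Q y)" and pos: "\<And>x. 0 \<le> inner (Q x) x"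
  obtains R where "\<And>x y. inner (blinfun_apply R x) y = inner x (R y)" "\<And>x. 0 \<le> inner (R x) x"
    "\<And>x. R (R x) = Q x" "\<And>K. K o\<^sub>L Q = Q o\<^sub>L K \<Longrightarrow> K o\<^sub>L R = R o\<^sub>L K"
proof -
  define c where "c = norm Q + 1"
  have c: "c > 0" by (simp add: c_def add_nonneg_pos)
  define S where "S = id_blinfun - (1/c) *\<^sub>R Q"
  have Sx: "S x = x - (1/c) *\<^sub>R Q x" for x by (simp add: S_def blinfun.diff_left blinfun.scaleR_left)
  have QS: "inner (Q x) x \<le> c * inner x x" for x
  proof -
    have "inner (Q x) x \<le> norm (Q x) * norm x" by (rule norm_cauchy_schwarz)
    also have "\<dots> \<le> norm Q * norm x * norm x" by (intro mult_right_mono norm_blinfun) auto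
    also have "\<dots> \<le> c * norm x * norm x" by (intro mult_right_mono) (auto simp: c_def)
    finally show ?thesis by (simp add: power2_norm_eq_inner mult.assoc flip: power2_eq_square)
  qed
  have Ssym: "inner (S x) y = inner x (S y)" for x y
    by (simp add: Sx inner_diff_left inner_diff_right sym)
  have Spos: "0 \<le> inner (S x) x" for x
    using QS[of x] c by (simp add: Sx inner_diff_left field_simps)
  have Sle: "inner (S x) x \<le> inner x x" for x
    using pos[of x] c by (simp add: Sx inner_diff_left)
  have S1: "norm S \<le> 1" by (rule psd_norm_le_1[OF Ssym Spos Sle])
  obtain Y where Y: "\<And>x y. inner (blinfun_apply Y x) y = inner x (Y y)" "norm Y \<le> 1"
    "Y = (1/2) *\<^sub>R (S + (Y o\<^sub>L Y))"
    "\<And>K. K o\<^sub>L S = S o\<^sub>L K \<Longrightarrow> K o\<^sub>L Y = Y o\<^sub>L K"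
    using contraction_half_square_fixpoint[OF Ssym S1] by blast
  define R where "R = sqrt c *\<^sub>R (id_blinfun - Y)"
  have Rx: "R x = sqrt c *\<^sub>R (x - Y x)" for x by (simp add: R_def blinfun.diff_left blinfun.scaleR_left)
  have YY: "Y (Y x) = 2 *\<^sub>R Y x - S x" for x
  proof -
    have "Y x = (1/2) *\<^sub>R (S x + Y (Y x))"
      by (subst Y(3)) (simp only: blinfun.scaleR_left blinfun.add_left blinfun_apply_blinfun_compose)
    then have "2 *\<^sub>R Y x = S x + Y (Y x)" by (metis (no_types) scaleR_half_double scaleR_add_right scaleR_2 scaleR_right_distrib)
    then show ?thesis by simp
  qed
  show ?thesis
  proof
    show "inner (R x) y = inner x (R y)" for x y
      by (simp add: Rx inner_diff_left inner_diff_right Y(1))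
    show "0 \<le> inner (R x) x" for x
    proof -
      have "inner (Y x) x \<le> norm (Y x) * norm x" by (rule norm_cauchy_schwarz)
      also have "\<dots> \<le> norm Y * norm x * norm x" by (intro mult_right_mono norm_blinfun) auto
      also have "\<dots> \<le> 1 * norm x * norm x" using Y(2) by (intro mult_right_mono) auto
      finally show ?thesis using c
        by (simp add: Rx inner_diff_left power2_norm_eq_inner flip: power2_eq_square)
    qed
    show "R (R x) = Q x" for x
    proof -
      have "R (R x) = (sqrt c * sqrt c) *\<^sub>R (x - 2 *\<^sub>R Y x + Y (Y x))"
        by (simp add: Rx blinfun.scaleR_right blinfun.diff_right scaleR_2 algebra_simps)
      then show ?thesis using c by (simp add: YY Sx algebra_simps)
    qed
    show "K o\<^sub>L R = R o\<^sub>L K" if "K o\<^sub>L Q = Q o\<^sub>L K" for K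
    proof -
      have KQ: "K (Q x) = Q (K x)" for x using that by (metis blinfun_apply_blinfun_compose)
      have "K o\<^sub>L S = S o\<^sub>L K"
        by (rule blinfun_eqI) (simp add: Sx blinfun.diff_right blinfun.scaleR_right KQ)
      then have "K (Y x) = Y (K x)" for x using Y(4) by (metis blinfun_apply_blinfun_compose)
      then show ?thesis
        by (intro blinfun_eqI) (simp add: Rx blinfun.diff_right blinfun.scaleR_right)
    qed
  qed
qed

text \<open>\<open>R'\<close> commutes with its square \<open>Q\<close>, hence with
  \<open>R\<close>, so R + R' annihilates y = R x - R' x. Both forms are nonnegative, so each
  vanishes at \<open>y\<close>; Cauchy-Schwarz turns this into \<open>R y\<close> = 0, and then
  \<open>y\<close> is orthogonal to itself.\<close>

lemma psd_sqrt_unique: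
  fixes Q R R' :: "'a::real_inner \<Rightarrow>\<^sub>L 'a"
  assumes R: "\<And>x y. inner (R x) y = inner x (R y)" "\<And>x. 0 \<le> inner (R x) x" "\<And>x. R (R x) = Q x"
    "\<And>K. K o\<^sub>L Q = Q o\<^sub>L K \<Longrightarrow> K o\<^sub>L R = R o\<^sub>L K"
    and R': "\<And>x y. inner (R' x) y = inner x (R' y)" "\<And>x. 0 \<le> inner (R' x) x" "\<And>x. R' (R' x) = Q x"
  shows "R' = R"
proof (rule blinfun_eqI)
  fix x
  have "R' o\<^sub>L Q = Q o\<^sub>L R'" by (rule blinfun_eqI) (simp flip: R'(3))
  from R(4)[OF this] have comm: "R' (R z) = R (R' z)" for z by (metis blinfun_apply_blinfun_compose)
  define y where "y = R x - R' x"
  have Ry: "R y + R' y = 0" by (simp add: y_def blinfun.diff_right comm R(3) R'(3))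
  have "inner (R y) y + inner (R' y) y = 0" using Ry by (simp flip: inner_add_left)
  then have z: "inner (R y) y = 0" "inner (R' y) y = 0" using R(2)[of y] R'(2)[of y] by linarith+
  have "(inner (R y) (R y))^2 \<le> inner (R y) y * inner (R (R y)) (R y)" by (rule psd_cauchy_schwarz[OF R(1,2)])
  then have Ry0: "R y = 0" using z by simp
  have "inner y y = inner (R x) y - inner (R' x) y" by (simp add: y_def inner_diff_left)
  also have "\<dots> = inner x (R y) - inner x (R' y)" by (simp add: R(1) R'(1))
  also have "\<dots> = 0" using Ry Ry0 by simp
  finally show "R' x = R x" by (simp add: y_def)
qed

lemma op_sqrt_psd:
  fixes Q :: "'a::{real_inner,banach} \<Rightarrow>\<^sub>L 'a"
  assumes sym: "\<And>x y. inner (Q x) y = inner x (Q y)" and pos: "\<And>x. 0 \<le> inner (Q x) x"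
  shows "bounded_linear (op_sqrt (blinfun_apply Q))" (is ?A)
    "inner (op_sqrt (blinfun_apply Q) x) y = inner x (op_sqrt (blinfun_apply Q) y)" (is ?B)
    "op_sqrt (blinfun_apply Q) (op_sqrt (blinfun_apply Q) x) = Q x" (is ?C)
proof -
  obtain R where R: "\<And>x y. inner (blinfun_apply R x) y = inner x (R y)" "\<And>x. 0 \<le> inner (R x) x"
    "\<And>x. R (R x) = Q x" "\<And>K. K o\<^sub>L Q = Q o\<^sub>L K \<Longrightarrow> K o\<^sub>L R = R o\<^sub>L K"
    using psd_sqrt_exists[OF assms] by blast
  have "op_sqrt (blinfun_apply Q) = blinfun_apply R"
    unfolding op_sqrt_def
  proof (rule the_equality)
    fix P assume P: "bounded_linear P \<and> (\<forall>x y. inner (P x) y = inner x (P y)) \<and>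
                       (\<forall>x. 0 \<le> inner (P x) x) \<and> (\<forall>x. P (P x) = Q x)"
    then have "Blinfun P = R"
      by (intro psd_sqrt_unique[OF R]) (auto simp: bounded_linear_Blinfun_apply)
    then show "P = blinfun_apply R" using P bounded_linear_Blinfun_apply by metis
  qed (use R(1,2,3) blinfun.bounded_linear_right[of R] in blast)
  then show ?A ?B ?C
    using R(1,3) blinfun.bounded_linear_right[of R] by simp_all
qed

text \<open>Any preimage minus its projection to the kernel is the unique preimage orthogonal to the
  kernel, so the description in \<open>pinv\<close> denotes it.\<close>

lemma pinv_right_inverse:
  fixes R :: "'a::{real_inner,banach} \<Rightarrow> 'a"
  assumes R: "bounded_linear R" and y: "y \<in> range R"
  shows "R (pinv R y) = y"
proof -
  interpret R: bounded_linear R by fact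
  obtain x where x: "y = R x" using y by auto
  have sub: "subspace {z. R z = 0}" by (auto simp: subspace_def R.add R.scaleR R.zero)
  have cl: "closed {z. R z = 0}" by (intro closed_Collect_eq R.continuous_on continuous_intros)
  obtain p where p: "p \<in> {z. R z = 0}" "\<And>z. z \<in> {z. R z = 0} \<Longrightarrow> inner (x - p) z = 0"
    using subspace_projection_exists[OF sub cl, of x] by blast
  have 1: "R (x - p) = y \<and> (\<forall>z. R z = 0 \<longrightarrow> inner (x - p) z = 0)"
    using p by (simp add: x R.diff)
  have "u = x - p" if u: "R u = y \<and> (\<forall>z. R z = 0 \<longrightarrow> inner u z = 0)" for u
  proof -
    let ?d = "u - (x - p)"
    have "R ?d = 0" using u 1 by (simp add: R.diff)
    then have "inner ?d ?d = 0" using u 1 by (simp add: inner_diff_left)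
    then show ?thesis by simp
  qed
  with 1 have "\<exists>!u. R u = y \<and> (\<forall>z. R z = 0 \<longrightarrow> inner u z = 0)" by blast
  from theI'[OF this] show ?thesis unfolding pinv_def by blast
qed

section \<open>Strongly continuous semigroups and their adjoints\<close>

text \<open>Baire: if every closed set \<open>E n\<close> had empty interior, the complements would
  be open and dense, yet their intersection is empty by pointwise boundedness. A ball inside one
  \<open>E n\<close> then bounds all operator norms.\<close>

lemma uniform_boundedness_principle:
  fixes T :: "'i \<Rightarrow> 'a::banach \<Rightarrow>\<^sub>L 'b::real_normed_vector"
  assumes pw: "\<And>x. \<exists>K. \<forall>i\<in>I. norm (T i x) \<le> K"
  shows "\<exists>K. \<forall>i\<in>I. norm (T i) \<le> K"
proof -
  define E where "E n = {x. \<forall>i\<in>I. norm (T i x) \<le> real n}" for n :: nat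
  have cl: "closed (E n)" for n
  proof -
    have "E n = (\<Inter>i\<in>I. {x. norm (T i x) \<le> real n})" by (auto simp: E_def)
    then show ?thesis by (auto intro!: closed_INT closed_Collect_le continuous_intros)
  qed
  have "\<exists>n. closure (- E n) \<noteq> UNIV"
  proof (rule ccontr)
    assume "\<not> (\<exists>n. closure (- E n) \<noteq> UNIV)"
    then have d: "closure (- E n) = UNIV" for n by blast
    have "Met_TC.mtopology closure_of \<Inter>(range (\<lambda>n. - E n)) = (UNIV :: 'a set)"
    proof (rule Met_TC.metric_Baire_category)
      show "Met_TC.mcomplete TYPE('a)" by (simp add: complete_UNIV)
    qed (use cl d in auto)
    moreover have "\<Inter>(range (\<lambda>n. - E n)) = {}"
    proof -
      have "\<exists>n. x \<in> E n" for x
      proof -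
        obtain K where K: "\<forall>i\<in>I. norm (T i x) \<le> K" using pw by blast
        obtain n where "K \<le> real n" using real_arch_simple by blast
        then have "x \<in> E n" using K by (auto simp: E_def intro: order_trans)
        then show ?thesis by blast
      qed
      then show ?thesis by auto
    qed
    ultimately show False by simp
  qed
  then obtain n where "interior (E n) \<noteq> {}" by (auto simp: closure_complement)
  then obtain a where "a \<in> interior (E n)" by auto
  then obtain e where e: "e > 0" "cball a e \<subseteq> E n"
    using mem_interior_cball by blast
  have "norm (T i) \<le> 2 * real n / e" if i: "i \<in> I" for i
  proof (rule norm_blinfun_bound)
    fix x
    show "norm (T i x) \<le> 2 * real n / e * norm x"
    proof (cases "x = 0")
      case False
      let ?c = "e / norm x"
      have "a + ?c *\<^sub>R x \<in> E n" "a \<in> E n" using e False by (auto simp: dist_norm subset_iff)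
      then have "norm (T i (a + ?c *\<^sub>R x)) \<le> real n" "norm (T i a) \<le> real n" using i by (auto simp: E_def)
      then have "norm (T i (a + ?c *\<^sub>R x) - T i a) \<le> 2 * real n"
        using norm_triangle_ineq4[of "T i (a + ?c *\<^sub>R x)" "T i a"] by linarith
      then have "?c * norm (T i x) \<le> 2 * real n"
        using e by (simp add: blinfun.add_right blinfun.scaleR_right)
      then show ?thesis using e False by (simp add: field_simps)
    qed simp
  qed (use e in auto)
  then show ?thesis by blast
qed

context
  fixes T :: "real \<Rightarrow> 'h::banach \<Rightarrow>\<^sub>L 'h"
  assumes T: "strongly_cont_semigroup T"
begin

lemma semigroup_0: "T 0 x = x"
  and semigroup_add: "0 \<le> s \<Longrightarrow> 0 \<le> t \<Longrightarrow> T (s + t) x = T s (T t x)"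
  using T by (simp_all add: strongly_cont_semigroup_def)

lemma semigroup_tendsto_0: "((\<lambda>t. T t x) \<longlongrightarrow> x) (at 0 within {0..})"
  using T by (simp add: strongly_cont_semigroup_def at_within_Ici_at_right)

text \<open>Otherwise the norms blow up along some sequence of times tending to 0, along which
  \<open>T\<close> converges pointwise, against the uniform boundedness principle.\<close>

lemma semigroup_bounded_near_0: "\<exists>\<delta>>0. \<exists>K. \<forall>s\<in>{0..\<delta>}. norm (T s) \<le> K"
proof (rule ccontr)
  assume c: "\<not> ?thesis"
  have "\<exists>s. 0 \<le> s \<and> s \<le> inverse (real (Suc n)) \<and> norm (T s) > real n" for n
    using c by (metis atLeastAtMost_iff inverse_positive_iff_positive not_le of_nat_0_less_iff zero_less_Suc)
  then obtain s where s: "\<And>n. 0 \<le> s n" "\<And>n. s n \<le> inverse (real (Suc n))" "\<And>n. norm (T (s n)) > real n" by metis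
  have s0: "s \<longlonglongrightarrow> 0"
    by (rule real_tendsto_sandwich[OF _ _ tendsto_const LIMSEQ_inverse_real_of_nat]) (use s in auto)
  have "\<exists>K. \<forall>i\<in>UNIV. norm (T (s i) x) \<le> K" for x
  proof -
    have "continuous (at 0 within {0..}) (\<lambda>t. T t x)"
      using semigroup_tendsto_0 by (simp add: continuous_within semigroup_0)
    then have "(\<lambda>n. T (s n) x) \<longlonglongrightarrow> T 0 x"
      using s(1) s0 unfolding continuous_within_sequentially by (auto simp: o_def)
    then have "Bseq (\<lambda>n. T (s n) x)" using convergentI convergent_imp_Bseq by blast
    then show ?thesis by (auto simp: Bseq_def)
  qed
  from uniform_boundedness_principle[of UNIV "\<lambda>n. T (s n)", OF this]
  obtain K where K: "\<And>n. norm (T (s n)) \<le> K" by auto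
  obtain n where "K \<le> real n" using real_arch_simple by blast
  then show False using K[of n] s(3)[of n] by linarith
qed

lemma semigroup_bounded: obtains K where "K > 0" "\<And>s. 0 \<le> s \<Longrightarrow> s \<le> t \<Longrightarrow> norm (T s) \<le> K"
proof -
  obtain \<delta> K0 where d: "\<delta> > 0" "\<forall>s\<in>{0..\<delta>}. norm (T s) \<le> K0" using semigroup_bounded_near_0 by blast
  \<comment> \<open>At least 1, so that the powers of \<open>K\<close> that count steps of length
    \<delta> increase.\<close>
  define K where "K = max 1 K0"
  have K: "K \<ge> 1" "\<And>s. 0 \<le> s \<Longrightarrow> s \<le> \<delta> \<Longrightarrow> norm (T s) \<le> K" using d by (auto simp: K_def le_max_iff_disj)
  have B: "norm (T s) \<le> K ^ Suc n" if "0 \<le> s" "s \<le> real n * \<delta>" for s n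
    using that
  proof (induction n arbitrary: s)
    case 0 then show ?case using K d by simp
  next
    case (Suc n)
    show ?case
    proof (cases "s \<le> \<delta>")
      case True
      have "K \<le> K ^ Suc (Suc n)" using K(1) by (intro self_le_power) auto
      then show ?thesis using K(2)[OF Suc.prems(1) True] by linarith
    next
      case False
      have "T s = T \<delta> o\<^sub>L T (s - \<delta>)"
        by (rule blinfun_eqI) (use semigroup_add[of \<delta> "s - \<delta>"] False d in simp)
      then have "norm (T s) \<le> norm (T \<delta>) * norm (T (s - \<delta>))" by (simp add: norm_blinfun_compose)
      also have "\<dots> \<le> K * K ^ Suc n"
        using K d False Suc.prems by (intro mult_mono Suc.IH) (auto simp: algebra_simps)
      finally show ?thesis by simp
    qed
  qed
  obtain n where n: "t / \<delta> \<le> real n" using real_arch_simple by blast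
  have "t \<le> real n * \<delta>" using n d by (simp add: field_simps)
  then show ?thesis using that[of "K ^ Suc n"] B[of _ n] K(1) by force
qed

text \<open>Right continuity at 0 spreads by T v - T u = T u (T (v - u) - 1) for u \<le> v. With the
  smaller time factored out, the local norm bound gives left and right continuity alike.\<close>

lemma semigroup_continuous: "continuous_on {0..} (\<lambda>t. T t x)"
  unfolding continuous_on_iff
proof (intro ballI allI impI)
  fix a e :: real assume a: "a \<in> {0..}" and e: "e > 0"
  obtain K where K: "K > 0" "\<And>s. 0 \<le> s \<Longrightarrow> s \<le> a + 1 \<Longrightarrow> norm (T s) \<le> K" using semigroup_bounded by blast
  have "\<exists>d>0. \<forall>s\<in>{0..}. s \<noteq> 0 \<and> dist s 0 < d \<longrightarrow> dist (T s x) x < e / K"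
    using semigroup_tendsto_0[of x] e K(1) unfolding Lim_within
    by (metis (no_types, lifting) dist_nz divide_pos_pos)
  then obtain d where d: "d > 0" "\<And>s. 0 \<le> s \<Longrightarrow> s < d \<Longrightarrow> norm (T s x - x) < e / K"
    using e K(1) by (metis semigroup_0 atLeast_iff dist_norm abs_of_nonneg diff_zero divide_pos_pos dist_real_def dist_self)
  have main: "norm (T v x - T u x) < e" if "0 \<le> u" "u \<le> v" "v \<le> a + 1" "v - u < d" for u v
  proof -
    have "T v x - T u x = T u (T (v - u) x - x)"
      using semigroup_add[of u "v - u"] that by (simp add: blinfun.diff_right)
    also have "norm \<dots> \<le> norm (T u) * norm (T (v - u) x - x)" by (rule norm_blinfun)
    also have "\<dots> \<le> K * norm (T (v - u) x - x)" using that by (intro mult_right_mono K(2)) auto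
    also have "\<dots> < K * (e / K)" using that by (intro mult_strict_left_mono d(2) K(1)) auto
    finally show ?thesis using K(1) by simp
  qed
  show "\<exists>d>0. \<forall>s\<in>{0..}. dist s a < d \<longrightarrow> dist (T s x) (T a x) < e"
  proof (intro exI[of _ "min d 1"] conjI ballI impI)
    fix s assume "s \<in> {0..}" "dist s a < min d 1"
    then show "dist (T s x) (T a x) < e"
      using main[of s a] main[of a s] a by (cases "s \<le> a") (auto simp: dist_norm norm_minus_commute abs_if split: if_splits)
  qed (use d in auto)
qed

text \<open>\<open>T\<close> is continuous only strongly, so the argument is frozen first:
  \<open>T (g s) (f s - f a)\<close> is small by local boundedness, and the rest is strong
  continuity at the fixed vector \<open>f a\<close>.\<close>

lemma semigroup_continuous_on_apply:
  assumes g: "continuous_on S g" "\<And>s. s \<in> S \<Longrightarrow> 0 \<le> g s" and f: "continuous_on S f"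
  shows "continuous_on S (\<lambda>s. T (g s) (f s))"
  unfolding continuous_on_def
proof
  fix a assume a: "a \<in> S"
  obtain K where K: "K > 0" "\<And>s. 0 \<le> s \<Longrightarrow> s \<le> g a + 1 \<Longrightarrow> norm (T s) \<le> K" using semigroup_bounded by blast
  have "(g \<longlongrightarrow> g a) (at a within S)" using g a by (simp add: continuous_on_def)
  then have "\<forall>\<^sub>F s in at a within S. g s < g a + 1" by (rule order_tendstoD) simp
  then have ev: "\<forall>\<^sub>F s in at a within S. norm (T (g s) (f s - f a)) \<le> K * norm (f s - f a)"
  proof -
    assume e: "\<forall>\<^sub>F s in at a within S. g s < g a + 1"
    have "\<forall>\<^sub>F s in at a within S. s \<in> S" by (simp add: eventually_at_filter)
    with e show ?thesis
    proof eventually_elim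
      case (elim s)
      have "norm (T (g s) (f s - f a)) \<le> norm (T (g s)) * norm (f s - f a)" by (rule norm_blinfun)
      also have "\<dots> \<le> K * norm (f s - f a)" using elim g by (intro mult_right_mono K(2)) auto
      finally show ?case .
    qed
  qed
  have "((\<lambda>s. K * norm (f s - f a)) \<longlongrightarrow> K * norm (f a - f a)) (at a within S)"
    using f a by (intro tendsto_intros) (simp add: continuous_on_def)
  then have 1: "((\<lambda>s. T (g s) (f s - f a)) \<longlongrightarrow> 0) (at a within S)"
    by (intro Lim_null_comparison[OF ev]) simp
  have "continuous_on S (\<lambda>s. T (g s) (f a))"
    using continuous_on_compose2[OF semigroup_continuous g(1)] g(2) by auto
  then have 2: "((\<lambda>s. T (g s) (f a)) \<longlongrightarrow> T (g a) (f a)) (at a within S)"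
    using a by (simp add: continuous_on_def)
  show "((\<lambda>s. T (g s) (f s)) \<longlongrightarrow> T (g a) (f a)) (at a within S)"
    using tendsto_add[OF 1 2] by (simp add: blinfun.diff_right)
qed

end

text \<open>On the domain of \<open>A\<^sup>*\<close> the map \<open>t \<mapsto> T\<^sub>t\<^sup>* y\<close> is Lipschitz near \<open>0\<close>. The estimate
  is obtained by telescoping over a fine grid, which only needs the right derivative of \<open>T\<close> at \<open>0\<close>.\<close>
lemma generator_weak_lipschitz:
  fixes T :: "real \<Rightarrow> 'h::{real_inner,banach} \<Rightarrow>\<^sub>L 'h"
  assumes T: "strongly_cont_semigroup T" and gen: "is_generator T DA A"
    and z: "\<forall>x\<in>DA. inner (A x) y = inner x z" and x: "x \<in> DA"
    and K: "K \<ge> 0" "\<And>r. 0 \<le> r \<Longrightarrow> r \<le> s \<Longrightarrow> norm (T r) \<le> K" and s: "s > 0"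
  shows "\<bar>inner (T s x - x) y\<bar> \<le> s * K * norm x * norm z"
proof -
  note T0 = semigroup_0[OF T] and Tadd = semigroup_add[OF T]
  have gx: "((\<lambda>h. (1 / h) *\<^sub>R (T h w - w)) \<longlongrightarrow> A w) (at_right 0)" if "w \<in> DA" for w
    using gen that by (auto simp: is_generator_def)
  \<comment> \<open>\<open>T r\<close> preserves the domain and commutes with \<open>A\<close>
    because it commutes with the difference quotients.\<close>
  have TA: "T r w \<in> DA \<and> A (T r w) = T r (A w)" if w: "w \<in> DA" and r: "r \<ge> 0" for r w
  proof -
    have "((\<lambda>h. T r ((1 / h) *\<^sub>R (T h w - w))) \<longlongrightarrow> T r (A w)) (at_right 0)"
      by (intro tendsto_intros gx w)
    then have l: "((\<lambda>h. (1 / h) *\<^sub>R (T h (T r w) - T r w)) \<longlongrightarrow> T r (A w)) (at_right 0)"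
    proof (rule Lim_transform_eventually)
      show "\<forall>\<^sub>F h in at_right 0. T r ((1 / h) *\<^sub>R (T h w - w)) = (1 / h) *\<^sub>R (T h (T r w) - T r w)"
        using eventually_at_right_less[of 0]
      proof eventually_elim
        case (elim h)
        then show ?case using r Tadd[of r h w] Tadd[of h r w] by (simp add: blinfun.scaleR_right blinfun.diff_right add.commute)
      qed
    qed
    then have "T r w \<in> DA" using gen by (auto simp: is_generator_def)
    then show ?thesis using l gx tendsto_unique[OF trivial_limit_at_right_real] by blast
  qed
  define R where "R h = norm (T h x - x - h *\<^sub>R A x)" for h
  have step: "\<bar>inner (T (real n * h) x - x) y\<bar> \<le> real n * (h * (K * norm x * norm z) + K * R h * norm y)"
    if h: "h \<ge> 0" "real n * h \<le> s" for n h
    using h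
  proof (induction n)
    case (Suc n)
    let ?r = "real n * h"
    have r: "0 \<le> ?r" "?r \<le> s" using Suc.prems by (auto simp: algebra_simps)
    have "T (real (Suc n) * h) x = T ?r (T h x)"
      using Tadd[of ?r h x] r h by (simp add: algebra_simps)
    then have eq: "T (real (Suc n) * h) x - x = (T ?r x - x) + h *\<^sub>R A (T ?r x) + T ?r (T h x - x - h *\<^sub>R A x)"
      using TA[OF x r(1)] by (simp add: blinfun.diff_right blinfun.scaleR_right)
    have "\<bar>inner (A (T ?r x)) y\<bar> = \<bar>inner (T ?r x) z\<bar>" using z TA[OF x r(1)] by auto
    also have "\<dots> \<le> norm (T ?r x) * norm z" by (rule Cauchy_Schwarz_ineq2)
    also have "\<dots> \<le> K * norm x * norm z"
      by (intro mult_right_mono order_trans[OF norm_blinfun] K r) auto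
    finally have a: "\<bar>inner (h *\<^sub>R A (T ?r x)) y\<bar> \<le> h * (K * norm x * norm z)"
      using h by (simp add: abs_mult mult_left_mono)
    have "\<bar>inner (T ?r (T h x - x - h *\<^sub>R A x)) y\<bar> \<le> norm (T ?r (T h x - x - h *\<^sub>R A x)) * norm y"
      by (rule Cauchy_Schwarz_ineq2)
    also have "\<dots> \<le> K * R h * norm y" unfolding R_def
      by (intro mult_right_mono order_trans[OF norm_blinfun] K r) auto
    finally have b: "\<bar>inner (T ?r (T h x - x - h *\<^sub>R A x)) y\<bar> \<le> K * R h * norm y" .
    have "\<bar>inner (T (real (Suc n) * h) x - x) y\<bar> \<le> \<bar>inner (T ?r x - x) y\<bar> + h * (K * norm x * norm z) + K * R h * norm y"
      unfolding eq inner_add_left using a b by linarith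
    also have "\<dots> \<le> real n * (h * (K * norm x * norm z) + K * R h * norm y) + h * (K * norm x * norm z) + K * R h * norm y"
      using Suc.IH[OF h(1) r(2)] by simp
    finally show ?case by (simp add: algebra_simps)
  qed (simp add: T0)
  have lim: "((\<lambda>h. R h / h) \<longlongrightarrow> 0) (at_right 0)"
  proof -
    have "((\<lambda>h. norm ((1 / h) *\<^sub>R (T h x - x) - A x)) \<longlongrightarrow> norm (A x - A x)) (at_right 0)"
      by (intro tendsto_intros gx x)
    then have "((\<lambda>h. norm ((1 / h) *\<^sub>R (T h x - x) - A x)) \<longlongrightarrow> 0) (at_right 0)" by simp
    then show ?thesis
    proof (rule Lim_transform_eventually)
      show "\<forall>\<^sub>F h in at_right 0. norm ((1 / h) *\<^sub>R (T h x - x) - A x) = R h / h"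
        using eventually_at_right_less[of 0]
      proof eventually_elim
        case (elim h)
        have "(1 / h) *\<^sub>R (T h x - x) - A x = (1 / h) *\<^sub>R (T h x - x - h *\<^sub>R A x)"
          using elim by (simp add: scaleR_diff_right)
        then show ?case using elim by (simp add: R_def)
      qed
    qed
  qed
  \<comment> \<open>n + 1 steps of this length reach \<open>s\<close> exactly; the summed remainders
    are at most s * K * (R h / h) * norm y and vanish in the limit.\<close>
  define h where "h n = s / real (Suc n)" for n
  have hpos: "h n > 0" for n using s by (simp add: h_def)
  have h0: "h \<longlonglongrightarrow> 0"
    using tendsto_mult[OF tendsto_const[of s] LIMSEQ_inverse_real_of_nat] by (simp add: h_def[abs_def] divide_inverse)
  have "filterlim h (at_right 0) sequentially"
    using h0 hpos by (simp add: filterlim_at less_imp_neq[symmetric])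
  then have Rh: "(\<lambda>n. R (h n) / h n) \<longlonglongrightarrow> 0" using lim filterlim_compose by blast
  have "\<bar>inner (T s x - x) y\<bar> \<le> s * (K * norm x * norm z) + s * K * (R (h n) / h n) * norm y" for n
  proof -
    have e: "real (Suc n) * h n = s" by (simp add: h_def)
    have e': "real (Suc n) = s / h n" using s by (simp add: h_def)
    have "\<bar>inner (T s x - x) y\<bar> \<le> real (Suc n) * (h n * (K * norm x * norm z) + K * R (h n) * norm y)"
      using step[of "h n" "Suc n"] hpos[of n] unfolding e by simp
    also have "\<dots> = real (Suc n) * h n * (K * norm x * norm z) + real (Suc n) * (K * R (h n) * norm y)"
      by (simp only: distrib_left mult.assoc)
    also have "\<dots> = s * (K * norm x * norm z) + s / h n * (K * R (h n) * norm y)"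
      unfolding e using e' by simp
    finally show ?thesis by (simp add: field_simps)
  qed
  moreover have "(\<lambda>n. s * (K * norm x * norm z) + s * K * (R (h n) / h n) * norm y)
      \<longlonglongrightarrow> s * (K * norm x * norm z) + s * K * 0 * norm y" by (intro tendsto_intros Rh)
  ultimately have "\<bar>inner (T s x - x) y\<bar> \<le> s * (K * norm x * norm z) + s * K * 0 * norm y"
    by (intro LIMSEQ_le_const) auto
  then show ?thesis by (simp add: mult.assoc)
qed

text \<open>Taking adjoints only reverses the semigroup law. For strong continuity, the Lipschitz
  estimate handles the dense set \<open>adj_domain DA A\<close>, and the norm bound near 0 carries
  it over to all \<open>y\<close>.\<close>

lemma adj_semigroup:
  fixes T :: "real \<Rightarrow> 'h::{real_inner,banach} \<Rightarrow>\<^sub>L 'h"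
  assumes T: "strongly_cont_semigroup T" and gen: "is_generator T DA A"
    and dense: "closure DA = UNIV" "closure (adj_domain DA A) = UNIV"
  shows "strongly_cont_semigroup (\<lambda>t. adj (T t))"
  unfolding strongly_cont_semigroup_def
proof (intro conjI allI impI)
  show "adj (T 0) = id_blinfun" using T by (simp add: strongly_cont_semigroup_def adj_id)
  fix s t :: real assume "0 \<le> s" "0 \<le> t"
  then have "T (t + s) = T t o\<^sub>L T s" using T by (simp add: strongly_cont_semigroup_def)
  then show "adj (T (s + t)) = adj (T s) o\<^sub>L adj (T t)" by (simp add: adj_compose add.commute)
next
  fix y
  obtain K where K: "K > 0" "\<And>s. 0 \<le> s \<Longrightarrow> s \<le> 1 \<Longrightarrow> norm (T s) \<le> K" using semigroup_bounded[OF T] by blast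
  have lip: "norm (adj (T s) w - w) \<le> s * K * norm z"
    if z: "\<forall>x\<in>DA. inner (A x) w = inner x z" and s: "0 < s" "s \<le> 1" for w z s
  proof (rule norm_le_inner_bound)
    fix x
    have "closed {x. \<bar>inner x (adj (T s) w - w)\<bar> \<le> s * K * norm z * norm x}"
      by (intro closed_Collect_le continuous_intros)
    moreover have "DA \<subseteq> {x. \<bar>inner x (adj (T s) w - w)\<bar> \<le> s * K * norm z * norm x}"
    proof clarify
      fix x assume x: "x \<in> DA"
      have "inner x (adj (T s) w - w) = inner (T s x - x) w"
        by (simp add: inner_diff_left inner_diff_right adj_inner)
      then show "\<bar>inner x (adj (T s) w - w)\<bar> \<le> s * K * norm z * norm x"
        using generator_weak_lipschitz[OF T gen z x _ _ s(1), of K] K s by (simp add: mult_ac)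
    qed
    ultimately have "closure DA \<subseteq> {x. \<bar>inner x (adj (T s) w - w)\<bar> \<le> s * K * norm z * norm x}"
      by (rule closure_minimal[rotated])
    then show "\<bar>inner x (adj (T s) w - w)\<bar> \<le> s * K * norm z * norm x" using dense by auto
  qed (use s K in simp)
  show "((\<lambda>t. adj (T t) y) \<longlongrightarrow> y) (at_right 0)"
  proof (rule tendstoI)
    fix e :: real assume e: "e > 0"
    have "y \<in> closure (adj_domain DA A)" using dense by simp
    then obtain w where w: "w \<in> adj_domain DA A" "dist w y < e / (2 * (K + 1))"
      using e K(1) unfolding closure_approachable by (metis add_pos_pos divide_pos_pos mult_pos_pos zero_less_numeral zero_less_one)
    then obtain z where z: "\<forall>x\<in>DA. inner (A x) w = inner x z" by (auto simp: adj_domain_def)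
    \<comment> \<open>Makes \<open>t * (K * norm z)\<close> smaller than e/2 for t < d; the added 1
      keeps the denominator positive when \<open>z\<close> is 0.\<close>
    define d where "d = min 1 (e / (2 * (K * norm z + 1)))"
    have Kz: "K * norm z + 1 > 0" using K by (simp add: add_nonneg_pos)
    have d: "d > 0" using e Kz by (simp add: d_def)
    show "\<forall>\<^sub>F t in at_right 0. dist (adj (T t) y) y < e"
      unfolding eventually_at_right_field
    proof (intro exI conjI allI impI)
      show "0 < d" by fact
      fix t assume t: "0 < t" "t < d"
      then have t1: "t \<le> 1" by (simp add: d_def)
      have "adj (T t) y - y = adj (T t) (y - w) + (adj (T t) w - w) + (w - y)" by (simp add: blinfun.diff_right)
      then have "norm (adj (T t) y - y) \<le> norm (adj (T t) (y - w)) + norm (adj (T t) w - w) + norm (w - y)"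
        by (metis (no_types, lifting) norm_triangle_ineq norm_triangle_mono order_refl)
      also have "norm (adj (T t) (y - w)) \<le> K * norm (y - w)"
        using K(2)[of t] t t1 norm_adj_le[of "T t"] by (intro order_trans[OF norm_blinfun] mult_right_mono) auto
      also have "norm (adj (T t) w - w) \<le> t * (K * norm z)" using lip[OF z t(1) t1] by (simp add: mult_ac)
      also have "t * (K * norm z) < e / 2"
      proof -
        have "t * (K * norm z) \<le> t * (K * norm z + 1)" using t by (intro mult_left_mono) auto
        also have "\<dots> < e / (2 * (K * norm z + 1)) * (K * norm z + 1)"
          using t Kz by (intro mult_strict_right_mono) (auto simp: d_def)
        also have "\<dots> = e / 2" using Kz by (simp add: field_simps)
        finally show ?thesis .
      qed
      also have "K * norm (y - w) + e / 2 + norm (w - y) = (K + 1) * dist w y + e / 2"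
        by (simp add: dist_norm norm_minus_commute algebra_simps)
      also have "(K + 1) * dist w y < e / 2"
        using w(2) K(1) by (simp add: field_simps)
      finally show "dist (adj (T t) y) y < e" by (simp add: dist_norm)
    qed
  qed
qed

section \<open>Lower integrals and one-dimensional Gaussian integrals\<close>

text \<open>\<open>f\<close> may be non-measurable: its \<open>integral\<^sup>N\<close> is a
  supremum over simple functions below it, and countably many of these already exhaust the
  supremum.\<close>

lemma nn_integral_measurable_minorant:
  obtains g where "g \<in> borel_measurable M" "\<And>x. g x \<le> f x" "integral\<^sup>N M g = integral\<^sup>N M f"
proof -
  let ?S = "{g. simple_function M g \<and> g \<le> f}"
  have "?S \<noteq> {}" by (auto intro!: exI[of _ "\<lambda>_. 0"] simp: le_fun_def)
  from ennreal_SUP_countable_SUP[OF this, of "integral\<^sup>S M"]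
  obtain F :: "nat \<Rightarrow> ennreal" where F: "range F \<subseteq> integral\<^sup>S M ` ?S" "(SUP g\<in>?S. integral\<^sup>S M g) = (SUP n. F n)"
    by blast
  then have "\<exists>g. \<forall>n. g n \<in> ?S \<and> F n = integral\<^sup>S M (g n)"
    by (intro choice) (auto simp: image_subset_iff)
  then obtain g where g: "\<And>n. g n \<in> ?S" "\<And>n. F n = integral\<^sup>S M (g n)" by auto
  let ?G = "\<lambda>x. SUP n. g n x"
  have m: "?G \<in> borel_measurable M"
    using g(1) by (intro borel_measurable_SUP) (auto intro: borel_measurable_simple_function)
  have le: "?G x \<le> f x" for x
    using g(1) by (intro SUP_least) (auto simp: le_fun_def)
  have "integral\<^sup>N M f = (SUP n. F n)" using F(2) by (simp add: nn_integral_def)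
  also have "\<dots> \<le> integral\<^sup>N M ?G"
  proof (rule SUP_least)
    fix n
    have "F n = integral\<^sup>N M (g n)" using g by (simp add: nn_integral_eq_simple_integral)
    also have "\<dots> \<le> integral\<^sup>N M ?G" by (intro nn_integral_mono SUP_upper) simp
    finally show "F n \<le> integral\<^sup>N M ?G" .
  qed
  finally have "integral\<^sup>N M f \<le> integral\<^sup>N M ?G" .
  moreover have "integral\<^sup>N M ?G \<le> integral\<^sup>N M f" by (intro nn_integral_mono le)
  ultimately show ?thesis using that[of ?G] m le by auto
qed

text \<open>The integral of the possibly non-measurable \<open>k\<close> is only a lower integral, so smallness near
  \<open>0\<close> is stated for measurable minorants.\<close>
lemma lower_integral_small_near_0:
  fixes k :: "real \<Rightarrow> ennreal"
  assumes fin: "(\<integral>\<^sup>+ s\<in>{0<..t}. k s \<partial>lborel) < \<infinity>" and t: "t > 0" and e: "e > (0::real)"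
  obtains d where "0 < d" "d \<le> t"
    "\<And>p. p \<in> borel_measurable borel \<Longrightarrow> (\<And>s. 0 < s \<Longrightarrow> s \<le> d \<Longrightarrow> p s \<le> k s) \<Longrightarrow>
      (\<integral>\<^sup>+ s\<in>{0<..d}. p s \<partial>lborel) \<le> ennreal e"
proof -
  let ?k = "\<lambda>s. k s * indicator {0<..t} s"
  obtain g where g[measurable]: "g \<in> borel_measurable lborel" and gk: "\<And>s. g s \<le> ?k s"
    and gi: "integral\<^sup>N lborel g = integral\<^sup>N lborel ?k"
    by (rule nn_integral_measurable_minorant[of lborel ?k]) auto
  have gfin: "integral\<^sup>N lborel g < \<infinity>" using fin gi by simp
  have "(\<lambda>n. \<integral>\<^sup>+ s. g s * indicator {0<..inverse (real (Suc n))} s \<partial>lborel) \<longlonglongrightarrow> (\<integral>\<^sup>+ (s::real). 0 \<partial>lborel)"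
  proof (rule nn_integral_dominated_convergence[where w = g])
    show "AE s in lborel. (\<lambda>n. g s * indicator {0<..inverse (real (Suc n))} s) \<longlonglongrightarrow> 0"
    proof (intro AE_I2)
      fix s :: real
      have "\<forall>\<^sub>F n in sequentially. g s * indicator {0<..inverse (real (Suc n))} s = 0"
      proof (cases "s > 0")
        case True
        then have "\<forall>\<^sub>F n in sequentially. inverse (real (Suc n)) < s"
          using LIMSEQ_inverse_real_of_nat by (rule order_tendstoD(2)[rotated])
        then show ?thesis by eventually_elim (auto split: split_indicator)
      qed (auto split: split_indicator)
      then show "(\<lambda>n. g s * indicator {0<..inverse (real (Suc n))} s) \<longlonglongrightarrow> 0"
        by (rule tendsto_eventually)
    qed
    show "AE s in lborel. g s * indicator {0<..inverse (real (Suc n))} s \<le> g s" for n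
      by (auto split: split_indicator)
  qed (use gfin in auto)
  then have e1: "\<forall>\<^sub>F n in sequentially. (\<integral>\<^sup>+ s. g s * indicator {0<..inverse (real (Suc n))} s \<partial>lborel) < ennreal e"
    using e by (intro order_tendstoD(2)) auto
  have e2: "\<forall>\<^sub>F n in sequentially. inverse (real (Suc n)) < t"
    using LIMSEQ_inverse_real_of_nat t by (rule order_tendstoD(2))
  obtain n where n: "(\<integral>\<^sup>+ s. g s * indicator {0<..inverse (real (Suc n))} s \<partial>lborel) < ennreal e"
    "inverse (real (Suc n)) < t"
    using eventually_happens'[OF sequentially_bot eventually_conj[OF e1 e2]] by blast
  define d where "d = inverse (real (Suc n))"
  have d: "0 < d" "d \<le> t" using n by (auto simp: d_def)
  have "(\<integral>\<^sup>+ s\<in>{0<..d}. p s \<partial>lborel) \<le> ennreal e"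
    if p[measurable]: "p \<in> borel_measurable borel" and pk: "\<And>s. 0 < s \<Longrightarrow> s \<le> d \<Longrightarrow> p s \<le> k s" for p
  proof -
    \<comment> \<open>The maximum of \<open>g\<close> and the restricted \<open>p\<close> is again a
      measurable minorant, so its integral does not exceed that of \<open>g\<close>, which is
      maximal; cancelling the finite mass outside \<open>{0<..d}\<close> compares \<open>p\<close>
      with \<open>g\<close> there.\<close>
    define h where "h s = max (g s) (p s * indicator {0<..d} s)" for s
    have [measurable]: "h \<in> borel_measurable lborel" unfolding h_def by simp
    have "h s \<le> ?k s" for s
      using gk[of s] pk[of s] d by (auto simp: h_def split: split_indicator)
    then have hg: "integral\<^sup>N lborel h \<le> integral\<^sup>N lborel g" unfolding gi by (intro nn_integral_mono)
    have split: "integral\<^sup>N lborel f = (\<integral>\<^sup>+ s. f s * indicator {0<..d} s \<partial>lborel) + (\<integral>\<^sup>+ s. f s * indicator (- {0<..d}) s \<partial>lborel)"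
      if [measurable]: "f \<in> borel_measurable lborel" for f :: "real \<Rightarrow> ennreal"
      by (subst nn_integral_add[symmetric]) (auto intro!: nn_integral_cong split: split_indicator)
    let ?c = "\<integral>\<^sup>+ s. g s * indicator (- {0<..d}) s \<partial>lborel"
    have cfin: "?c \<noteq> \<top>"
      using gfin split[of g] by (auto simp: top_unique)
    have "(\<integral>\<^sup>+ s. p s * indicator {0<..d} s \<partial>lborel) + ?c
        \<le> (\<integral>\<^sup>+ s. h s * indicator {0<..d} s \<partial>lborel) + (\<integral>\<^sup>+ s. h s * indicator (- {0<..d}) s \<partial>lborel)"
      by (intro add_mono nn_integral_mono) (auto simp: h_def split: split_indicator)
    also have "\<dots> = integral\<^sup>N lborel h" by (rule split[symmetric]) simp
    also have "\<dots> \<le> integral\<^sup>N lborel g" by (rule hg)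
    also have "\<dots> = (\<integral>\<^sup>+ s. g s * indicator {0<..d} s \<partial>lborel) + ?c" by (rule split) simp
    finally have "(\<integral>\<^sup>+ s. p s * indicator {0<..d} s \<partial>lborel) \<le> (\<integral>\<^sup>+ s. g s * indicator {0<..d} s \<partial>lborel)"
      using cfin by (simp add: ennreal_add_left_cancel_le add.commute[of _ ?c])
    also have "\<dots> \<le> ennreal e" using n(1) by (simp add: d_def)
    finally show ?thesis .
  qed
  with d show ?thesis using that by blast
qed

text \<open>Real and imaginary parts of the characteristic function of the standard normal law; the
  phase enters by the addition theorem.\<close>

lemma std_normal_integral_cos:
  "integrable lborel (\<lambda>x. std_normal_density x * cos (q * x + c))" (is ?A)
  "(LINT x|lborel. std_normal_density x * cos (q * x + c)) = exp (- q\<^sup>2 / 2) * cos c" (is ?B)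
proof -
  have b: "integrable lborel (\<lambda>x. std_normal_density x * f x)"
    if [measurable]: "f \<in> borel_measurable borel" and "\<And>x. \<bar>f x\<bar> \<le> 1" for f
    by (rule Bochner_Integration.integrable_bound[OF integrable_normal_density[of 1 0]])
       (use that in "auto simp: abs_mult intro!: AE_I2 mult_left_le")
  show ?A by (intro b) auto
  have ic: "integrable lborel (\<lambda>x. std_normal_density x * cos (q * x))"
    and isn: "integrable lborel (\<lambda>x. std_normal_density x * sin (q * x))" by (intro b; simp)+
  interpret S: real_distribution std_normal_distribution by (rule real_dist_normal_dist)
  have "char std_normal_distribution q = (LINT x|std_normal_distribution. iexp (q * x))" by (simp add: char_def)
  also have "\<dots> = (LINT x|lborel. std_normal_density x *\<^sub>R iexp (q * x))"
    by (subst integral_density) auto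
  also have "\<dots> = (LINT x|lborel. Complex (std_normal_density x * cos (q * x)) (std_normal_density x * sin (q * x)))"
    by (intro Bochner_Integration.integral_cong) (auto simp: complex_eq_iff Re_exp Im_exp)
  finally have ch: "complex_of_real (exp (- q\<^sup>2 / 2)) = \<dots>" by (simp add: char_std_normal_distribution)
  have int: "integrable lborel (\<lambda>x. Complex (std_normal_density x * cos (q * x)) (std_normal_density x * sin (q * x)))"
    using ic isn by (simp add: Complex_eq flip: of_real_mult)
  have C: "(LINT x|lborel. std_normal_density x * cos (q * x)) = exp (- q\<^sup>2 / 2)"
    using arg_cong[OF ch, of Re] integral_Re[OF int] by simp
  have S: "(LINT x|lborel. std_normal_density x * sin (q * x)) = 0"
    using arg_cong[OF ch, of Im] integral_Im[OF int] by simp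
  have "(LINT x|lborel. std_normal_density x * cos (q * x + c))
      = (LINT x|lborel. cos c * (std_normal_density x * cos (q * x)) - sin c * (std_normal_density x * sin (q * x)))"
    by (intro Bochner_Integration.integral_cong) (auto simp: cos_add algebra_simps)
  also have "\<dots> = exp (- q\<^sup>2 / 2) * cos c" using ic isn by (simp add: C S)
  finally show ?B .
qed

text \<open>The absolute first moment is sqrt (2 / pi); rounding it up to 1 is why the later
  derivative bound carries no constant.\<close>

lemma std_normal_integral_abs_le:
  "integrable lborel (\<lambda>x. std_normal_density x * \<bar>x\<bar>)"
  "(LINT x|lborel. std_normal_density x * \<bar>x\<bar>) \<le> 1"
proof -
  show "integrable lborel (\<lambda>x. std_normal_density x * \<bar>x\<bar>)"
    using integrable_std_normal_moment_abs[of 1] by simp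
  have "(LINT x|lborel. std_normal_density x * \<bar>x\<bar>) = sqrt (2 / pi)"
    using integral_std_normal_moment_abs_odd[of 0] by simp
  also have "\<dots> \<le> 1" using pi_gt3 by simp
  finally show "(LINT x|lborel. std_normal_density x * \<bar>x\<bar>) \<le> 1" .
qed

text \<open>Gaussian integration by parts. The derivative of the density is -x times the density, so
  minus density times cosine is a primitive of the integrand plus \<open>q\<close> times a known
  sine integral, and it vanishes at both infinities.\<close>

lemma std_normal_integral_x_cos:
  "integrable lborel (\<lambda>x. std_normal_density x * x * cos (q * x + c))" (is ?A)
  "(LINT x|lborel. std_normal_density x * x * cos (q * x + c)) = - q * exp (- q\<^sup>2 / 2) * sin c" (is ?B)
proof -
  show A: ?A
    by (rule Bochner_Integration.integrable_bound[OF std_normal_integral_abs_le(1)])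
       (auto simp: abs_mult intro!: AE_I2 mult_left_le)
  have s: "integrable lborel (\<lambda>x. std_normal_density x * sin (q * x + c))"
    "(LINT x|lborel. std_normal_density x * sin (q * x + c)) = exp (- q\<^sup>2 / 2) * sin c"
  proof -
    have "cos (q * x + (c - pi / 2)) = sin (q * x + c)" for x
      using cos_diff[of "q * x + c" "pi / 2"] by (simp add: algebra_simps)
    moreover have "cos (c - pi / 2) = sin c" by (simp add: cos_diff)
    ultimately show "integrable lborel (\<lambda>x. std_normal_density x * sin (q * x + c))"
      "(LINT x|lborel. std_normal_density x * sin (q * x + c)) = exp (- q\<^sup>2 / 2) * sin c"
      using std_normal_integral_cos[of q "c - pi/2"] by simp_all
  qed
  let ?F = "\<lambda>x. - std_normal_density x * cos (q * x + c)"
  let ?f = "\<lambda>x. std_normal_density x * x * cos (q * x + c) + q * (std_normal_density x * sin (q * x + c))"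
  have d: "(?F has_vector_derivative ?f x) (at x)" for x
  proof -
    define k where "k = 1 / sqrt (2 * pi)"
    show ?thesis
      unfolding has_real_derivative_iff_has_vector_derivative[symmetric] std_normal_density_def k_def[symmetric]
      by (auto intro!: derivative_eq_intros simp: algebra_simps)
  qed
  have c: "isCont ?f x" for x unfolding std_normal_density_def by (intro continuous_intros) auto
  have lim: "((\<lambda>x. ?F x) \<longlongrightarrow> 0) F" if "(std_normal_density \<longlongrightarrow> 0) F" for F
    using that by (rule Lim_null_comparison[rotated]) (auto simp: abs_mult intro!: always_eventually mult_left_le)
  have top: "(std_normal_density \<longlongrightarrow> 0) at_top"
  proof -
    have "filterlim (\<lambda>x::real. x^2 * (1/2)) at_top at_top"
      by (intro filterlim_at_top_mult_tendsto_pos[OF tendsto_const] filterlim_pow_at_top filterlim_ident) auto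
    then have "filterlim (\<lambda>x::real. - (x^2 * (1/2))) at_bot at_top" by (simp add: filterlim_uminus_at_bot)
    then have "((\<lambda>x::real. exp (- (x^2 * (1/2)))) \<longlongrightarrow> 0) at_top"
      by (rule filterlim_compose[OF exp_at_bot])
    from tendsto_mult[OF tendsto_const this, of "1 / sqrt (2 * pi)"]
    show ?thesis by (simp add: std_normal_density_def[abs_def])
  qed
  have "(std_normal_density \<longlongrightarrow> 0) at_bot"
    unfolding filterlim_at_bot_mirror using top by (simp add: std_normal_density_def[abs_def])
  note top this
  then have l: "((?F \<circ> real_of_ereal) \<longlongrightarrow> 0) (at_right (-\<infinity>))" "((?F \<circ> real_of_ereal) \<longlongrightarrow> 0) (at_left \<infinity>)"
    using lim by (simp_all add: ereal_tendsto_simps)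
  have "(LBINT x=-\<infinity>..\<infinity>. ?f x) = 0 - 0"
    by (rule interval_integral_FTC_integrable[OF _ d c _ l]) (use A s in "auto simp: set_integrable_def")
  then have "(LINT x|lborel. ?f x) = 0" by (simp add: interval_lebesgue_integral_def set_lebesgue_integral_def)
  then show ?B using A s by simp
qed

section \<open>Trigonometric sums\<close>

text \<open>Entries are amplitude, frequency and phase. Frequency 0 gives the constants, and with
  free phases the class is closed under products, hence an algebra.\<close>

definition trig :: "(real \<times> 'h::real_inner \<times> real) list \<Rightarrow> 'h \<Rightarrow> real" where
  "trig l y = (\<Sum>(a, h, c)\<leftarrow>l. a * cos (inner y h + c))"

lemma trig_Nil [simp]: "trig [] y = 0"
  and trig_Cons [simp]: "trig ((a, h, c) # l) y = a * cos (inner y h + c) + trig l y"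
  by (simp_all add: trig_def)

lemma trig_continuous: "continuous_on S (trig l)"
  unfolding trig_def[abs_def]
  by (induction l) (auto simp: case_prod_beta intro!: continuous_intros)

lemma trig_measurable [measurable]: "trig l \<in> borel_measurable borel"
  by (intro borel_measurable_continuous_onI trig_continuous)

lemma trig_bounded: "\<exists>C. \<forall>y. \<bar>trig l y\<bar> \<le> C"
proof (induction l)
  case (Cons x l)
  obtain a h c where x: "x = (a, h, c)" by (cases x)
  obtain C where "\<forall>y. \<bar>trig l y\<bar> \<le> C" using Cons by blast
  then have "\<bar>trig (x # l) y\<bar> \<le> \<bar>a\<bar> + C" for y
    by (simp add: x) (intro order_trans[OF abs_triangle_ineq] add_mono, auto simp: abs_mult intro!: mult_left_le)
  then show ?case by blast
qed (auto intro: exI[of _ 0])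

lemma trig_append: "trig (l @ l') y = trig l y + trig l' y"
  by (simp add: trig_def)

lemma trig_scale: "trig (map (\<lambda>(a, h, c). (k * a, h, c)) l) y = k * trig l y"
  by (induction l) (auto simp: algebra_simps)

text \<open>The product-to-sum formula for cosines, term by term; Stone-Weierstrass requires this
  closure.\<close>

lemma trig_mult: "\<exists>l''. \<forall>y. trig l'' y = trig l y * trig l' y"
proof -
  have single: "\<exists>l''. \<forall>y. trig l'' y = a * cos (inner y h + c) * trig l' y" for a h c l'
  proof (induction l')
    case (Cons x l')
    obtain b k d where x: "x = (b, k, d)" by (cases x)
    obtain m where m: "\<forall>y. trig m y = a * cos (inner y h + c) * trig l' y" using Cons by blast
    have "trig ((a * b / 2, h + k, c + d) # (a * b / 2, h - k, c - d) # m) y = a * cos (inner y h + c) * trig (x # l') y" for y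
    proof -
      have e: "cos (inner y (h + k) + (c + d)) = cos ((inner y h + c) + (inner y k + d))"
        "cos (inner y (h - k) + (c - d)) = cos ((inner y h + c) - (inner y k + d))"
        by (simp_all add: inner_add_right inner_diff_right algebra_simps)
      have "p * q / 2 * cos (u + v) + p * q / 2 * cos (u - v) = p * cos u * (q * cos v)" for p q u v :: real
        by (simp add: cos_add cos_diff algebra_simps)
      from this[of a b "inner y h + c" "inner y k + d"] show ?thesis
        unfolding x trig_Cons m[rule_format] e distrib_left by linarith
    qed
    then show ?case by blast
  qed (auto intro: exI[of _ "[]"])
  show ?thesis
  proof (induction l)
    case (Cons x l)
    obtain a h c where x: "x = (a, h, c)" by (cases x)
    obtain m1 m2 where "\<forall>y. trig m1 y = a * cos (inner y h + c) * trig l' y"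
      "\<forall>y. trig m2 y = trig l y * trig l' y" using Cons single by metis
    then have "\<forall>y. trig (m1 @ m2) y = trig (x # l) y * trig l' y" by (simp add: x trig_append algebra_simps)
    then show ?case by blast
  qed (auto intro: exI[of _ "[]"])
qed

text \<open>Averaging over a Gaussian displacement along \<open>v\<close> only rescales amplitudes;
  the additional weight \<open>x\<close> produces the derivative of that average in direction
  \<open>v\<close>.\<close>

lemma std_normal_integral_trig:
  shows "(LINT x|lborel. std_normal_density x * trig l (m + x *\<^sub>R v))
      = trig (map (\<lambda>(a, h, c). (a * exp (- (inner v h)\<^sup>2 / 2), h, c)) l) m" (is ?A)
    and "(LINT x|lborel. std_normal_density x * x * trig l (m + x *\<^sub>R v))
      = (\<Sum>(a, h, c)\<leftarrow>l. - (a * inner v h * exp (- (inner v h)\<^sup>2 / 2) * sin (inner m h + c)))" (is ?B)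
    and "integrable lborel (\<lambda>x. std_normal_density x * trig l (m + x *\<^sub>R v))" (is ?C)
    and "integrable lborel (\<lambda>x. std_normal_density x * x * trig l (m + x *\<^sub>R v))" (is ?D)
proof (induction l)
  case (Cons t l)
  obtain a h c where t: "t = (a, h, c)" by (cases t)
  have e: "inner (m + x *\<^sub>R v) h + c = inner v h * x + (inner m h + c)" for x
    by (simp add: inner_add_left)
  note C = std_normal_integral_cos[of "inner v h" "inner m h + c"]
  note X = std_normal_integral_x_cos[of "inner v h" "inner m h + c"]
  have eqs: "std_normal_density x * trig (t # l) (m + x *\<^sub>R v)
      = a * (std_normal_density x * cos (inner v h * x + (inner m h + c))) + std_normal_density x * trig l (m + x *\<^sub>R v)"
    "std_normal_density x * x * trig (t # l) (m + x *\<^sub>R v)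
      = a * (std_normal_density x * x * cos (inner v h * x + (inner m h + c))) + std_normal_density x * x * trig l (m + x *\<^sub>R v)" for x
    unfolding t trig_Cons e by (simp_all add: algebra_simps)
  { case 1 show ?case unfolding eqs using C Cons(1,3) by (simp add: t) }
  { case 2 show ?case unfolding eqs using X Cons(2,4) by (simp add: t) }
  { case 3 show ?case unfolding eqs using C Cons(3) by simp }
  { case 4 show ?case unfolding eqs using X Cons(4) by simp }
qed simp_all

lemma std_normal_average_le:
  assumes f: "\<And>x. \<bar>f x\<bar> \<le> C" and int: "integrable lborel (\<lambda>x. std_normal_density x * f x)"
  shows "\<bar>LINT x|lborel. std_normal_density x * f x\<bar> \<le> C"
proof -
  have "\<bar>LINT x|lborel. std_normal_density x * f x\<bar> \<le> (LINT x|lborel. \<bar>std_normal_density x * f x\<bar>)"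
    by (rule integral_abs_bound)
  also have "\<dots> \<le> (LINT x|lborel. std_normal_density x * C)"
    using f by (intro integral_mono[OF integrable_abs[OF int]]) (auto simp: abs_mult mult_left_mono)
  also have "\<dots> = C" by simp
  finally show ?thesis .
qed

section \<open>Dimension-free Gaussian bounds for trigonometric sums\<close>

text \<open>Read as a Gaussian with variance norm (L h)^2 in direction \<open>h\<close>, this
  separates the one-dimensional part along \<open>adj L e\<close> from an independent remainder
  given by \<open>L'\<close>.\<close>

lemma split_off_direction:
  fixes L :: "'h::{real_inner,banach} \<Rightarrow>\<^sub>L 'h"
  assumes e: "inner e e = 1"
  obtains L' where "\<And>h. blinfun_apply L' h = L h - inner e (L h) *\<^sub>R e"
    "\<And>h. (norm (L h))\<^sup>2 = (inner (adj L e) h)\<^sup>2 + (norm (L' h))\<^sup>2"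
proof
  let ?L' = "(id_blinfun - (blinfun_scaleR_left e o\<^sub>L blinfun_inner_left e)) o\<^sub>L L"
  show L': "?L' h = L h - inner e (L h) *\<^sub>R e" for h
    by (simp add: blinfun.diff_left inner_commute)
  show "(norm (L h))\<^sup>2 = (inner (adj L e) h)\<^sup>2 + (norm (?L' h))\<^sup>2" for h
    unfolding adj_inner' power2_norm_eq_inner L'
    by (simp add: inner_diff_left inner_diff_right e inner_commute power2_eq_square)
qed

text \<open>The damping is that of averaging over a centred Gaussian with variance norm (L h)^2 in
  direction \<open>h\<close>. A finite sum sees only finitely many frequencies, so finitely many
  one-dimensional averages, none of which increases the sup bound, achieve it.\<close>

lemma gaussian_smoothing_bound:
  fixes L :: "'h::{real_inner,banach} \<Rightarrow>\<^sub>L 'h"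
  assumes "\<And>y. \<bar>trig l y\<bar> \<le> C"
  shows "\<bar>trig (map (\<lambda>(a, h, c). (a * exp (- (norm (L h))\<^sup>2 / 2), h, c)) l) y\<bar> \<le> C"
  using assms
proof (induction "card {h \<in> (\<lambda>(a, h, c). h) ` set l. L h \<noteq> 0}" arbitrary: L l y rule: less_induct)
  case less
  let ?N = "\<lambda>L l. {h \<in> (\<lambda>(a, h, c). h) ` set l. blinfun_apply L h \<noteq> 0}"
  show ?case
  proof (cases "?N L l = {}")
    case True
    then have "map (\<lambda>(a, h, c). (a * exp (- (norm (L h))\<^sup>2 / 2), h, c)) l = l"
      by (intro map_idI) force
    then show ?thesis using less.prems by metis
  next
    case False
    then obtain h0 where h0: "h0 \<in> (\<lambda>(a, h, c). h) ` set l" "L h0 \<noteq> 0" by blast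
    \<comment> \<open>Splitting off the direction of \<open>L h0\<close> makes \<open>L' h0\<close>
      vanish, and \<open>L' h\<close> is 0 wherever \<open>L h\<close> is, so the induction measure
      drops.\<close>
    define e where "e = (1 / norm (L h0)) *\<^sub>R L h0"
    have ee: "inner e e = 1" using h0 by (simp add: e_def power2_norm_eq_inner[symmetric] power2_eq_square)
    define l' where "l' = map (\<lambda>(a, h, c). (a * exp (- (inner (adj L e) h)\<^sup>2 / 2), h, c)) l"
    obtain L' where L': "\<And>h. blinfun_apply L' h = L h - inner e (L h) *\<^sub>R e"
      and nL: "\<And>h. (norm (L h))\<^sup>2 = (inner (adj L e) h)\<^sup>2 + (norm (L' h))\<^sup>2"
      using split_off_direction[OF ee, of L] by blast
    have fst: "(\<lambda>(a, h, c). h) ` set l' = (\<lambda>(a, h, c). h) ` set l" by (force simp: l'_def)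
    have "L' h0 = 0"
    proof -
      have "inner e (L h0) *\<^sub>R e = L h0" using h0 by (simp add: e_def power2_norm_eq_inner[symmetric] power2_eq_square)
      then show ?thesis by (simp add: L')
    qed
    then have "?N L' l' \<subset> ?N L l" using h0 unfolding fst by (force simp: L')
    then have card: "card (?N L' l') < card (?N L l)" by (intro psubset_card_mono) auto
    have "\<bar>trig l' y\<bar> \<le> C" for y
      unfolding l'_def std_normal_integral_trig(1)[symmetric]
      by (rule std_normal_average_le[OF less.prems std_normal_integral_trig(3)])
    from less.hyps[OF card this]
    have "\<bar>trig (map (\<lambda>(a, h, c). (a * exp (- (norm (L' h))\<^sup>2 / 2), h, c)) l') y\<bar> \<le> C" .
    also have "map (\<lambda>(a, h, c). (a * exp (- (norm (L' h))\<^sup>2 / 2), h, c)) l'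
        = map (\<lambda>(a, h, c). (a * exp (- (norm (L h))\<^sup>2 / 2), h, c)) l"
      by (auto simp: l'_def nL mult_exp_exp add_divide_distrib)
    finally show ?thesis .
  qed
qed

text \<open>Splitting off the direction \<open>k\<close> of the Gaussian with covariance \<open>R R\<^sup>*\<close> turns the derivative
  in direction \<open>R k\<close> into multiplication by a one-dimensional Gaussian variable.\<close>
lemma gaussian_derivative_bound:
  fixes R :: "'h::{real_inner,banach} \<Rightarrow>\<^sub>L 'h"
  assumes l: "\<And>y. \<bar>trig l y\<bar> \<le> C"
  shows "\<bar>\<Sum>(a, h, c)\<leftarrow>l. a * inner k (R h) * exp (- (norm (R h))\<^sup>2 / 2) * sin (inner m h + c)\<bar> \<le> norm k * C"
proof (cases "k = 0")
  case True
  then show ?thesis by (induction l) auto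
next
  case False
  define e where "e = (1 / norm k) *\<^sub>R k"
  have ee: "inner e e = 1" using False by (simp add: e_def power2_norm_eq_inner[symmetric] power2_eq_square)
  define v where "v = adj R e"
  obtain L where L: "\<And>h. blinfun_apply L h = R h - inner e (R h) *\<^sub>R e"
    "\<And>h. (norm (R h))\<^sup>2 = (inner (adj R e) h)\<^sup>2 + (norm (L h))\<^sup>2"
    using split_off_direction[OF ee, of R] by blast
  note nR = L(2)[folded v_def]
  have ex: "exp (- ((norm (R h))\<^sup>2 / 2)) = exp (- ((norm (L h))\<^sup>2 / 2)) * exp (- ((inner v h)\<^sup>2 / 2))" for h
    by (simp add: nR mult_exp_exp add_divide_distrib)
  have k: "inner k (R h) = norm k * inner v h" for h
    using False by (simp add: v_def adj_inner' e_def)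
  \<comment> \<open>The directions complementary to \<open>e\<close> are averaged out first, which
    keeps the bound \<open>C\<close>; what remains is a one-dimensional Gaussian along
    \<open>v\<close>.\<close>
  define l' where "l' = map (\<lambda>(a, h, c). (a * exp (- (norm (L h))\<^sup>2 / 2), h, c)) l"
  have l': "\<bar>trig l' y\<bar> \<le> C" for y unfolding l'_def by (rule gaussian_smoothing_bound[OF l])
  have "(\<Sum>(a, h, c)\<leftarrow>l. a * inner k (R h) * exp (- (norm (R h))\<^sup>2 / 2) * sin (inner m h + c))
      = - (norm k * (\<Sum>(a, h, c)\<leftarrow>l'. - (a * inner v h * exp (- (inner v h)\<^sup>2 / 2) * sin (inner m h + c))))"
    unfolding l'_def
    by (induction l) (auto simp: k ex algebra_simps)
  also have "\<bar>\<dots>\<bar> = norm k * \<bar>LINT x|lborel. std_normal_density x * x * trig l' (m + x *\<^sub>R v)\<bar>"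
    by (simp add: std_normal_integral_trig(2) abs_mult)
  also have "\<bar>LINT x|lborel. std_normal_density x * x * trig l' (m + x *\<^sub>R v)\<bar>
      \<le> (LINT x|lborel. \<bar>std_normal_density x * x * trig l' (m + x *\<^sub>R v)\<bar>)"
    by (rule integral_abs_bound)
  also have "\<dots> \<le> (LINT x|lborel. (std_normal_density x * \<bar>x\<bar>) * C)"
    using std_normal_integral_abs_le(1) l'
    by (intro integral_mono[OF integrable_abs[OF std_normal_integral_trig(4)]]) (auto simp: abs_mult mult_left_mono)
  also have "\<dots> \<le> C"
  proof -
    have "C \<ge> 0" using l[of 0] by linarith
    then show ?thesis using std_normal_integral_abs_le(2) by (simp add: mult_left_le_one_le)
  qed
  finally show ?thesis by (simp add: mult_left_mono)
qed

text \<open>Stone--Weierstrass on a compact set carrying almost all mass gives a trigonometric sum with no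
  control off that set; composing it with an approximate truncation (again by Stone--Weierstrass)
  restores the global bound.\<close>
lemma trig_dense:
  fixes \<mu> \<nu> :: "'h::{real_inner,banach,second_countable_topology} measure"
  assumes fin: "finite_measure \<mu>" "finite_measure \<nu>" and sets: "sets \<mu> = sets borel" "sets \<nu> = sets borel"
    and \<psi>: "continuous_on UNIV \<psi>" "\<And>y. \<bar>\<psi> y\<bar> \<le> 1" and e: "e > 0"
  obtains l where "\<And>y. \<bar>trig l y\<bar> \<le> 1" "(LINT y|\<mu>. \<bar>\<psi> y - trig l y\<bar>) \<le> e" "(LINT y|\<nu>. \<bar>\<psi> y - trig l y\<bar>) \<le> e"
proof -
  define mm where "mm = measure \<mu> UNIV + measure \<nu> UNIV + 1"
  have mm: "mm > 0" "measure \<mu> UNIV \<le> mm" "measure \<nu> UNIV \<le> mm"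
    by (auto simp: mm_def add_nonneg_pos)
  \<comment> \<open>Error budget: 3 d against a total mass of at most \<open>mm\<close>, plus 2 on
    the complement of a compact set, of mass at most \<open>d\<close>.\<close>
  define d where "d = e / (3 * mm + 2)"
  have d: "d > 0" "d * (3 * mm + 2) = e" using e mm by (auto simp: d_def)
  have tight: "\<exists>K. compact K \<and> measure \<kappa> (- K) \<le> d" if k: "finite_measure \<kappa>" "sets \<kappa> = sets borel" for \<kappa> :: "'h measure"
  proof -
    interpret finite_measure \<kappa> by fact
    have sp: "space \<kappa> = UNIV" using k(2) sets_eq_imp_space_eq by fastforce
    have "emeasure \<kappa> UNIV = (SUP K \<in> {K. K \<subseteq> UNIV \<and> compact K}. emeasure \<kappa> K)"
      by (rule inner_regular) (use k emeasure_finite in auto)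
    have "\<exists>K. compact K \<and> measure \<kappa> UNIV < measure \<kappa> K + d"
    proof (rule ccontr)
      assume "\<not> ?thesis"
      then have le: "measure \<kappa> K \<le> measure \<kappa> UNIV - d" if "compact K" for K using that by force
      have "0 \<le> measure \<kappa> UNIV - d" using le[of "{}"] by simp
      have "emeasure \<kappa> UNIV \<le> ennreal (measure \<kappa> UNIV - d)"
        unfolding \<open>emeasure \<kappa> UNIV = _\<close> using le by (intro SUP_least) (auto simp: emeasure_eq_measure intro!: ennreal_leI)
      then have "measure \<kappa> UNIV \<le> measure \<kappa> UNIV - d"
        using \<open>0 \<le> measure \<kappa> UNIV - d\<close> by (simp add: emeasure_eq_measure)
      then show False using d by simp
    qed
    then obtain K where K: "compact K" "measure \<kappa> UNIV < measure \<kappa> K + d" by blast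
    have "K \<in> sets \<kappa>" using K k(2) by (auto intro: borel_compact)
    then have "measure \<kappa> (- K) = measure \<kappa> UNIV - measure \<kappa> K"
      using finite_measure_compl[of K] by (simp add: sp Compl_eq_Diff_UNIV)
    then show ?thesis using K by auto
  qed
  obtain K1 K2 where K1: "compact K1" "measure \<mu> (- K1) \<le> d" and K2: "compact K2" "measure \<nu> (- K2) \<le> d"
    using tight fin sets by metis
  define K where "K = K1 \<union> K2"
  have K: "compact K" using K1 K2 by (simp add: K_def compact_Un)
  have "\<exists>g. g \<in> range trig \<and> (\<forall>x\<in>K. \<bar>\<psi> x - g x\<bar> < d)"
  proof (rule Stone_Weierstrass_HOL[OF K, where P = "\<lambda>g. g \<in> range trig"])
    show "(\<lambda>x. c) \<in> range trig" for c by (rule range_eqI[of _ _ "[(c, 0, 0)]"]) auto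
    show "f \<in> range trig \<Longrightarrow> continuous_on K f" for f using trig_continuous by auto
    show "(\<lambda>x. f x + g x) \<in> range trig" if "f \<in> range trig \<and> g \<in> range trig" for f g
    proof -
      from that obtain l l' where "f = trig l" "g = trig l'" by auto
      then show ?thesis by (auto simp: trig_append intro!: range_eqI[of _ _ "l @ l'"])
    qed
    show "(\<lambda>x. f x * g x) \<in> range trig" if "f \<in> range trig \<and> g \<in> range trig" for f g
    proof -
      obtain l l' where "f = trig l" "g = trig l'" using \<open>f \<in> range trig \<and> g \<in> range trig\<close> by auto
      moreover obtain l'' where "\<forall>y. trig l'' y = trig l y * trig l' y" using trig_mult by blast
      ultimately show ?thesis by (auto intro!: range_eqI[of _ _ l''])
    qed
    show "\<exists>f. f \<in> range trig \<and> f x \<noteq> f y" if "x \<in> K \<and> y \<in> K \<and> x \<noteq> y" for x y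
    proof -
      \<comment> \<open>Scaled so that the arguments at \<open>x\<close> and \<open>y\<close> differ
        by pi: the cosine with phase \<open>- inner y h\<close> is 1 at \<open>y\<close> and -1 at
        \<open>x\<close>.\<close>
      define h where "h = (pi / (norm (x - y))\<^sup>2) *\<^sub>R (x - y)"
      have "inner x h - inner y h = inner (x - y) h" by (simp add: inner_diff_left)
      also have "\<dots> = pi" using that by (simp add: h_def power2_norm_eq_inner)
      finally have "trig [(1, h, - inner y h)] x \<noteq> trig [(1, h, - inner y h)] y" by simp
      then show ?thesis by blast
    qed
    show "continuous_on K \<psi>" using \<psi>(1) continuous_on_subset by blast
  qed (use d in auto)
  then obtain l1 where l1: "\<And>x. x \<in> K \<Longrightarrow> \<bar>\<psi> x - trig l1 x\<bar> < d" by auto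
  obtain R where R: "\<And>y. \<bar>trig l1 y\<bar> \<le> R" using trig_bounded by blast
  define clamp where "clamp r = max (-1) (min 1 r)" for r :: real
  \<comment> \<open>The functions whose composition with \<open>trig l1\<close> is again a
    trigonometric sum form an algebra containing the identity, so \<open>clamp\<close> can be
    approximated within it on an interval containing the values of \<open>trig l1\<close>.\<close>
  let ?P = "\<lambda>g. continuous_on UNIV g \<and> (\<lambda>y. g (trig l1 y)) \<in> range trig"
  have "\<exists>g. ?P g \<and> (\<forall>x\<in>{-R..R}. \<bar>clamp x - g x\<bar> < d)"
  proof (rule Stone_Weierstrass_HOL[where P = ?P])
    show "?P (\<lambda>x. c)" for c by (auto intro!: range_eqI[of _ _ "[(c, 0, 0)]"])
    show "?P f \<Longrightarrow> continuous_on {-R..R} f" for f using continuous_on_subset by blast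
    show "?P (\<lambda>x. f x + g x)" if "?P f \<and> ?P g" for f g
    proof -
      from that obtain l l' where "\<And>y. f (trig l1 y) = trig l y" "\<And>y. g (trig l1 y) = trig l' y"
        by (auto simp: fun_eq_iff)
      with that show ?thesis by (auto simp: trig_append intro!: continuous_intros range_eqI[of _ _ "l @ l'"])
    qed
    show "?P (\<lambda>x. f x * g x)" if "?P f \<and> ?P g" for f g
    proof -
      from that obtain l l' where "\<And>y. f (trig l1 y) = trig l y" "\<And>y. g (trig l1 y) = trig l' y"
        by (auto simp: fun_eq_iff)
      moreover obtain l'' where "\<forall>y. trig l'' y = trig l y * trig l' y" using trig_mult by blast
      ultimately show ?thesis using that by (auto intro!: continuous_intros range_eqI[of _ _ l''])
    qed
    show "\<exists>f. ?P f \<and> f x \<noteq> f y" if "x \<in> {-R..R} \<and> y \<in> {-R..R} \<and> x \<noteq> y" for x y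
      using that by (intro exI[of _ "\<lambda>x. x"]) auto
    show "continuous_on {-R..R} clamp" unfolding clamp_def by (intro continuous_intros)
  qed (use d in auto)
  then obtain g where g0: "(\<lambda>y. g (trig l1 y)) \<in> range trig" "\<forall>x\<in>{-R..R}. \<bar>clamp x - g x\<bar> < d" by blast
  obtain l2 where l2: "\<And>y. g (trig l1 y) = trig l2 y" using g0(1) by (auto simp: fun_eq_iff)
  have g: "\<bar>clamp x - g x\<bar> < d" if "\<bar>x\<bar> \<le> R" for x using g0(2) that by (simp add: abs_le_iff)
  define l where "l = map (\<lambda>(a, h, c). ((1 / (1 + d)) * a, h, c)) l2"
  have l: "trig l y = trig l2 y / (1 + d)" for y unfolding l_def trig_scale by simp
  have b2: "\<bar>trig l2 y\<bar> \<le> 1 + d" for y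
    using g[OF R[of y]] unfolding l2 clamp_def by linarith
  have b: "\<bar>trig l y\<bar> \<le> 1" for y using b2[of y] d by (simp add: l)
  have close: "\<bar>trig l2 y - trig l y\<bar> \<le> d" for y
  proof -
    have "trig l2 y - trig l y = d * trig l y" using d by (simp add: l field_simps)
    then show ?thesis using b[of y] d by (simp add: abs_mult mult_left_le)
  qed
  \<comment> \<open>One \<open>d\<close> each for \<open>trig l1\<close> against \<psi>, for
    \<open>g\<close> against \<open>clamp\<close> and for the division by 1 + d; truncation costs
    nothing, as \<psi> has values in [-1,1].\<close>
  have onK: "\<bar>\<psi> y - trig l y\<bar> \<le> 3 * d" if "y \<in> K" for y
    using g[OF R[of y]] l1[OF that] \<psi>(2)[of y] close[of y] unfolding l2 clamp_def by linarith
  have off: "\<bar>\<psi> y - trig l y\<bar> \<le> 2" for y using b[of y] \<psi>(2)[of y] by linarith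
  have est: "(LINT y|\<kappa>. \<bar>\<psi> y - trig l y\<bar>) \<le> e"
    if k: "finite_measure \<kappa>" "sets \<kappa> = sets borel" "measure \<kappa> (- K') \<le> d" "K' \<subseteq> K" "compact K'" "measure \<kappa> UNIV \<le> mm"
    for \<kappa> :: "'h measure" and K'
  proof -
    interpret finite_measure \<kappa> by fact
    have sp: "space \<kappa> = UNIV" using k(2) sets_eq_imp_space_eq by fastforce
    have Ks: "- K' \<in> sets \<kappa>" using k compact_imp_closed[of K'] by (auto intro!: borel_open)
    have [measurable]: "\<psi> \<in> borel_measurable \<kappa>" "trig l \<in> borel_measurable \<kappa>"
      using \<psi>(1) by (auto simp: measurable_cong_sets[OF k(2) refl] intro: borel_measurable_continuous_onI)
    have "(LINT y|\<kappa>. \<bar>\<psi> y - trig l y\<bar>) \<le> (LINT y|\<kappa>. 3 * d + 2 * indicator (- K') y)"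
    proof (rule integral_mono)
      show "integrable \<kappa> (\<lambda>y. \<bar>\<psi> y - trig l y\<bar>)" by (rule integrable_const_bound[of _ 2]) (use off in auto)
      show "integrable \<kappa> (\<lambda>y. 3 * d + 2 * indicator (- K') y)" using Ks by (simp add: emeasure_eq_measure)
      show "\<bar>\<psi> y - trig l y\<bar> \<le> 3 * d + 2 * indicator (- K') y" for y
        using onK[of y] off[of y] k(4) d by (auto split: split_indicator)
    qed
    also have "\<dots> = 3 * d * measure \<kappa> UNIV + 2 * measure \<kappa> (- K')"
      using Ks by (simp add: sp emeasure_eq_measure)
    also have "\<dots> \<le> 3 * d * mm + 2 * d" using k d by (intro add_mono mult_left_mono) auto
    also have "\<dots> = e" using d(2) by (simp add: algebra_simps)
    finally show ?thesis .
  qed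
  show ?thesis
    using that[OF b] est[of \<mu> K1] est[of \<nu> K2] fin sets K1 K2 mm by (auto simp: K_def)
qed

text \<open>Passes from trigonometric test functions to bounded continuous ones, because the
  function to be tested later involves \<open>B\<close> and is not a trigonometric sum.\<close>

lemma trig_norming:
  fixes \<mu> \<nu> :: "'h::{real_inner,banach,second_countable_topology} measure"
  assumes fin: "finite_measure \<mu>" "finite_measure \<nu>" and sets: "sets \<mu> = sets borel" "sets \<nu> = sets borel"
    and K: "\<And>l. (\<And>y. \<bar>trig l y\<bar> \<le> 1) \<Longrightarrow> \<bar>(LINT y|\<mu>. trig l y) - (LINT y|\<nu>. trig l y)\<bar> \<le> K"
    and \<psi>: "continuous_on UNIV \<psi>" "\<And>y. \<bar>\<psi> y\<bar> \<le> c" and c: "c > 0"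
  shows "\<bar>(LINT y|\<mu>. \<psi> y) - (LINT y|\<nu>. \<psi> y)\<bar> \<le> c * K"
proof -
  let ?\<phi> = "\<lambda>y. \<psi> y / c"
  have \<phi>: "continuous_on UNIV ?\<phi>" "\<And>y. \<bar>?\<phi> y\<bar> \<le> 1"
    using \<psi> c by (auto intro!: continuous_intros)
  have "\<bar>(LINT y|\<mu>. ?\<phi> y) - (LINT y|\<nu>. ?\<phi> y)\<bar> \<le> K"
  proof (rule field_le_epsilon)
    fix e :: real assume "e > 0"
    then obtain l where l: "\<And>y. \<bar>trig l y\<bar> \<le> 1" "(LINT y|\<mu>. \<bar>?\<phi> y - trig l y\<bar>) \<le> e / 2" "(LINT y|\<nu>. \<bar>?\<phi> y - trig l y\<bar>) \<le> e / 2"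
      using trig_dense[OF fin sets \<phi>, of "e / 2"] by auto
    have d: "\<bar>(LINT y|\<kappa>. ?\<phi> y) - (LINT y|\<kappa>. trig l y)\<bar> \<le> (LINT y|\<kappa>. \<bar>?\<phi> y - trig l y\<bar>)"
      if k: "finite_measure \<kappa>" "sets \<kappa> = sets borel" for \<kappa> :: "'h measure"
    proof -
      interpret finite_measure \<kappa> by fact
      have [measurable]: "?\<phi> \<in> borel_measurable \<kappa>" "trig l \<in> borel_measurable \<kappa>"
        using \<phi>(1) by (auto simp: measurable_cong_sets[OF k(2) refl] intro: borel_measurable_continuous_onI)
      have "integrable \<kappa> ?\<phi>" "integrable \<kappa> (trig l)"
        by (rule integrable_const_bound[of _ 1]; use \<phi> l in simp)+
      then have "(LINT y|\<kappa>. ?\<phi> y) - (LINT y|\<kappa>. trig l y) = (LINT y|\<kappa>. ?\<phi> y - trig l y)"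
        by (rule Bochner_Integration.integral_diff[symmetric])
      then show ?thesis using integral_abs_bound by metis
    qed
    show "\<bar>(LINT y|\<mu>. ?\<phi> y) - (LINT y|\<nu>. ?\<phi> y)\<bar> \<le> K + e"
      using d[OF fin(1) sets(1)] d[OF fin(2) sets(2)] K[OF l(1)] l(2,3) by linarith
  qed
  then have "\<bar>(LINT y|\<mu>. \<psi> y) - (LINT y|\<nu>. \<psi> y)\<bar> / c \<le> K" using c by (simp flip: diff_divide_distrib)
  then show ?thesis using c by (simp add: field_simps)
qed

text \<open>By norming with \<open>K\<close> = 0 the integrals of bounded continuous functions
  agree. The functions \<open>f n\<close> decrease to the indicator of a closed set
  \<open>S\<close>, and closed sets generate the Borel sets.\<close>

lemma measure_eqI_trig:
  fixes \<mu> \<nu> :: "'h::{real_inner,banach,second_countable_topology} measure"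
  assumes fin: "finite_measure \<mu>" "finite_measure \<nu>" and sets: "sets \<mu> = sets borel" "sets \<nu> = sets borel"
    and eq: "\<And>l. (LINT y|\<mu>. trig l y) = (LINT y|\<nu>. trig l y)"
  shows "\<mu> = \<nu>"
proof -
  have eqc: "(LINT y|\<mu>. \<psi> y) = (LINT y|\<nu>. \<psi> y)" if "continuous_on UNIV \<psi>" "\<And>y. \<bar>\<psi> y\<bar> \<le> 1" for \<psi> :: "'h \<Rightarrow> real"
    using trig_norming[OF fin sets, of 0 \<psi> 1] that eq by simp
  have cl: "measure \<mu> S = measure \<nu> S" if S: "closed S" "S \<noteq> {}" for S
  proof -
    define f where "f n y = max 0 (1 - real n * infdist y S)" for n y
    have f: "continuous_on UNIV (f n)" "\<bar>f n y\<bar> \<le> 1" for n y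
      unfolding f_def by (intro continuous_intros) (auto simp: infdist_nonneg)
    have lim: "(\<lambda>n. LINT y|\<kappa>. f n y) \<longlonglongrightarrow> measure \<kappa> S" if k: "finite_measure \<kappa>" "sets \<kappa> = sets borel" for \<kappa> :: "'h measure"
    proof -
      interpret finite_measure \<kappa> by fact
      have Sm: "S \<in> sets \<kappa>" using k S by simp
      have "(\<lambda>n. LINT y|\<kappa>. f n y) \<longlonglongrightarrow> (LINT y|\<kappa>. indicator S y)"
      proof (rule integral_dominated_convergence[where w = "\<lambda>_. 1"])
        show "f n \<in> borel_measurable \<kappa>" for n
          using f by (simp add: measurable_cong_sets[OF k(2) refl] borel_measurable_continuous_onI)
        show "AE y in \<kappa>. (\<lambda>n. f n y) \<longlonglongrightarrow> indicator S y"
        proof (intro AE_I2)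
          fix y
          show "(\<lambda>n. f n y) \<longlonglongrightarrow> indicator S y"
          proof (cases "y \<in> S")
            case True then show ?thesis by (simp add: f_def)
          next
            case False
            then have p: "infdist y S > 0" using S in_closed_iff_infdist_zero[of S y] infdist_nonneg[of y S] by fastforce
            obtain N where N: "1 / infdist y S \<le> real N" using real_arch_simple by blast
            have "f n y = 0" if "n \<ge> N" for n
            proof -
              have "1 / infdist y S \<le> real n" using N that by linarith
              then show ?thesis using p by (simp add: f_def field_simps)
            qed
            then have "\<forall>\<^sub>F n in sequentially. f n y = 0" by (auto simp: eventually_sequentially)
            then show ?thesis using False by (simp add: tendsto_eventually)
          qed
        qed
      qed (use f Sm in auto)
      then show ?thesis using Sm by simp
    qed
    have "(\<lambda>n. LINT y|\<mu>. f n y) = (\<lambda>n. LINT y|\<nu>. f n y)" using eqc f by blast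
    then show ?thesis using lim[OF fin(1) sets(1)] lim[OF fin(2) sets(2)] LIMSEQ_unique by metis
  qed
  show ?thesis
  proof (rule measure_eqI_generator_eq[where E = "Collect closed" and A = "\<lambda>_. UNIV" and \<Omega> = UNIV])
    have "borel = sigma UNIV (Collect closed :: 'h set set)" by (rule borel_eq_closed)
    then have "sets borel = sigma_sets UNIV (Collect closed :: 'h set set)" by (metis sets_measure_of top_greatest Pow_UNIV)
    then show "sets \<mu> = sigma_sets UNIV (Collect closed)" "sets \<nu> = sigma_sets UNIV (Collect closed)" using sets by auto
    show "emeasure \<mu> S = emeasure \<nu> S" if "S \<in> Collect closed" for S
      using cl[of S] that fin by (cases "S = {}") (auto simp: finite_measure.emeasure_eq_measure)
    show "emeasure \<mu> UNIV \<noteq> \<infinity>" using fin finite_measure.emeasure_finite by auto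
  qed (auto simp: Int_stable_def)
qed

section \<open>Wiener integrals of deterministic integrands\<close>

locale wiener_space =
  fixes M :: "'a measure" and F :: "real \<Rightarrow> 'a measure" and W :: "real \<Rightarrow> 'u::real_inner \<Rightarrow> 'a \<Rightarrow> real"
  assumes filt: "filtered_cprob_space M F" and wiener: "cyl_wiener M F W"

sublocale wiener_space \<subseteq> prob_space M
  using filt by (simp add: filtered_cprob_space_def)

context wiener_space
begin

lemma space_F [simp]: "space (F t) = space M"
  and sets_F_subset: "sets (F t) \<subseteq> sets M"
  using filt by (auto simp: filtered_cprob_space_def subalgebra_def)

lemma sets_F_M: "E \<in> sets (F t) \<Longrightarrow> E \<in> sets M"
  using sets_F_subset by blast

lemma sets_F_mono: "s \<le> t \<Longrightarrow> sets (F s) \<subseteq> sets (F t)"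
  using filt by (auto simp: filtered_cprob_space_def)

lemma measurable_F_M: "f \<in> measurable (F t) N \<Longrightarrow> f \<in> measurable M N"
  by (rule subsetD[OF measurable_mono[OF order_refl refl sets_F_subset]]) auto

lemma measurable_F_mono: "s \<le> t \<Longrightarrow> f \<in> measurable (F s) N \<Longrightarrow> f \<in> measurable (F t) N"
  by (rule subsetD[OF measurable_mono[OF order_refl refl sets_F_mono]]) auto

lemma W_measurable: "0 \<le> t \<Longrightarrow> W t u \<in> borel_measurable (F t)"
  using wiener by (simp add: cyl_wiener_def)

lemma W_linear: "0 \<le> t \<Longrightarrow> AE w in M. W t (a *\<^sub>R u + b *\<^sub>R v) w = a * W t u w + b * W t v w"
  and W_increment_distributed: "0 \<le> s \<Longrightarrow> s < t \<Longrightarrow> u \<noteq> 0 \<Longrightarrow>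
    distributed M lborel (\<lambda>w. W t u w - W s u w) (normal_density 0 (sqrt (t - s) * norm u))"
  and W_increment_indep: "0 \<le> s \<Longrightarrow> s \<le> t \<Longrightarrow> A \<in> sets (F s) \<Longrightarrow> C \<in> sets borel \<Longrightarrow>
    prob (A \<inter> ((\<lambda>w. W t u w - W s u w) -` C \<inter> space M)) =
    prob A * prob ((\<lambda>w. W t u w - W s u w) -` C \<inter> space M)"
  using wiener unfolding cyl_wiener_def by simp_all

text \<open>\<open>cyl_wiener\<close> provides independence as a product rule for events;
  intersection-stable generators upgrade it to independence of \<eta> and the increment as random
  variables.\<close>

lemma expectation_mult_increment:
  assumes st: "0 \<le> s" "s \<le> t" and \<eta>: "\<eta> \<in> borel_measurable (F s)" "\<And>w. \<bar>\<eta> w\<bar> \<le> 1"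
    and f: "f \<in> borel_measurable borel" "\<And>x. \<bar>f x\<bar> \<le> (1::real)"
  shows "(LINT w|M. \<eta> w * f (W t u w - W s u w)) = (LINT w|M. \<eta> w) * (LINT w|M. f (W t u w - W s u w))"
proof -
  let ?D = "\<lambda>w. W t u w - W s u w"
  have \<eta>M[measurable]: "\<eta> \<in> borel_measurable M" using \<eta> measurable_F_M by blast
  have [measurable]: "W t u \<in> borel_measurable M" "W s u \<in> borel_measurable M"
    using W_measurable st measurable_F_M order_trans by blast+
  note f(1)[measurable]
  have Int_stable: "Int_stable {X -` A \<inter> space M |A. A \<in> sets borel}" for X :: "'a \<Rightarrow> real"
  proof (safe intro!: Int_stableI)
    fix A B :: "real set" assume "A \<in> sets borel" "B \<in> sets borel"
    then show "\<exists>C. (X -` A \<inter> space M) \<inter> (X -` B \<inter> space M) = (X -` C \<inter> space M) \<and> C \<in> sets borel"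
      by (intro exI[of _ "A \<inter> B"]) auto
  qed
  have "indep_var borel \<eta> borel ?D"
    unfolding indep_var_eq
  proof (intro conjI indep_set_sigma_sets Int_stable)
    show "indep_set {\<eta> -` A \<inter> space M |A. A \<in> sets borel} {?D -` A \<inter> space M |A. A \<in> sets borel}"
    proof (safe intro!: indep_setI)
      fix A B :: "real set" assume AB: "A \<in> sets borel" "B \<in> sets borel"
      have "\<eta> -` A \<inter> space M \<in> sets (F s)" using measurable_sets[OF \<eta>(1) AB(1)] by simp
      then show "prob ((\<eta> -` A \<inter> space M) \<inter> (?D -` B \<inter> space M)) = prob (\<eta> -` A \<inter> space M) * prob (?D -` B \<inter> space M)"
        using W_increment_indep st AB by blast
    qed auto
  qed auto
  then have "indep_var borel ((\<lambda>x. x) \<circ> \<eta>) borel (f \<circ> ?D)"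
    by (rule indep_var_compose) auto
  then have "indep_var borel \<eta> borel (\<lambda>w. f (?D w))" by (simp add: comp_def)
  then show ?thesis
  proof (rule indep_var_lebesgue_integral)
    show "integrable M \<eta>" by (rule integrable_const_bound[of _ 1]) (use \<eta>(2) in auto)
    show "integrable M (\<lambda>w. f (?D w))" by (rule integrable_const_bound[of _ 1]) (use f(2) in auto)
  qed
qed

text \<open>The Gaussian clause of \<open>cyl_wiener\<close> requires s < t and u nonzero.
  Degenerate increments vanish almost surely, for u = 0 by linearity with zero coefficients.\<close>

lemma expectation_cos_increment:
  assumes st: "0 \<le> s" "s \<le> t"
  shows "(LINT w|M. cos (W t u w - W s u w + c)) = exp (- ((t - s) * (norm u)\<^sup>2) / 2) * cos c"
proof (cases "s = t \<or> u = 0")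
  case True
  have "AE w in M. W t u w - W s u w = 0"
  proof (cases "s = t")
    case False
    then have u: "u = 0" using True by simp
    have "AE w in M. W r (0 *\<^sub>R u + 0 *\<^sub>R u) w = 0 * W r u w + 0 * W r u w" if "r \<ge> 0" for r
      using that by (rule W_linear)
    from this[of s] this[of t] show ?thesis using st u by auto
  qed simp
  then have "(LINT w|M. cos (W t u w - W s u w + c)) = (LINT w|M. cos c)"
  proof (intro integral_cong_AE)
    have [measurable]: "W t u \<in> borel_measurable M" "W s u \<in> borel_measurable M"
      using W_measurable st measurable_F_M order_trans by blast+
    show "(\<lambda>w. cos (W t u w - W s u w + c)) \<in> borel_measurable M" by measurable
  qed auto
  then show ?thesis using True by (auto simp: prob_space)
next
  case False
  define \<sigma> where "\<sigma> = sqrt (t - s) * norm u"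
  have \<sigma>: "\<sigma> > 0" using False st by (simp add: \<sigma>_def)
  have D: "distributed M lborel (\<lambda>w. W t u w - W s u w) (normal_density 0 \<sigma>)"
    unfolding \<sigma>_def using False st by (intro W_increment_distributed) auto
  have "(LINT w|M. cos (W t u w - W s u w + c)) = (LINT x|lborel. normal_density 0 \<sigma> x * cos (x + c))"
    by (rule distributed_integral[OF D, symmetric]) auto
  also have "\<dots> = \<bar>\<sigma>\<bar> *\<^sub>R (LINT x|lborel. normal_density 0 \<sigma> (0 + \<sigma> * x) * cos (0 + \<sigma> * x + c))"
    using \<sigma> by (intro lborel_integral_real_affine) auto
  also have "\<dots> = (LINT x|lborel. std_normal_density x * cos (\<sigma> * x + c))"
    unfolding real_scaleR_def integral_mult_right_zero[symmetric] using \<sigma>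
    by (intro Bochner_Integration.integral_cong) (auto simp: normal_density_def real_sqrt_mult power_mult_distrib)
  also have "\<dots> = exp (- \<sigma>\<^sup>2 / 2) * cos c" by (rule std_normal_integral_cos)
  also have "\<sigma>\<^sup>2 = (t - s) * (norm u)\<^sup>2" using st by (simp add: \<sigma>_def power_mult_distrib)
  finally show ?thesis .
qed

text \<open>Addition theorem plus independence: the sine of the symmetric increment has mean 0, so
  only the cosine term survives.\<close>

lemma expectation_cos_add_increment:
  assumes st: "0 \<le> s" "s \<le> t" and E: "E \<in> sets (F s)" and Y: "Y \<in> borel_measurable (F s)"
  shows "(LINT w|M. indicator E w * cos (Y w + (W t u w - W s u w)))
    = (LINT w|M. indicator E w * cos (Y w)) * exp (- ((t - s) * (norm u)\<^sup>2) / 2)"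
proof -
  let ?D = "\<lambda>w. W t u w - W s u w"
  note E[measurable] Y[measurable]
  have EM[measurable]: "E \<in> sets M" using E sets_F_M by blast
  have YM[measurable]: "Y \<in> borel_measurable M" using Y measurable_F_M by blast
  have [measurable]: "W t u \<in> borel_measurable M" "W s u \<in> borel_measurable M"
    using W_measurable st measurable_F_M order_trans by blast+
  let ?c = "\<lambda>w. indicator E w * cos (Y w)" and ?s = "\<lambda>w. indicator E w * sin (Y w)"
  have i: "integrable M (\<lambda>w. ?c w * cos (?D w))" "integrable M (\<lambda>w. ?s w * sin (?D w))"
    by (rule integrable_const_bound[of _ 1]; auto simp: abs_mult indicator_def intro!: mult_le_one)+
  have "(LINT w|M. indicator E w * cos (Y w + ?D w)) = (LINT w|M. ?c w * cos (?D w) - ?s w * sin (?D w))"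
    by (intro Bochner_Integration.integral_cong refl) (simp only: cos_add right_diff_distrib mult.assoc)
  also have "\<dots> = (LINT w|M. ?c w * cos (?D w)) - (LINT w|M. ?s w * sin (?D w))"
    using i by (rule Bochner_Integration.integral_diff)
  also have "(LINT w|M. ?c w * cos (?D w)) = (LINT w|M. ?c w) * (LINT w|M. cos (?D w))"
    by (rule expectation_mult_increment[OF st]) (auto simp: abs_mult indicator_def)
  also have "(LINT w|M. ?s w * sin (?D w)) = (LINT w|M. ?s w) * (LINT w|M. sin (?D w))"
    by (rule expectation_mult_increment[OF st]) (auto simp: abs_mult indicator_def)
  also have "(LINT w|M. sin (?D w)) = (LINT w|M. cos (?D w + - (pi / 2)))"
    unfolding cos_add by simp
  also have "\<dots> = 0" by (subst expectation_cos_increment[OF st]) simp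
  also have "(LINT w|M. cos (?D w)) = exp (- ((t - s) * (norm u)\<^sup>2) / 2)"
    using expectation_cos_increment[OF st, of u 0] by simp
  finally show ?thesis by simp
qed

text \<open>Peels off the last increment; \<open>Y\<close>, \<open>E\<close> and the earlier
  increments are all known at its left end point.\<close>

lemma expectation_cos_add_step_integral:
  assumes ts: "0 \<le> ts m" "\<And>i. ts i \<le> ts (Suc i)" and mn: "m \<le> n"
    and E: "E \<in> sets (F (ts m))" and Y: "Y \<in> borel_measurable (F (ts m))"
  shows "(LINT w|M. indicator E w * cos (Y w + (\<Sum>i=m..<n. W (ts (Suc i)) (us i) w - W (ts i) (us i) w)))
    = (LINT w|M. indicator E w * cos (Y w)) * exp (- (\<Sum>i=m..<n. (ts (Suc i) - ts i) * (norm (us i))\<^sup>2) / 2)"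
  using mn
proof (induction n rule: dec_induct)
  case (step n)
  have mono: "ts i \<le> ts j" if "i \<le> j" for i j using lift_Suc_mono_le[of ts] ts(2) that by blast
  have t0: "0 \<le> ts n" using ts(1) mono[of m n] step by simp
  let ?J = "\<lambda>w. \<Sum>i=m..<n. W (ts (Suc i)) (us i) w - W (ts i) (us i) w"
  have J: "?J \<in> borel_measurable (F (ts n))"
  proof (intro borel_measurable_sum borel_measurable_diff)
    fix i assume i: "i \<in> {m..<n}"
    have "0 \<le> ts i" using ts(1) mono[of m i] i by simp
    moreover have "ts i \<le> ts n" "ts (Suc i) \<le> ts n" using i by (auto intro: mono)
    ultimately show "W (ts (Suc i)) (us i) \<in> borel_measurable (F (ts n))" "W (ts i) (us i) \<in> borel_measurable (F (ts n))"
      using W_measurable ts(2)[of i] measurable_F_mono by (meson order_trans)+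
  qed
  have Y': "Y \<in> borel_measurable (F (ts n))" using Y measurable_F_mono mono step by blast
  have E': "E \<in> sets (F (ts n))" using E sets_F_mono mono step by blast
  have "(LINT w|M. indicator E w * cos (Y w + (\<Sum>i=m..<Suc n. W (ts (Suc i)) (us i) w - W (ts i) (us i) w)))
      = (LINT w|M. indicator E w * cos ((Y w + ?J w) + (W (ts (Suc n)) (us n) w - W (ts n) (us n) w)))"
    using step by (simp add: add.assoc)
  also have "\<dots> = (LINT w|M. indicator E w * cos (Y w + ?J w)) * exp (- ((ts (Suc n) - ts n) * (norm (us n))\<^sup>2) / 2)"
    by (rule expectation_cos_add_increment[OF t0 ts(2) E']) (intro borel_measurable_add Y' J)
  also have "\<dots> = (LINT w|M. indicator E w * cos (Y w)) * exp (- (\<Sum>i=m..<Suc n. (ts (Suc i) - ts i) * (norm (us i))\<^sup>2) / 2)"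
    unfolding step.IH using step by (simp add: mult.assoc mult_exp_exp add_divide_distrib)
  finally show ?case .
qed simp

end

section \<open>Step functions and approximation on grids\<close>

lemma stepfun_outside:
  assumes "\<And>i. ts i \<le> ts (Suc i)" "ts n \<le> s"
  shows "stepfun n ts us s = 0"
proof -
  have mono: "ts i \<le> ts j" if "i \<le> j" for i j using lift_Suc_mono_le[of ts] assms(1) that by blast
  have "s \<notin> {ts i..<ts (Suc i)}" if "i < n" for i
    using mono[of "Suc i" n] that assms(2) by auto
  then show ?thesis by (simp add: stepfun_def)
qed

lemma stepfun_eq:
  assumes ts: "\<And>i. ts i \<le> ts (Suc i)" and s: "ts 0 \<le> s" "s < ts n"
  shows "\<exists>i<n. ts i \<le> s \<and> s < ts (Suc i) \<and> stepfun n ts us s = us i"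
  using s
proof (induction n)
  case (Suc n)
  show ?case
  proof (cases "s < ts n")
    case True
    then have "stepfun (Suc n) ts us s = stepfun n ts us s" by (simp add: stepfun_def)
    then show ?thesis using Suc.IH[OF Suc.prems(1) True] by (metis less_SucI)
  next
    case False
    then have "stepfun (Suc n) ts us s = us n"
      using stepfun_outside[where ts = ts and n = n and s = s and us = us] ts Suc.prems by (simp add: stepfun_def)
    then show ?thesis using False Suc.prems by (intro exI[of _ n]) auto
  qed
qed simp

text \<open>A grid through \<open>t1\<close> serves \<open>[0,t1]\<close> and \<open>[0,t2]\<close> simultaneously.\<close>
lemma fine_grid_exists:
  fixes t1 t2 d :: real
  assumes t: "0 \<le> t1" "t1 \<le> t2" and d: "d > 0"
  obtains ts :: "nat \<Rightarrow> real" and N where "ts 0 = 0" "ts N = t1" "ts (2 * N) = t2"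
    "\<And>i. ts i \<le> ts (Suc i)" "\<And>i. ts (Suc i) - ts i < d"
proof -
  obtain n where "(t2 + 1) / d < real n" using reals_Archimedean2 by blast
  define N where "N = Suc n"
  have N: "N > 0" "(t2 + 1) / d < real N" using \<open>_ < real n\<close> by (auto simp: N_def)
  then have N2: "t2 / real N < d" using d by (simp add: field_simps)
  \<comment> \<open>\<open>N\<close> equal steps up to \<open>t1\<close>, \<open>N\<close> more up
    to \<open>t2\<close>, then constant. Steps may have length 0, which covers t1 = 0 and t1 =
    t2.\<close>
  define ts where "ts i = (if i \<le> N then t1 * real i / real N else if i \<le> 2 * N then t1 + (t2 - t1) * (real i - real N) / real N else t2)" for i
  have "t1 / real N \<ge> 0" "(t2 - t1) / real N \<ge> 0" "t1 / real N < d" "(t2 - t1) / real N < d"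
    using t N(1) N2 divide_right_mono[of t1 t2 "real N"] divide_right_mono[of "t2 - t1" t2 "real N"] by auto
  moreover have "ts (Suc i) - ts i = t1 / real N \<or> ts (Suc i) - ts i = (t2 - t1) / real N \<or> ts (Suc i) - ts i = 0" for i
  proof -
    consider "i < N" | "N \<le> i" "i < 2 * N" | "2 * N \<le> i" by linarith
    then show ?thesis
    proof cases
      case 1 then show ?thesis by (simp add: ts_def field_simps)
    next
      case 2
      have "ts i = t1 + (t2 - t1) * (real i - real N) / real N" using 2 N by (auto simp: ts_def)
      then show ?thesis using 2 N by (simp add: ts_def field_simps)
    next
      case 3
      then have "ts i = t2" using N by (auto simp: ts_def)
      then show ?thesis using 3 by (simp add: ts_def)
    qed
  qed
  ultimately have "0 \<le> ts (Suc i) - ts i \<and> ts (Suc i) - ts i < d" for i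
    using d by (smt (verit))
  then show ?thesis using that[of ts N] N by (auto simp: ts_def)
qed

lemma stepfun_L2_close:
  fixes g :: "real \<Rightarrow> 'u::real_normed_vector"
  assumes ts: "ts 0 = 0" "\<And>i. ts i \<le> ts (Suc i)" "\<And>i. ts (Suc i) - ts i < d"
    and close: "\<And>s r. s \<in> {0..ts n} \<Longrightarrow> r \<in> {0..ts n} \<Longrightarrow> \<bar>s - r\<bar> < d \<Longrightarrow> norm (g s - g r) \<le> e"
    and e: "e \<ge> 0"
  shows "(\<integral>\<^sup>+ s\<in>{0..ts n}. ennreal ((norm (g s - stepfun n ts (\<lambda>i. g (ts i)) s))\<^sup>2) \<partial>lborel) \<le> ennreal (e\<^sup>2 * ts n)"
proof -
  have mono: "ts i \<le> ts j" if "i \<le> j" for i j using lift_Suc_mono_le[of ts] ts(2) that by blast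
  have le: "norm (g s - stepfun n ts (\<lambda>i. g (ts i)) s) \<le> e" if s: "0 \<le> s" "s < ts n" for s
  proof -
    obtain i where i: "i < n" "ts i \<le> s" "s < ts (Suc i)" "stepfun n ts (\<lambda>i. g (ts i)) s = g (ts i)"
      using stepfun_eq[of ts s n "\<lambda>i. g (ts i)"] ts s by auto
    have "0 \<le> ts i" "ts i \<le> ts n" using mono[of 0 i] mono[of i n] i ts(1) by auto
    then show ?thesis unfolding i(4) using i s ts(3)[of i] by (intro close) auto
  qed
  have "(\<integral>\<^sup>+ s\<in>{0..ts n}. ennreal ((norm (g s - stepfun n ts (\<lambda>i. g (ts i)) s))\<^sup>2) \<partial>lborel)
      \<le> (\<integral>\<^sup>+ s. ennreal (e\<^sup>2) * indicator {0..ts n} s \<partial>lborel)"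
  proof (rule nn_integral_mono_AE)
    \<comment> \<open>The last grid point lies in none of the half-open steps.\<close>
    have "AE s in lborel. s \<noteq> ts n" using AE_lborel_singleton by auto
    then show "AE s in lborel. ennreal ((norm (g s - stepfun n ts (\<lambda>i. g (ts i)) s))\<^sup>2) * indicator {0..ts n} s
        \<le> ennreal (e\<^sup>2) * indicator {0..ts n} s"
      by eventually_elim (auto split: split_indicator intro!: ennreal_leI power_mono le)
  qed
  also have "\<dots> = ennreal (e\<^sup>2) * ennreal (ts n)"
    using mono[of 0 n] ts(1) by (simp add: nn_integral_cmult_indicator)
  also have "\<dots> = ennreal (e\<^sup>2 * ts n)" using mono[of 0 n] ts(1) by (simp add: ennreal_mult)
  finally show ?thesis .
qed

lemma riemann_sum_close:
  fixes f :: "real \<Rightarrow> real"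
  assumes mono: "\<And>i. ts i \<le> ts (Suc i)" and mn: "m \<le> n" and cont: "continuous_on {ts m..ts n} f"
    and close: "\<And>i s. m \<le> i \<Longrightarrow> i < n \<Longrightarrow> ts i \<le> s \<Longrightarrow> s \<le> ts (Suc i) \<Longrightarrow> \<bar>f s - f (ts i)\<bar> \<le> e"
  shows "\<bar>integral {ts m..ts n} f - (\<Sum>i=m..<n. (ts (Suc i) - ts i) * f (ts i))\<bar> \<le> e * (ts n - ts m)"
  using mn cont close
proof (induction n rule: dec_induct)
  case base then show ?case by simp
next
  case (step n)
  have mono': "ts i \<le> ts j" if "i \<le> j" for i j using lift_Suc_mono_le[of ts] mono that by blast
  have c: "continuous_on {ts m..ts (Suc n)} f" by fact
  have int: "f integrable_on {ts m..ts (Suc n)}" using c by (rule integrable_continuous_interval)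
  have split: "integral {ts m..ts (Suc n)} f = integral {ts m..ts n} f + integral {ts n..ts (Suc n)} f"
    using Henstock_Kurzweil_Integration.integral_combine[OF mono'[OF step(1)] mono int] by simp
  have IH: "\<bar>integral {ts m..ts n} f - (\<Sum>i=m..<n. (ts (Suc i) - ts i) * f (ts i))\<bar> \<le> e * (ts n - ts m)"
    using step.prems mono[of n] by (intro step.IH) (auto intro: continuous_on_subset)
  have int2: "f integrable_on {ts n..ts (Suc n)}"
    using c mono'[OF step(1)] by (intro integrable_continuous_interval) (auto intro: continuous_on_subset)
  have e: "e \<ge> 0" using step.prems(2)[of n "ts n"] step(1) mono[of n] by simp
  have "integral {ts n..ts (Suc n)} f - (ts (Suc n) - ts n) * f (ts n) = integral {ts n..ts (Suc n)} (\<lambda>s. f s - f (ts n))"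
    using int2 mono[of n] by (subst Henstock_Kurzweil_Integration.integral_diff) auto
  also have "norm \<dots> \<le> e * (ts (Suc n) - ts n)"
    using integral_bound[of "ts n" "ts (Suc n)" "\<lambda>s. f s - f (ts n)" e] mono[of n] step.prems(2)[of n] step(1)
      continuous_on_diff[OF continuous_on_subset[OF c, of "{ts n..ts (Suc n)}"] continuous_on_const[of _ "f (ts n)"]] mono'[OF step(1)]
    by auto
  finally have "\<bar>integral {ts n..ts (Suc n)} f - (ts (Suc n) - ts n) * f (ts n)\<bar> \<le> e * (ts (Suc n) - ts n)" by simp
  then have "\<bar>integral {ts m..ts (Suc n)} f - ((\<Sum>i=m..<n. (ts (Suc i) - ts i) * f (ts i)) + (ts (Suc n) - ts n) * f (ts n))\<bar>
      \<le> e * (ts n - ts m) + e * (ts (Suc n) - ts n)"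
    using IH unfolding split by linarith
  then show ?case using step(1) by (simp add: algebra_simps)
qed

lemma is_wiener_integral_cong:
  assumes "\<And>s. 0 \<le> s \<Longrightarrow> s \<le> t \<Longrightarrow> g s = g' s" "is_wiener_integral M W t g Y"
  shows "is_wiener_integral M W t g' Y"
proof -
  have "(\<integral>\<^sup>+ s\<in>{0..t}. ennreal ((norm (g s - f s))\<^sup>2) \<partial>lborel) = (\<integral>\<^sup>+ s\<in>{0..t}. ennreal ((norm (g' s - f s))\<^sup>2) \<partial>lborel)" for f
    by (intro nn_integral_cong) (auto split: split_indicator simp: assms(1))
  then show ?thesis using assms(2) by (simp add: is_wiener_integral_def)
qed

text \<open>An elementary substitute for Cauchy-Schwarz when an L2 estimate must control an L1 norm:
  after integration, a second moment of order e^2 gives a bound of order e.\<close>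

lemma abs_le_amgm: "\<bar>z\<bar> \<le> e + z\<^sup>2 / e" if "e > (0::real)"
proof -
  have "0 \<le> (\<bar>z\<bar> - e)\<^sup>2" by simp
  then have "2 * (e * \<bar>z\<bar>) \<le> e * e + z\<^sup>2" by (simp add: power2_eq_square algebra_simps)
  moreover have "0 \<le> e * \<bar>z\<bar>" using that by simp
  ultimately have "e * \<bar>z\<bar> \<le> e * e + z\<^sup>2" by linarith
  then show ?thesis using that by (simp add: field_simps)
qed

lemma abs_cos_diff_le: "\<bar>cos x - cos y\<bar> \<le> \<bar>x - y\<bar>" for x y :: real
proof -
  have "cos x - cos y = 2 * sin ((x + y) / 2) * sin ((y - x) / 2)" by (rule cos_diff_cos)
  then have "\<bar>cos x - cos y\<bar> = 2 * \<bar>sin ((x + y) / 2)\<bar> * \<bar>sin ((y - x) / 2)\<bar>" by (simp add: abs_mult)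
  also have "\<dots> \<le> 2 * 1 * \<bar>(y - x) / 2\<bar>"
    by (intro mult_mono abs_sin_x_le_abs_x) auto
  finally show ?thesis by simp
qed

lemma (in prob_space) square_integral_bound:
  assumes [measurable]: "Z \<in> borel_measurable M" and le: "(\<integral>\<^sup>+ w. ennreal ((Z w)\<^sup>2) \<partial>M) \<le> ennreal K" and K: "K \<ge> 0"
  shows "integrable M (\<lambda>w. (Z w)\<^sup>2)" "(LINT w|M. (Z w)\<^sup>2) \<le> K"
proof -
  show i: "integrable M (\<lambda>w. (Z w)\<^sup>2)"
    by (rule integrableI_nonneg) (use le in "auto intro: le_less_trans")
  have "ennreal (LINT w|M. (Z w)\<^sup>2) \<le> ennreal K"
    using le nn_integral_eq_integral[OF i] by simp
  then show "(LINT w|M. (Z w)\<^sup>2) \<le> K" using K by simp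
qed

context wiener_space
begin

lemma stepint_measurable:
  assumes "\<And>i. 0 \<le> ts i"
  shows "stepint W n ts us \<in> borel_measurable M"
  unfolding stepint_def[abs_def]
  by (intro borel_measurable_sum borel_measurable_diff measurable_F_M[OF W_measurable] assms)

text \<open>\<open>is_wiener_integral\<close> asserts only L2 distances to step integrals, not
  adaptedness. Both integrals are therefore approximated on a common grid through \<open>t1\<close>;
  the difference of the step integrals consists of increments after \<open>t1\<close>, for which the
  formula is known, and the mesh tends to 0.\<close>

lemma expectation_cos_add_wiener_integral:
  assumes t: "0 \<le> t1" "t1 \<le> t2" and g: "continuous_on {0..t2} g"
    and Y1: "is_wiener_integral M W t1 g Y1" and Y2: "is_wiener_integral M W t2 g Y2"
    and E: "E \<in> sets (F t1)" and Y: "Y \<in> borel_measurable (F t1)"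
  shows "(LINT w|M. indicator E w * cos (Y w + (Y2 w - Y1 w)))
    = (LINT w|M. indicator E w * cos (Y w)) * exp (- integral {t1..t2} (\<lambda>s. (norm (g s))\<^sup>2) / 2)"
    (is "?L = ?a * exp (- ?V / 2)")
proof -
  have EM[measurable]: "E \<in> sets M" using E sets_F_M by blast
  have YM[measurable]: "Y \<in> borel_measurable M" using Y measurable_F_M by blast
  have [measurable]: "Y1 \<in> borel_measurable M" "Y2 \<in> borel_measurable M"
    using Y1 Y2 by (auto simp: is_wiener_integral_def)
  have "bounded (g ` {0..t2})" using g by (intro compact_imp_bounded compact_continuous_image) auto
  then obtain C where C: "C > 0" "\<And>s. s \<in> {0..t2} \<Longrightarrow> norm (g s) \<le> C" unfolding bounded_pos by auto
  \<comment> \<open>\<open>V\<close> will be the Riemann sum of the squared norm of \<open>g\<close>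
    over [t1,t2]. The factor 1 + 4 * t2 comes from \<open>abs_le_amgm\<close> and two second moments
    of size at most e^2 * t2, each weighted by 2 / e; 2 * C * e bounds a difference of squares of
    numbers at most \<open>C\<close>.\<close>
  have approx: "\<exists>V. \<bar>?a * exp (- V / 2) - ?L\<bar> \<le> e * (1 + 4 * t2) \<and> \<bar>?V - V\<bar> \<le> 2 * C * e * t2" if e: "e > 0" for e
  proof -
    have "uniformly_continuous_on {0..t2} g" using g by (rule compact_uniformly_continuous) simp
    then obtain d where d: "d > 0" "\<And>s r. s \<in> {0..t2} \<Longrightarrow> r \<in> {0..t2} \<Longrightarrow> \<bar>s - r\<bar> < d \<Longrightarrow> norm (g s - g r) < e"
      using e unfolding uniformly_continuous_on_def by (metis dist_norm dist_real_def abs_minus_commute norm_minus_commute)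
    obtain ts N where ts: "ts 0 = 0" "ts N = t1" "ts (2 * N) = t2" "\<And>i. ts i \<le> ts (Suc i)" "\<And>i. ts (Suc i) - ts i < d"
      using fine_grid_exists[OF t d(1)] by blast
    have mono: "ts i \<le> ts j" if "i \<le> j" for i j using lift_Suc_mono_le[of ts] ts(4) that by blast
    have ts0: "0 \<le> ts i" for i using mono[of 0 i] ts(1) by simp
    define us where "us i = g (ts i)" for i
    let ?S1 = "stepint W N ts us" and ?S2 = "stepint W (2 * N) ts us"
    have [measurable]: "?S1 \<in> borel_measurable M" "?S2 \<in> borel_measurable M"
      by (auto intro: stepint_measurable ts0)
    have "(\<integral>\<^sup>+ w. ennreal ((Y1 w - ?S1 w)\<^sup>2) \<partial>M) = (\<integral>\<^sup>+ s\<in>{0..t1}. ennreal ((norm (g s - stepfun N ts us s))\<^sup>2) \<partial>lborel)"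
      using Y1 ts unfolding is_wiener_integral_def by blast
    also have "\<dots> \<le> ennreal (e\<^sup>2 * ts N)"
      unfolding us_def ts(2)[symmetric] using ts(1,4,5)
    proof (rule stepfun_L2_close)
      show "norm (g s - g r) \<le> e" if "s \<in> {0..ts N}" "r \<in> {0..ts N}" "\<bar>s - r\<bar> < d" for s r
        using d(2)[of s r] that t ts(2) by auto
    qed (use e in auto)
    finally have 1: "(\<integral>\<^sup>+ w. ennreal ((Y1 w - ?S1 w)\<^sup>2) \<partial>M) \<le> ennreal (e\<^sup>2 * t2)"
      by (rule order_trans) (use ts(2) t in \<open>auto intro!: ennreal_leI mult_left_mono\<close>)
    have "(\<integral>\<^sup>+ w. ennreal ((Y2 w - ?S2 w)\<^sup>2) \<partial>M) = (\<integral>\<^sup>+ s\<in>{0..t2}. ennreal ((norm (g s - stepfun (2 * N) ts us s))\<^sup>2) \<partial>lborel)"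
      using Y2 ts unfolding is_wiener_integral_def by blast
    also have "\<dots> \<le> ennreal (e\<^sup>2 * ts (2 * N))"
      unfolding us_def ts(3)[symmetric] using ts(1,4,5)
    proof (rule stepfun_L2_close)
      show "norm (g s - g r) \<le> e" if "s \<in> {0..ts (2 * N)}" "r \<in> {0..ts (2 * N)}" "\<bar>s - r\<bar> < d" for s r
        using d(2)[of s r] that ts(3) by auto
    qed (use e in auto)
    finally have 2: "(\<integral>\<^sup>+ w. ennreal ((Y2 w - ?S2 w)\<^sup>2) \<partial>M) \<le> ennreal (e\<^sup>2 * t2)"
      by (simp add: ts(3))
    have K: "e\<^sup>2 * t2 \<ge> 0" using t by simp
    note b1 = square_integral_bound[OF _ 1 K, simplified] and b2 = square_integral_bound[OF _ 2 K, simplified]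
    let ?J = "\<lambda>w. \<Sum>i=N..<2*N. W (ts (Suc i)) (us i) w - W (ts i) (us i) w"
    have J: "?J w = ?S2 w - ?S1 w" for w
    proof -
      have "{..<2*N} = {..<N} \<union> {N..<2*N}" by auto
      then have "?S2 w = ?S1 w + ?J w" unfolding stepint_def by (simp add: sum.union_disjoint ivl_disj_int)
      then show ?thesis by simp
    qed
    define V where "V = (\<Sum>i=N..<2*N. (ts (Suc i) - ts i) * (norm (us i))\<^sup>2)"
    have "(LINT w|M. indicator E w * cos (Y w + ?J w)) = ?a * exp (- V / 2)"
      unfolding V_def by (rule expectation_cos_add_step_integral) (use ts E Y t in auto)
    then have A: "?a * exp (- V / 2) = (LINT w|M. indicator E w * cos (Y w + (?S2 w - ?S1 w)))"
      by (simp add: J)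
    let ?f = "\<lambda>w. indicator E w * cos (Y w + (?S2 w - ?S1 w))"
    let ?g = "\<lambda>w. indicator E w * cos (Y w + (Y2 w - Y1 w))"
    let ?h = "\<lambda>w. e + (2 / e) * ((Y2 w - ?S2 w)\<^sup>2 + (Y1 w - ?S1 w)\<^sup>2)"
    have ifg: "integrable M ?f" "integrable M ?g"
      by (rule integrable_const_bound[of _ 1]; auto simp: abs_mult indicator_def)+
    have ih: "integrable M ?h" using b1 b2 by simp
    have "\<bar>?a * exp (- V / 2) - ?L\<bar> = \<bar>LINT w|M. ?f w - ?g w\<bar>"
      unfolding A using ifg by simp
    also have "\<dots> \<le> (LINT w|M. \<bar>?f w - ?g w\<bar>)" by (rule integral_abs_bound)
    also have "\<dots> \<le> (LINT w|M. ?h w)"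
    proof (rule integral_mono)
      show "integrable M (\<lambda>w. \<bar>?f w - ?g w\<bar>)" using ifg by simp
      fix w
      let ?x = "Y2 w - ?S2 w" and ?y = "Y1 w - ?S1 w"
      have "\<bar>?f w - ?g w\<bar> \<le> \<bar>cos (Y w + (?S2 w - ?S1 w)) - cos (Y w + (Y2 w - Y1 w))\<bar>"
        by (auto simp: indicator_def)
      also have "\<dots> \<le> \<bar>(Y w + (?S2 w - ?S1 w)) - (Y w + (Y2 w - Y1 w))\<bar>" by (rule abs_cos_diff_le)
      also have "\<dots> = \<bar>?x - ?y\<bar>" by (simp add: abs_minus_commute algebra_simps)
      also have "\<dots> \<le> e + (?x - ?y)\<^sup>2 / e" using e by (rule abs_le_amgm)
      also have "(?x - ?y)\<^sup>2 / e \<le> (2 * (?x\<^sup>2 + ?y\<^sup>2)) / e"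
        using e zero_le_power2[of "?x + ?y"] by (intro divide_right_mono) (auto simp: power2_eq_square algebra_simps)
      finally show "\<bar>?f w - ?g w\<bar> \<le> ?h w" by simp
    qed (rule ih)
    also have "\<dots> = e + (2 / e) * ((LINT w|M. (Y2 w - ?S2 w)\<^sup>2) + (LINT w|M. (Y1 w - ?S1 w)\<^sup>2))"
      using b1 b2 by (simp add: prob_space)
    also have "\<dots> \<le> e + (2 / e) * (e\<^sup>2 * t2 + e\<^sup>2 * t2)"
      using b1 b2 e by (intro add_mono mult_left_mono) auto
    also have "\<dots> = e * (1 + 4 * t2)" using e by (simp add: power2_eq_square field_simps)
    finally have r1: "\<bar>?a * exp (- V / 2) - ?L\<bar> \<le> e * (1 + 4 * t2)" .
    have "\<bar>integral {ts N..ts (2*N)} (\<lambda>s. (norm (g s))\<^sup>2) - (\<Sum>i=N..<2*N. (ts (Suc i) - ts i) * (norm (g (ts i)))\<^sup>2)\<bar>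
        \<le> (2 * C * e) * (ts (2 * N) - ts N)"
    proof (rule riemann_sum_close)
      show "continuous_on {ts N..ts (2*N)} (\<lambda>s. (norm (g s))\<^sup>2)"
        using ts0[of N] ts(3) by (intro continuous_intros continuous_on_subset[OF g]) auto
      fix i s assume i: "N \<le> i" "i < 2 * N" "ts i \<le> s" "s \<le> ts (Suc i)"
      have in0: "s \<in> {0..t2}" "ts i \<in> {0..t2}"
        using i ts0[of i] mono[of i "2*N"] mono[of "Suc i" "2*N"] ts(3) by auto
      have "\<bar>norm (g s) - norm (g (ts i))\<bar> \<le> norm (g s - g (ts i))" by (rule norm_triangle_ineq3)
      also have "\<dots> \<le> e" using d(2)[OF in0] i ts(5)[of i] by auto
      finally have "\<bar>norm (g s) - norm (g (ts i))\<bar> * \<bar>norm (g s) + norm (g (ts i))\<bar> \<le> e * (C + C)"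
        using C(2)[OF in0(1)] C(2)[OF in0(2)] e by (intro mult_mono) auto
      moreover have "(norm (g s))\<^sup>2 - (norm (g (ts i)))\<^sup>2 = (norm (g s) - norm (g (ts i))) * (norm (g s) + norm (g (ts i)))"
        by (simp add: power2_eq_square algebra_simps)
      ultimately show "\<bar>(norm (g s))\<^sup>2 - (norm (g (ts i)))\<^sup>2\<bar> \<le> 2 * C * e" by (simp add: abs_mult mult_ac)
    qed (use ts in auto)
    then have "\<bar>?V - V\<bar> \<le> (2 * C * e) * (t2 - t1)" by (simp add: V_def us_def ts(2,3))
    also have "\<dots> \<le> 2 * C * e * t2" using t C e by (intro mult_left_mono) auto
    finally show ?thesis using r1 by blast
  qed
  define \<epsilon> where "\<epsilon> n = inverse (real (Suc n))" for n
  have \<epsilon>: "\<epsilon> n > 0" "\<epsilon> \<longlonglongrightarrow> 0" for n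
    using LIMSEQ_inverse_real_of_nat by (auto simp: \<epsilon>_def[abs_def])
  have "\<forall>n. \<exists>V. \<bar>?a * exp (- V / 2) - ?L\<bar> \<le> \<epsilon> n * (1 + 4 * t2) \<and> \<bar>?V - V\<bar> \<le> 2 * C * \<epsilon> n * t2"
    by (intro allI approx \<epsilon>(1))
  from choice[OF this] obtain V where V: "\<And>n. \<bar>?a * exp (- V n / 2) - ?L\<bar> \<le> \<epsilon> n * (1 + 4 * t2)" "\<And>n. \<bar>?V - V n\<bar> \<le> 2 * C * \<epsilon> n * t2"
    by blast
  have z: "(\<lambda>n. \<epsilon> n * (1 + 4 * t2)) \<longlonglongrightarrow> 0" "(\<lambda>n. 2 * C * \<epsilon> n * t2) \<longlonglongrightarrow> 0"
    using tendsto_mult_left_zero[OF \<epsilon>(2), of "1 + 4 * t2"] tendsto_mult_left_zero[OF \<epsilon>(2), of "2 * C * t2"]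
    by (simp_all add: mult_ac)
  have "(\<lambda>n. V n - ?V) \<longlonglongrightarrow> 0"
    by (rule Lim_null_comparison[OF _ z(2)]) (use V(2) in \<open>auto simp: abs_minus_commute\<close>)
  then have "V \<longlonglongrightarrow> ?V" by (rule Lim_null[THEN iffD2])
  then have l1: "(\<lambda>n. ?a * exp (- V n / 2)) \<longlonglongrightarrow> ?a * exp (- ?V / 2)" by (intro tendsto_intros) auto
  have "(\<lambda>n. ?a * exp (- V n / 2) - ?L) \<longlonglongrightarrow> 0"
    by (rule Lim_null_comparison[OF _ z(1)]) (use V(1) in auto)
  then have "(\<lambda>n. ?a * exp (- V n / 2)) \<longlonglongrightarrow> ?L" by (rule Lim_null[THEN iffD2])
  from LIMSEQ_unique[OF this l1] show ?thesis .
qed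

end

section \<open>Mild solutions and Duhamel's formula\<close>

lemma integral_reflect_shift:
  fixes f :: "real \<Rightarrow> real"
  assumes "continuous_on {t - b..t - a} f"
  shows "integral {a..b} (\<lambda>s. f (t - s)) = integral {t - b..t - a} f"
proof -
  have "(f has_integral integral {t - b..t - a} f) {t - b..t - a}"
    using assms by (intro integrable_integral integrable_continuous_interval)
  then have "((f \<circ> (+) t) has_integral integral {t - b..t - a} f) {- b..- a}"
    by (simp add: has_integral_shift_Icc_real add.commute)
  then have "((\<lambda>s. (f \<circ> (+) t) (- s)) has_integral integral {t - b..t - a} f) {a..b}"
    by (subst has_integral_reflect_real[symmetric]) (simp add: comp_def)
  then show ?thesis by (simp add: integral_unique)
qed

text \<open>Here \<open>c n\<close> will be the mean drift over an interval of length
  \<open>d n\<close>. Writing sin x = x * sinc x cancels \<open>d n\<close> without dividing by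
  \<open>c n\<close>, which may be 0.\<close>

lemma cos_difference_quotient_tendsto:
  fixes a c d :: "nat \<Rightarrow> real"
  assumes a: "a \<longlonglongrightarrow> A" and c: "c \<longlonglongrightarrow> C" and d: "d \<longlonglongrightarrow> 0" and d0: "\<And>n. d n > 0"
  shows "(\<lambda>n. (cos (a n) - cos (a n - d n * c n)) / d n) \<longlonglongrightarrow> - (sin A * C)"
proof -
  have sinc: "sin x = x * sinc x" for x by simp
  have "(cos (a n) - cos (a n - d n * c n)) / d n = - (sin (a n - d n * c n / 2) * (c n * sinc (d n * c n / 2)))" for n
  proof -
    have "cos (a n) - cos (a n - d n * c n) = 2 * sin ((a n + (a n - d n * c n)) / 2) * sin ((a n - d n * c n - a n) / 2)"
      by (rule cos_diff_cos)
    also have "(a n + (a n - d n * c n)) / 2 = a n - d n * c n / 2" by (simp add: field_simps)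
    also have "(a n - d n * c n - a n) / 2 = - (d n * c n / 2)" by simp
    also have "sin (- (d n * c n / 2)) = - ((d n * c n / 2) * sinc (d n * c n / 2))" by (simp add: sinc[of "d n * c n / 2"])
    finally show ?thesis using d0[of n] by simp
  qed
  moreover have "(\<lambda>n. sinc (d n * c n / 2)) \<longlonglongrightarrow> sinc (0 * C / 2)"
    by (rule isCont_tendsto_compose[OF isCont_sinc]) (intro tendsto_intros c d, simp)
  then have "(\<lambda>n. - (sin (a n - d n * c n / 2) * (c n * sinc (d n * c n / 2)))) \<longlonglongrightarrow> - (sin (A - 0 * C / 2) * (C * sinc (0 * C / 2)))"
    by (intro tendsto_intros a c d) auto
  ultimately show ?thesis by simp
qed

locale mild_data =
  fixes T :: "real \<Rightarrow> ('h::{real_inner,banach,second_countable_topology} \<Rightarrow>\<^sub>L 'h)"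
    and V G :: "'u::{real_inner,banach,second_countable_topology} \<Rightarrow>\<^sub>L 'h" and B :: "'h \<Rightarrow> 'u" and b :: real
  assumes T: "strongly_cont_semigroup T" and T': "strongly_cont_semigroup (\<lambda>t. adj (T t))"
    and B: "continuous_on UNIV B" and Bb: "\<And>y. norm (B y) \<le> b"
begin

definition noise_adj :: "'h \<Rightarrow> real \<Rightarrow> 'u" where
  "noise_adj h s = adj G (adj (T s) h)"

text \<open>This is <Q_t h, h>, the variance of the stochastic convolution at time \<open>t\<close>
  tested against \<open>h\<close>.\<close>

definition q :: "real \<Rightarrow> 'h \<Rightarrow> real" where
  "q t h = integral {0..t} (\<lambda>s. (norm (noise_adj h s))\<^sup>2)"

text \<open>The number <e^{tA} V B(y), h>, with the operators moved to \<open>h\<close>.\<close>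

definition drift :: "real \<Rightarrow> 'h \<Rightarrow> 'h \<Rightarrow> real" where
  "drift t h y = inner (B y) (adj V (adj (T t) h))"

lemma adjT_continuous: "continuous_on {0..} (\<lambda>t. adj (T t) h)"
  using semigroup_continuous[OF T'] by simp

lemma noise_adj_continuous: "continuous_on {0..} (noise_adj h)"
  unfolding noise_adj_def by (intro continuous_intros adjT_continuous)

lemma noise_adj_sq_continuous: "continuous_on {0..} (\<lambda>s. (norm (noise_adj h s))\<^sup>2)"
  by (intro continuous_intros noise_adj_continuous)

lemma q_continuous: "continuous_on {0..t} (\<lambda>s. q s h)"
  unfolding q_def
  by (intro indefinite_integral_continuous_1 integrable_continuous_interval continuous_on_subset[OF noise_adj_sq_continuous]) auto

lemma q_diff:
  assumes "0 \<le> r1" "r1 \<le> r2" "r2 \<le> t"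
  shows "integral {r1..r2} (\<lambda>s. (norm (noise_adj h (t - s)))\<^sup>2) = q (t - r1) h - q (t - r2) h"
proof -
  have c: "continuous_on {u..v} (\<lambda>s. (norm (noise_adj h s))\<^sup>2)" if "0 \<le> u" for u v
    using that by (intro continuous_on_subset[OF noise_adj_sq_continuous]) auto
  have "integral {r1..r2} (\<lambda>s. (norm (noise_adj h (t - s)))\<^sup>2) = integral {t - r2..t - r1} (\<lambda>s. (norm (noise_adj h s))\<^sup>2)"
    using assms by (intro integral_reflect_shift c) auto
  moreover have "integral {0..t - r2} (\<lambda>s. (norm (noise_adj h s))\<^sup>2) + integral {t - r2..t - r1} (\<lambda>s. (norm (noise_adj h s))\<^sup>2)
      = integral {0..t - r1} (\<lambda>s. (norm (noise_adj h s))\<^sup>2)"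
    using assms by (intro Henstock_Kurzweil_Integration.integral_combine integrable_continuous_interval c) auto
  ultimately show ?thesis by (simp add: q_def)
qed

lemma q_0 [simp]: "q 0 h = 0"
  by (simp add: q_def)

lemma drift_bounded: obtains C where "C > 0" "\<And>s y. 0 \<le> s \<Longrightarrow> s \<le> t \<Longrightarrow> \<bar>drift s h y\<bar> \<le> C"
proof -
  obtain K where K: "K > 0" "\<And>s. 0 \<le> s \<Longrightarrow> s \<le> t \<Longrightarrow> norm (adj (T s)) \<le> K"
    using semigroup_bounded[OF T'] by blast
  let ?C = "b * (norm (adj V) * (K * norm h))"
  have b: "b \<ge> 0" using Bb[of 0] norm_ge_zero order_trans by blast
  have "\<bar>drift s h y\<bar> \<le> ?C" if "0 \<le> s" "s \<le> t" for s y
  proof -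
    have "\<bar>drift s h y\<bar> \<le> norm (B y) * norm (adj V (adj (T s) h))" unfolding drift_def by (rule Cauchy_Schwarz_ineq2)
    also have "\<dots> \<le> b * (norm (adj V) * (norm (adj (T s)) * norm h))"
      using b by (intro mult_mono Bb order_trans[OF norm_blinfun] norm_blinfun) auto
    also have "\<dots> \<le> ?C" using b K that by (intro mult_left_mono mult_right_mono) auto
    finally show ?thesis .
  qed
  moreover have "?C \<ge> 0" using b K by simp
  ultimately have C: "?C + 1 > 0" "\<bar>drift s h y\<bar> \<le> ?C + 1" if "0 \<le> s" "s \<le> t" for s y
    using that by (simp_all add: add_nonneg_pos add_increasing2)
  moreover have "?C + 1 > 0" using \<open>?C \<ge> 0\<close> by linarith
  ultimately show ?thesis using that by blast
qed

lemma drift_continuous: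
  assumes "continuous_on S g" "\<And>s. s \<in> S \<Longrightarrow> 0 \<le> g s" "continuous_on S f"
  shows "continuous_on S (\<lambda>s. drift (g s) h (f s))"
  unfolding drift_def
  by (intro continuous_intros continuous_on_compose2[OF B assms(3)] continuous_on_compose2[OF adjT_continuous assms(1)])
     (use assms(2) in auto)

lemma drift_measurable: "drift s h \<in> borel_measurable borel"
  unfolding drift_def by (intro borel_measurable_continuous_onI continuous_intros B)

end

locale mild_solution = mild_data T V G B b + wiener_space M F W
  for T :: "real \<Rightarrow> ('h::{real_inner,banach,second_countable_topology} \<Rightarrow>\<^sub>L 'h)"
    and V G B b and M :: "'a measure" and F W +
  fixes X :: "real \<Rightarrow> 'a \<Rightarrow> 'h" and x :: 'h
  assumes X_measurable_F: "0 \<le> t \<Longrightarrow> X t \<in> borel_measurable (F t)"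
    and X_continuous: "AE w in M. continuous_on {0..} (\<lambda>t. X t w)"
    and mild: "0 \<le> t \<Longrightarrow> \<exists>Z. is_stoch_conv M W T G t Z \<and>
        (AE w in M. X t w = T t x + (LINT s:{0..t}|lborel. T (t - s) (V (B (X s w)))) + Z w)"
begin

lemma X_measurable: "0 \<le> t \<Longrightarrow> X t \<in> borel_measurable M"
  using X_measurable_F measurable_F_M by blast

text \<open>The pairing <e^{(t-r)A} X(r), h>. Transporting the state to the fixed time
  \<open>t\<close> removes the generator: in \<open>r\<close> it changes only by a drift integral
  and a Wiener integral whose integrands do not depend on \<open>r\<close>.\<close>

definition obs :: "real \<Rightarrow> 'h \<Rightarrow> real \<Rightarrow> 'a \<Rightarrow> real" where
  "obs t h r w = inner (X r w) (adj (T (t - r)) h)"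

lemma obs_measurable_F: "0 \<le> r \<Longrightarrow> obs t h r \<in> borel_measurable (F r)"
  unfolding obs_def[abs_def] by (intro borel_measurable_inner X_measurable_F) auto

lemma obs_measurable [measurable]: "0 \<le> r \<Longrightarrow> obs t h r \<in> borel_measurable M"
  using obs_measurable_F measurable_F_M by blast

lemma obs_continuous:
  assumes "continuous_on {0..} (\<lambda>t. X t w)"
  shows "continuous_on {0..t} (\<lambda>r. obs t h r w)"
  unfolding obs_def
  by (intro continuous_intros continuous_on_subset[OF assms] continuous_on_compose2[OF adjT_continuous]) auto

lemma drift_X_continuous:
  assumes "continuous_on {0..} (\<lambda>t. X t w)"
  shows "continuous_on {0..t} (\<lambda>r. drift (t - r) h (X r w))"
  by (intro drift_continuous continuous_intros continuous_on_subset[OF assms]) auto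

lemma obs_representation:
  assumes r: "0 \<le> r" "r \<le> t"
  obtains Y where "is_wiener_integral M W r (\<lambda>s. noise_adj h (t - s)) Y"
    "AE w in M. obs t h r w = inner (T t x) h + integral {0..r} (\<lambda>s. drift (t - s) h (X s w)) + Y w"
proof -
  obtain Z where Z: "is_stoch_conv M W T G r Z"
    "AE w in M. X r w = T r x + (LINT s:{0..r}|lborel. T (r - s) (V (B (X s w)))) + Z w"
    using mild[OF r(1)] by blast
  \<comment> \<open>Testing the mild equation at time \<open>r\<close> against \<open>k\<close> is
    testing its image under \<open>T (t - r)\<close> against \<open>h\<close>; the semigroup law
    then replaces r - s by t - s in both kernels.\<close>
  define k where "k = adj (T (t - r)) h"
  have Tadd: "T (t - s) v = T (t - r) (T (r - s) v)" if "s \<le> r" for s v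
    using semigroup_add[OF T, of "t - r" "r - s" v] that r by simp
  have T'add: "adj (T (t - s)) h = adj (T (r - s)) k" if "s \<le> r" for s
    using semigroup_add[OF T', of "r - s" "t - r" h] that r by (simp add: k_def)
  show ?thesis
  proof (rule that)
    show "is_wiener_integral M W r (\<lambda>s. noise_adj h (t - s)) (\<lambda>w. inner (Z w) k)"
    proof (rule is_wiener_integral_cong)
      show "is_wiener_integral M W r (\<lambda>s. adj G (adj (T (r - s)) k)) (\<lambda>w. inner (Z w) k)"
        using Z(1) by (simp add: is_stoch_conv_def)
    qed (simp add: noise_adj_def T'add)
    show "AE w in M. obs t h r w = inner (T t x) h + integral {0..r} (\<lambda>s. drift (t - s) h (X s w)) + inner (Z w) k"
      using Z(2) X_continuous
    proof eventually_elim
      case (elim w)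
      let ?f = "\<lambda>s. T (r - s) (V (B (X s w)))"
      have c: "continuous_on {0..r} ?f"
        by (intro semigroup_continuous_on_apply[OF T] continuous_intros continuous_on_compose2[OF B] continuous_on_subset[OF elim(2)]) auto
      then have i: "set_integrable lborel {0..r} ?f" by (rule borel_integrable_atLeastAtMost')
      have d: "inner (?f s) k = drift (t - s) h (X s w)" if "s \<in> {0..r}" for s
      proof -
        have "inner (?f s) k = inner (T (t - s) (V (B (X s w)))) h"
          using Tadd[of s "V (B (X s w))"] that by (simp add: k_def flip: adj_inner)
        then show ?thesis by (simp add: drift_def adj_inner)
      qed
      have "inner (LINT s:{0..r}|lborel. ?f s) k = (LINT s:{0..r}|lborel. inner (?f s) k)"
        using i unfolding set_lebesgue_integral_def set_integrable_def
        by (simp flip: integral_inner_left)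
      also have "\<dots> = integral {0..r} (\<lambda>s. inner (?f s) k)"
        by (intro set_borel_integral_eq_integral borel_integrable_atLeastAtMost' continuous_intros c)
      also have "\<dots> = integral {0..r} (\<lambda>s. drift (t - s) h (X s w))"
        by (rule Henstock_Kurzweil_Integration.integral_cong) (rule d)
      finally have 1: "inner (LINT s:{0..r}|lborel. ?f s) k = integral {0..r} (\<lambda>s. drift (t - s) h (X s w))" .
      have "inner (T r x) k = inner (T t x) h"
        using Tadd[of 0 x] r by (simp add: k_def flip: adj_inner)
      then show ?case using elim(1) 1 by (simp add: obs_def inner_add_left flip: k_def)
    qed
  qed
qed

text \<open>The discounted expectation whose \<open>r\<close>-derivative is the integrand of Duhamel's formula.\<close>
definition disc :: "'a set \<Rightarrow> real \<Rightarrow> 'h \<Rightarrow> real \<Rightarrow> real \<Rightarrow> real" where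
  "disc E t h c r = exp (- q (t - r) h / 2) * (LINT w|M. indicator E w * cos (obs t h r w + c))"

text \<open>Only the drift term of Ito's formula: the second-order term, -1/2 times the squared norm
  of \<open>noise_adj h (t - r)\<close> times the cosine, is cancelled by the derivative of the
  exponential factor.\<close>

definition disc' :: "'a set \<Rightarrow> real \<Rightarrow> 'h \<Rightarrow> real \<Rightarrow> real \<Rightarrow> real" where
  "disc' E t h c r = exp (- q (t - r) h / 2) *
     (LINT w|M. indicator E w * - (sin (obs t h r w + c) * drift (t - r) h (X r w)))"

text \<open>\<open>I\<close> is the observable at \<open>r2\<close> with the drift on [r1,r2]
  switched off. The noise increment contributes exactly the ratio of the two exponential factors, so
  the change of \<open>disc\<close> is due to the drift alone. This takes the place of Ito's
  formula.\<close>

lemma disc_increment: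
  assumes r: "0 \<le> s" "s \<le> r1" "r1 \<le> r2" "r2 \<le> t" and E: "E \<in> sets (F s)"
  obtains I where "I \<in> borel_measurable M"
    "AE w in M. I w = obs t h r2 w
      - (integral {0..r2} (\<lambda>s. drift (t - s) h (X s w)) - integral {0..r1} (\<lambda>s. drift (t - s) h (X s w)))"
    "disc E t h c r2 - disc E t h c r1
      = exp (- q (t - r2) h / 2) * (LINT w|M. indicator E w * (cos (obs t h r2 w + c) - cos (I w + c)))"
proof -
  obtain Y1 where Y1: "is_wiener_integral M W r1 (\<lambda>s. noise_adj h (t - s)) Y1"
    "AE w in M. obs t h r1 w = inner (T t x) h + integral {0..r1} (\<lambda>s. drift (t - s) h (X s w)) + Y1 w"
    using obs_representation[of r1 t h] r by auto
  obtain Y2 where Y2: "is_wiener_integral M W r2 (\<lambda>s. noise_adj h (t - s)) Y2"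
    "AE w in M. obs t h r2 w = inner (T t x) h + integral {0..r2} (\<lambda>s. drift (t - s) h (X s w)) + Y2 w"
    using obs_representation[of r2 t h] r by auto
  have E1: "E \<in> sets (F r1)" using E sets_F_mono r by blast
  have EM[measurable]: "E \<in> sets M" using E sets_F_M by blast
  have [measurable]: "Y1 \<in> borel_measurable M" "Y2 \<in> borel_measurable M"
    using Y1 Y2 by (auto simp: is_wiener_integral_def)
  have [measurable]: "obs t h r1 \<in> borel_measurable M" "obs t h r2 \<in> borel_measurable M" using r by auto
  define I where "I w = obs t h r1 w + (Y2 w - Y1 w)" for w
  have [measurable]: "I \<in> borel_measurable M" unfolding I_def by measurable
  have ex: "(LINT w|M. indicator E w * cos (I w + c))
      = (LINT w|M. indicator E w * cos (obs t h r1 w + c)) * exp (- (q (t - r1) h - q (t - r2) h) / 2)"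
  proof -
    have "(LINT w|M. indicator E w * cos ((obs t h r1 w + c) + (Y2 w - Y1 w)))
      = (LINT w|M. indicator E w * cos (obs t h r1 w + c)) * exp (- integral {r1..r2} (\<lambda>s. (norm (noise_adj h (t - s)))\<^sup>2) / 2)"
    proof (rule expectation_cos_add_wiener_integral[OF _ r(3) _ Y1(1) Y2(1) E1])
      show "continuous_on {0..r2} (\<lambda>s. noise_adj h (t - s))"
        using r by (intro continuous_on_compose2[OF noise_adj_continuous] continuous_intros) auto
      show "(\<lambda>w. obs t h r1 w + c) \<in> borel_measurable (F r1)"
        using obs_measurable_F r by (intro borel_measurable_add) auto
    qed (use r in auto)
    also have "integral {r1..r2} (\<lambda>s. (norm (noise_adj h (t - s)))\<^sup>2) = q (t - r1) h - q (t - r2) h"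
      using r by (intro q_diff) auto
    finally show ?thesis by (simp add: I_def add_ac)
  qed
  have int: "integrable M (\<lambda>w. indicator E w * cos (J w + c))" if [measurable]: "J \<in> borel_measurable M" for J
    by (rule integrable_const_bound[of _ 1]) (auto simp: abs_mult indicator_def)
  show ?thesis
  proof (rule that[of I])
    show "AE w in M. I w = obs t h r2 w
      - (integral {0..r2} (\<lambda>s. drift (t - s) h (X s w)) - integral {0..r1} (\<lambda>s. drift (t - s) h (X s w)))"
      using Y1(2) Y2(2) by eventually_elim (simp add: I_def)
    have "exp (- q (t - r2) h / 2) * (LINT w|M. indicator E w * cos (I w + c)) = disc E t h c r1"
      unfolding ex disc_def by (simp add: mult_exp_exp field_simps)
    then show "disc E t h c r2 - disc E t h c r1
      = exp (- q (t - r2) h / 2) * (LINT w|M. indicator E w * (cos (obs t h r2 w + c) - cos (I w + c)))"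
      unfolding right_diff_distrib using int[of "obs t h r2"] int[of I] by (simp add: disc_def right_diff_distrib)
  qed measurable
qed

end

context mild_solution
begin

lemma drift_X_measurable: "0 \<le> r \<Longrightarrow> (\<lambda>w. drift s h (X r w)) \<in> borel_measurable M"
  by (rule measurable_compose[OF X_measurable drift_measurable])

text \<open>Difference quotients are taken along sequences for two reasons: the identities for
  \<open>I\<close> hold almost surely for each pair of times only, and dominated convergence is
  sequential. The bound on the drift dominates all quotients.\<close>

lemma disc_has_derivative:
  assumes s: "0 \<le> s" and r: "r \<in> {s..t}" and E: "E \<in> sets (F s)"
  shows "(disc E t h c has_real_derivative disc' E t h c r) (at r within {s..t})"
  unfolding has_field_derivative_iff tendsto_at_iff_sequentially
proof (intro allI impI)
  fix u :: "nat \<Rightarrow> real" assume u: "\<forall>i. u i \<in> {s..t} - {r}" and ur: "u \<longlonglongrightarrow> r"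
  have u': "\<forall>i. u i \<in> {0..t} - {r}" using u s by (meson DiffD1 DiffD2 DiffI atLeastAtMost_iff order_trans)
  have EM[measurable]: "E \<in> sets M" using E sets_F_M by blast
  \<comment> \<open>\<open>disc_increment\<close> needs ordered times, so \<open>u i\<close> and
    \<open>r\<close> are sorted; the difference quotient is symmetric in the two.\<close>
  define lo where "lo i = min r (u i)" for i
  define hi where "hi i = max r (u i)" for i
  define d where "d i = hi i - lo i" for i
  have bd: "s \<le> lo i" "lo i \<le> hi i" "hi i \<le> t" "d i > 0" "0 \<le> lo i" "0 \<le> hi i" for i
  proof -
    have "s \<le> u i" "u i \<le> t" "u i \<noteq> r" using u by auto
    then show "s \<le> lo i" "lo i \<le> hi i" "hi i \<le> t" "d i > 0" "0 \<le> lo i" "0 \<le> hi i"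
      using r s by (auto simp: lo_def hi_def d_def)
  qed
  have hir: "hi \<longlonglongrightarrow> r" using tendsto_max[OF tendsto_const ur, of r] by (simp add: hi_def[abs_def])
  have lor: "lo \<longlonglongrightarrow> r" using tendsto_min[OF tendsto_const ur, of r] by (simp add: lo_def[abs_def])
  have d0: "d \<longlonglongrightarrow> 0" using tendsto_diff[OF hir lor] by (simp add: d_def[abs_def])
  have quot: "(f (u i) - f r) / (u i - r) = (f (hi i) - f (lo i)) / d i" for f :: "real \<Rightarrow> real" and i
  proof (cases "u i \<le> r")
    case True
    have "(f (u i) - f r) / (u i - r) = (f r - f (u i)) / (r - u i)"
      by (metis minus_diff_eq minus_divide_divide)
    then show ?thesis using True by (simp add: hi_def lo_def d_def)
  qed (simp add: hi_def lo_def d_def)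
  let ?\<beta> = "\<lambda>w s. drift (t - s) h (X s w)"
  let ?P = "\<lambda>w r. integral {0..r} (?\<beta> w)"
  let ?rep = "\<lambda>i I. I \<in> borel_measurable M \<and>
      (AE w in M. I w = obs t h (hi i) w - (?P w (hi i) - ?P w (lo i))) \<and>
      disc E t h c (hi i) - disc E t h c (lo i)
        = exp (- q (t - hi i) h / 2) * (LINT w|M. indicator E w * (cos (obs t h (hi i) w + c) - cos (I w + c)))"
  have "\<forall>i. \<exists>I. ?rep i I"
  proof
    fix i
    show "\<exists>I. ?rep i I" by (rule disc_increment[OF s bd(1-3)[of i] E]) blast
  qed
  from choice[OF this] obtain I where I: "\<forall>i. ?rep i (I i)" by blast
  have Im[measurable]: "I i \<in> borel_measurable M" for i using I by blast
  have obsm[measurable]: "obs t h (hi i) \<in> borel_measurable M" "obs t h r \<in> borel_measurable M" for i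
    using bd(6)[of i] r s by auto
  have Iae: "AE w in M. \<forall>i. I i w = obs t h (hi i) w - (?P w (hi i) - ?P w (lo i))"
    unfolding AE_all_countable using I by blast
  obtain C where C: "C > 0" "\<And>s y. 0 \<le> s \<Longrightarrow> s \<le> t \<Longrightarrow> \<bar>drift s h y\<bar> \<le> C" using drift_bounded[of t h] by blast
  define g where "g i w = indicator E w * ((cos (obs t h (hi i) w + c) - cos (I i w + c)) / d i)" for i w
  define g0 where "g0 w = indicator E w * - (sin (obs t h r w + c) * drift (t - r) h (X r w))" for w
  have Q: "((\<lambda>y. (disc E t h c y - disc E t h c r) / (y - r)) \<circ> u) i = exp (- q (t - hi i) h / 2) * (LINT w|M. g i w)" for i
  proof -
    have "(LINT w|M. g i w) = (LINT w|M. indicator E w * (cos (obs t h (hi i) w + c) - cos (I i w + c))) / d i"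
      unfolding g_def times_divide_eq_right by simp
    then show ?thesis using I quot[of "disc E t h c" i] by simp
  qed
  have cX: "continuous_on {0..t} (?\<beta> w)" if "continuous_on {0..} (\<lambda>t. X t w)" for w
    by (rule drift_X_continuous[OF that])
  have lim: "(\<lambda>i. LINT w|M. g i w) \<longlonglongrightarrow> (LINT w|M. g0 w)"
  proof (rule integral_dominated_convergence[where w = "\<lambda>_. C"])
    show "g i \<in> borel_measurable M" for i unfolding g_def by measurable
    have [measurable]: "(\<lambda>w. drift (t - r) h (X r w)) \<in> borel_measurable M" using r s by (intro drift_X_measurable) auto
    show "g0 \<in> borel_measurable M" unfolding g0_def by measurable
    show "AE w in M. (\<lambda>i. g i w) \<longlonglongrightarrow> g0 w"
      using Iae X_continuous
    proof eventually_elim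
      case (elim w)
      let ?c = "\<lambda>i. (?P w (hi i) - ?P w (lo i)) / d i"
      have "(?P w has_real_derivative ?\<beta> w r) (at r within {0..t})"
        using r s by (intro integral_has_real_derivative cX elim) auto
      then have "((\<lambda>y. (?P w y - ?P w r) / (y - r)) \<circ> u) \<longlonglongrightarrow> ?\<beta> w r"
        unfolding has_field_derivative_iff tendsto_at_iff_sequentially using u' ur by blast
      then have cl: "?c \<longlonglongrightarrow> ?\<beta> w r" unfolding comp_def quot[of "?P w"] .
      have "(\<lambda>i. obs t h (hi i) w) \<longlonglongrightarrow> obs t h r w"
        by (rule continuous_on_tendsto_compose[OF obs_continuous[OF elim(2)] hir]) (use r s bd in auto)
      then have al: "(\<lambda>i. obs t h (hi i) w + c) \<longlonglongrightarrow> obs t h r w + c" by (intro tendsto_intros)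
      have Ic: "I i w + c = (obs t h (hi i) w + c) - d i * ?c i" for i
        using elim(1) bd(4)[of i] by simp
      have "(\<lambda>i. (cos (obs t h (hi i) w + c) - cos (I i w + c)) / d i) \<longlonglongrightarrow> - (sin (obs t h r w + c) * ?\<beta> w r)"
        unfolding Ic by (rule cos_difference_quotient_tendsto[OF al cl d0 bd(4)])
      then show ?case unfolding g_def g0_def by (intro tendsto_intros)
    qed
    show "AE w in M. norm (g i w) \<le> C" for i
      using Iae X_continuous
    proof eventually_elim
      case (elim w)
      have int: "?\<beta> w integrable_on {0..hi i}"
        using bd[of i] by (intro integrable_continuous_interval continuous_on_subset[OF cX[OF elim(2)]]) auto
      have "?P w (hi i) - ?P w (lo i) = integral {lo i..hi i} (?\<beta> w)"
        using Henstock_Kurzweil_Integration.integral_combine[OF bd(5) bd(2) int] by simp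
      also have "norm \<dots> \<le> C * (hi i - lo i)"
        using bd[of i] by (intro integral_bound continuous_on_subset[OF cX[OF elim(2)]]) (auto intro!: C(2))
      finally have P: "\<bar>?P w (hi i) - ?P w (lo i)\<bar> \<le> C * d i" by (simp add: d_def)
      have "\<bar>cos (obs t h (hi i) w + c) - cos (I i w + c)\<bar> \<le> \<bar>(obs t h (hi i) w + c) - (I i w + c)\<bar>"
        by (rule abs_cos_diff_le)
      also have "\<dots> \<le> C * d i" using P elim(1) by simp
      finally have "\<bar>(cos (obs t h (hi i) w + c) - cos (I i w + c)) / d i\<bar> \<le> C"
        using bd(4)[of i] by (simp add: field_simps)
      then show ?case using C(1) by (auto simp: g_def indicator_def)
    qed
  qed simp_all
  have ql: "(\<lambda>i. q (t - hi i) h) \<longlonglongrightarrow> q (t - r) h"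
    using r s bd by (intro continuous_on_tendsto_compose[OF q_continuous[of t h]] tendsto_intros hir) auto
  then have "(\<lambda>i. exp (- q (t - hi i) h / 2) * (LINT w|M. g i w)) \<longlonglongrightarrow> exp (- q (t - r) h / 2) * (LINT w|M. g0 w)"
    by (intro tendsto_mult tendsto_exp tendsto_divide tendsto_minus ql lim tendsto_const) simp
  then show "((\<lambda>y. (disc E t h c y - disc E t h c r) / (y - r)) \<circ> u) \<longlonglongrightarrow> disc' E t h c r"
    unfolding ext[OF Q] by (simp add: disc'_def g0_def)
qed

lemma disc'_continuous:
  assumes s: "0 \<le> s" and E: "E \<in> sets M"
  shows "continuous_on {s..t} (disc' E t h c)"
  unfolding continuous_on_sequentially
proof (intro allI impI ballI, elim conjE)
  fix u :: "nat \<Rightarrow> real" and r assume r: "r \<in> {s..t}" and u: "\<forall>n. u n \<in> {s..t}" and ur: "u \<longlonglongrightarrow> r"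
  note E[measurable]
  have u0: "0 \<le> u i" "u i \<le> t" for i using u s by (meson atLeastAtMost_iff order_trans)+
  obtain C where C: "C > 0" "\<And>s y. 0 \<le> s \<Longrightarrow> s \<le> t \<Longrightarrow> \<bar>drift s h y\<bar> \<le> C" using drift_bounded[of t h] by blast
  define g where "g v w = indicator E w * - (sin (obs t h v w + c) * drift (t - v) h (X v w))" for v w
  have gm: "g v \<in> borel_measurable M" if "v \<in> {s..t}" for v
  proof -
    have [measurable]: "(\<lambda>w. drift (t - v) h (X v w)) \<in> borel_measurable M" "obs t h v \<in> borel_measurable M"
      using that s by (auto intro!: drift_X_measurable obs_measurable)
    show ?thesis unfolding g_def by measurable
  qed
  have lim: "(\<lambda>i. LINT w|M. g (u i) w) \<longlonglongrightarrow> (LINT w|M. g r w)"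
  proof (rule integral_dominated_convergence[where w = "\<lambda>_. C"])
    show "AE w in M. (\<lambda>i. g (u i) w) \<longlonglongrightarrow> g r w"
      using X_continuous
    proof eventually_elim
      case (elim w)
      have "(\<lambda>i. obs t h (u i) w) \<longlonglongrightarrow> obs t h r w"
        by (rule continuous_on_tendsto_compose[OF obs_continuous[OF elim] ur]) (use r s u0 in auto)
      moreover have "(\<lambda>i. drift (t - u i) h (X (u i) w)) \<longlonglongrightarrow> drift (t - r) h (X r w)"
        by (rule continuous_on_tendsto_compose[OF drift_X_continuous[OF elim] ur]) (use r s u0 in auto)
      ultimately show ?case unfolding g_def by (intro tendsto_intros)
    qed
    show "AE w in M. norm (g (u i) w) \<le> C" for i
    proof (rule AE_I2)
      fix w
      have "\<bar>sin (obs t h (u i) w + c)\<bar> * \<bar>drift (t - u i) h (X (u i) w)\<bar> \<le> 1 * C"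
        using u0 C by (intro mult_mono C(2)) auto
      then show "norm (g (u i) w) \<le> C" using C(1) by (auto simp: g_def indicator_def abs_mult)
    qed
  qed (use gm r u in auto)
  have ql: "(\<lambda>i. q (t - u i) h) \<longlonglongrightarrow> q (t - r) h"
    using r s u0 by (intro continuous_on_tendsto_compose[OF q_continuous[of t h]] tendsto_intros ur) auto
  then have "(\<lambda>i. exp (- q (t - u i) h / 2) * (LINT w|M. g (u i) w)) \<longlonglongrightarrow> exp (- q (t - r) h / 2) * (LINT w|M. g r w)"
    by (intro tendsto_mult tendsto_exp tendsto_divide tendsto_minus ql lim tendsto_const) simp
  then show "(disc' E t h c \<circ> u) \<longlonglongrightarrow> disc' E t h c r"
    by (simp add: disc'_def g_def comp_def)
qed

lemma disc_FTC:
  assumes "0 \<le> s" "s \<le> t" "E \<in> sets (F s)"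
  shows "(disc' E t h c has_integral (disc E t h c t - disc E t h c s)) {s..t}"
  using assms disc_has_derivative
  by (intro fundamental_theorem_of_calculus) (auto simp: has_real_derivative_iff_has_vector_derivative)

end

section \<open>The Ornstein-Uhlenbeck semigroup on trigonometric sums\<close>

context mild_data
begin

text \<open>The solution of the linear equation started at \<open>y\<close>, tested against
  \<open>h\<close> at time \<open>t\<close>, is normal with mean
  \<open>inner y (adj (T t) h)\<close> and variance \<open>q t h\<close>; this is the resulting
  action on cosines.\<close>

definition ou :: "real \<Rightarrow> (real \<times> 'h \<times> real) list \<Rightarrow> (real \<times> 'h \<times> real) list" where
  "ou t = map (\<lambda>(a, h, c). (a * exp (- q t h / 2), adj (T t) h, c))"

text \<open>The derivative of \<open>trig (ou t l)\<close> at \<open>y\<close> in direction V B(y);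
  \<open>drift t h y\<close> is the pairing of that direction with the frequency
  \<open>adj (T t) h\<close>.\<close>

definition ou_drift :: "real \<Rightarrow> (real \<times> 'h \<times> real) list \<Rightarrow> 'h \<Rightarrow> real" where
  "ou_drift t l y = (\<Sum>(a, h, c)\<leftarrow>l. a * (exp (- q t h / 2) * - (sin (inner y (adj (T t) h) + c) * drift t h y)))"

lemma ou_drift_continuous: "continuous_on UNIV (ou_drift t l)"
proof (induction l)
  case (Cons x l)
  obtain a h c where x: "x = (a, h, c)" by (cases x)
  have "continuous_on UNIV (drift t h)" unfolding drift_def by (intro continuous_intros B)
  then show ?case using Cons unfolding x ou_drift_def by (simp, intro continuous_intros)
qed (simp add: ou_drift_def)

text \<open>A qualitative bound depending on \<open>l\<close>, for integrability only; the
  quantitative one is \<open>ou_drift_Gamma_bound\<close>.\<close>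

lemma ou_drift_bounded:
  assumes "0 \<le> t"
  shows "\<exists>C. \<forall>y. \<bar>ou_drift t l y\<bar> \<le> C"
proof (induction l)
  case (Cons x l)
  obtain a h c where x: "x = (a, h, c)" by (cases x)
  obtain K where K: "K > 0" "\<And>s y. 0 \<le> s \<Longrightarrow> s \<le> t \<Longrightarrow> \<bar>drift s h y\<bar> \<le> K" using drift_bounded[of t h] by blast
  obtain C where C: "\<And>y. \<bar>ou_drift t l y\<bar> \<le> C" using Cons by blast
  have "\<bar>ou_drift t (x # l) y\<bar> \<le> \<bar>a\<bar> * (exp (- q t h / 2) * (1 * K)) + C" for y
  proof -
    have "ou_drift t (x # l) y = a * (exp (- q t h / 2) * - (sin (inner y (adj (T t) h) + c) * drift t h y)) + ou_drift t l y"
      by (simp add: x ou_drift_def)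
    also have "\<bar>\<dots>\<bar> \<le> \<bar>a\<bar> * (exp (- q t h / 2) * (\<bar>sin (inner y (adj (T t) h) + c)\<bar> * \<bar>drift t h y\<bar>)) + \<bar>ou_drift t l y\<bar>"
      by (rule order_trans[OF abs_triangle_ineq]) (simp add: abs_mult)
    also have "\<dots> \<le> \<bar>a\<bar> * (exp (- q t h / 2) * (1 * K)) + C"
      using assms K C by (intro add_mono mult_left_mono mult_mono) auto
    finally show ?thesis .
  qed
  then show ?case by blast
qed (auto simp: ou_drift_def)

end

text \<open>Linear in \<open>l\<close>, so induction reduces it to a single cosine and
  \<open>disc_FTC\<close>: at r = t, \<open>q 0 h\<close> is 0 and \<open>T 0\<close> the identity,
  so \<open>disc\<close> is the expectation of the cosine; at r = s it is that of its image under
  \<open>ou\<close>.\<close>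

lemma (in mild_solution) duhamel:
  assumes st: "0 \<le> s" "s \<le> t" and E: "E \<in> sets (F s)"
  shows "((\<lambda>r. LINT w|M. indicator E w * ou_drift (t - r) l (X r w)) has_integral
      ((LINT w|M. indicator E w * trig l (X t w)) - (LINT w|M. indicator E w * trig (ou (t - s) l) (X s w)))) {s..t}"
    and "continuous_on {s..t} (\<lambda>r. LINT w|M. indicator E w * ou_drift (t - r) l (X r w))"
proof -
  have EM[measurable]: "E \<in> sets M" using E sets_F_M by blast
  have int: "integrable M (\<lambda>w. indicator E w * f (X r w))"
    if f: "f \<in> borel_measurable borel" "\<exists>C. \<forall>y. \<bar>f y\<bar> \<le> C" and r: "0 \<le> r" for f :: "'h \<Rightarrow> real" and r
  proof -
    obtain C where "\<And>y. \<bar>f y\<bar> \<le> C" using f(2) by blast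
    moreover have "(\<lambda>w. indicator E w * f (X r w)) \<in> borel_measurable M"
      using measurable_compose[OF X_measurable[OF r] f(1)] by measurable
    moreover have "0 \<le> C" using calculation(1)[of 0] by linarith
    ultimately show ?thesis by (intro integrable_const_bound[of _ C]) (auto simp: indicator_def)
  qed
  have intd: "integrable M (\<lambda>w. indicator E w * ou_drift (t - r) l (X r w))" if "r \<in> {s..t}" for r l
    using that st by (intro int ou_drift_bounded borel_measurable_continuous_onI ou_drift_continuous) auto
  have intt: "integrable M (\<lambda>w. indicator E w * trig l (X r w))" if "0 \<le> r" for r l
    using that by (intro int trig_bounded trig_measurable)
  let ?D = "\<lambda>l r. LINT w|M. indicator E w * ou_drift (t - r) l (X r w)"
  let ?v = "\<lambda>l r. LINT w|M. indicator E w * trig l (X r w)"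
  have "(?D l has_integral (?v l t - ?v (ou (t - s) l) s)) {s..t} \<and> continuous_on {s..t} (?D l)"
  proof (induction l)
    case Nil then show ?case by (simp add: ou_drift_def ou_def)
  next
    case (Cons z l)
    obtain a h c where z: "z = (a, h, c)" by (cases z)
    have D: "a * disc' E t h c r + ?D l r = ?D (z # l) r" if r: "r \<in> {s..t}" for r
    proof -
      have e: "ou_drift (t - r) (z # l) y = ou_drift (t - r) [z] y + ou_drift (t - r) l y" for y
        by (simp add: ou_drift_def)
      have "?D (z # l) r = ?D [z] r + ?D l r"
        unfolding e distrib_left using intd[OF r] by simp
      also have "?D [z] r = a * disc' E t h c r"
        unfolding disc'_def integral_mult_right_zero[symmetric]
        by (intro Bochner_Integration.integral_cong) (auto simp: ou_drift_def z obs_def)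
      finally show ?thesis by simp
    qed
    have v: "?v (z # l) r = ?v [z] r + ?v l r" if "0 \<le> r" for r l z
    proof -
      have e: "trig (z # l) y = trig [z] y + trig l y" for y by (simp add: trig_def)
      show ?thesis unfolding e distrib_left using intt[OF that] by simp
    qed
    have t1: "a * disc E t h c t = ?v [z] t"
      using semigroup_0[OF T', of h]
      unfolding disc_def integral_mult_right_zero[symmetric]
      by (intro Bochner_Integration.integral_cong) (auto simp: z obs_def)
    have s1: "a * disc E t h c s = ?v (ou (t - s) [z]) s"
      unfolding disc_def integral_mult_right_zero[symmetric]
      by (intro Bochner_Integration.integral_cong) (auto simp: z obs_def ou_def)
    have "((\<lambda>r. a * disc' E t h c r + ?D l r) has_integral (a * (disc E t h c t - disc E t h c s) + (?v l t - ?v (ou (t - s) l) s))) {s..t}"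
      using Cons by (intro has_integral_add has_integral_mult_right disc_FTC st E) auto
    moreover have "a * (disc E t h c t - disc E t h c s) + (?v l t - ?v (ou (t - s) l) s)
        = ?v (z # l) t - ?v (ou (t - s) (z # l)) s"
    proof -
      have "ou (t - s) (z # l) = hd (ou (t - s) [z]) # ou (t - s) l" "ou (t - s) [z] = [hd (ou (t - s) [z])]"
        by (simp_all add: ou_def)
      then have "?v (ou (t - s) (z # l)) s = ?v (ou (t - s) [z]) s + ?v (ou (t - s) l) s"
        using v[OF st(1), of "hd (ou (t - s) [z])" "ou (t - s) l"] by simp
      then show ?thesis using v[of t z l] st t1 s1 by (simp add: right_diff_distrib)
    qed
    ultimately have "((\<lambda>r. a * disc' E t h c r + ?D l r) has_integral (?v (z # l) t - ?v (ou (t - s) (z # l)) s)) {s..t}" by simp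
    then have 1: "(?D (z # l) has_integral (?v (z # l) t - ?v (ou (t - s) (z # l)) s)) {s..t}"
      by (rule has_integral_eq[rotated]) (rule D)
    have "continuous_on {s..t} (\<lambda>r. a * disc' E t h c r + ?D l r)"
      using Cons by (intro continuous_intros disc'_continuous st EM) auto
    then have "continuous_on {s..t} (?D (z # l))" by (rule continuous_on_eq) (rule D)
    with 1 show ?case by blast
  qed
  then show "(?D l has_integral (?v l t - ?v (ou (t - s) l) s)) {s..t}" "continuous_on {s..t} (?D l)" by auto
qed

section \<open>Weak uniqueness\<close>

context mild_data
begin

text \<open>The weak form of the Bochner integral, from which linearity, symmetry, positivity and
  the norm bound of \<open>Qop\<close> are read off.\<close>

lemma Qop_inner:
  assumes t: "0 \<le> t"
  shows "inner (Qop T G t x) y = integral {0..t} (\<lambda>s. inner (noise_adj x s) (noise_adj y s))"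
proof -
  let ?f = "\<lambda>s. T s (G (adj G (adj (T s) x)))"
  have c: "continuous_on {0..t} ?f"
    by (intro semigroup_continuous_on_apply[OF T] continuous_intros continuous_on_subset[OF adjT_continuous]) auto
  then have i: "set_integrable lborel {0..t} ?f" by (rule borel_integrable_atLeastAtMost')
  have "inner (Qop T G t x) y = (LINT s:{0..t}|lborel. inner (?f s) y)"
    using i unfolding Qop_def set_lebesgue_integral_def set_integrable_def
    by (simp flip: integral_inner_left)
  also have "\<dots> = integral {0..t} (\<lambda>s. inner (?f s) y)"
    by (intro set_borel_integral_eq_integral borel_integrable_atLeastAtMost' continuous_intros c)
  also have "(\<lambda>s. inner (?f s) y) = (\<lambda>s. inner (noise_adj x s) (noise_adj y s))"
    by (simp add: noise_adj_def adj_inner)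
  finally show ?thesis .
qed

lemma noise_adj_linear: "noise_adj (x + y) s = noise_adj x s + noise_adj y s" "noise_adj (c *\<^sub>R x) s = c *\<^sub>R noise_adj x s"
  by (simp_all add: noise_adj_def blinfun.add_right blinfun.scaleR_right)

lemma noise_adj_inner_integrable: "(\<lambda>s. inner (noise_adj x s) (noise_adj y s)) integrable_on {0..t}"
  by (intro integrable_continuous_interval continuous_intros continuous_on_subset[OF noise_adj_continuous]) auto

lemma Qop_bounded_linear:
  assumes t: "0 \<le> t"
  shows "bounded_linear (Qop T G t)"
proof -
  obtain K where K: "K > 0" "\<And>s. 0 \<le> s \<Longrightarrow> s \<le> t \<Longrightarrow> norm (adj (T s)) \<le> K"
    using semigroup_bounded[OF T'] by blast
  define C where "C = norm (adj G) * K"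
  have C: "norm (noise_adj x s) \<le> C * norm x" if "0 \<le> s" "s \<le> t" for x s
  proof -
    have "norm (noise_adj x s) \<le> norm (adj G) * (norm (adj (T s)) * norm x)"
      unfolding noise_adj_def by (intro order_trans[OF norm_blinfun] mult_left_mono norm_blinfun) auto
    also have "\<dots> \<le> norm (adj G) * (K * norm x)" using K that by (intro mult_left_mono mult_right_mono) auto
    finally show ?thesis by (simp add: C_def mult_ac)
  qed
  have C0: "C \<ge> 0" using K by (simp add: C_def)
  show ?thesis
  proof (rule bounded_linear_intro[where K = "C\<^sup>2 * t"])
    show "Qop T G t (x + y) = Qop T G t x + Qop T G t y" for x y
      by (rule inner_ext_left)
         (simp add: inner_add_left Qop_inner[OF t] noise_adj_linear Henstock_Kurzweil_Integration.integral_add noise_adj_inner_integrable)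
    show "Qop T G t (c *\<^sub>R x) = c *\<^sub>R Qop T G t x" for c x
      by (rule inner_ext_left) (simp add: Qop_inner[OF t] noise_adj_linear)
    show "norm (Qop T G t x) \<le> norm x * (C\<^sup>2 * t)" for x
    proof (rule norm_le_inner_bound)
      fix y
      have "inner y (Qop T G t x) = integral {0..t} (\<lambda>s. inner (noise_adj x s) (noise_adj y s))"
        by (simp only: inner_commute[of y] Qop_inner[OF t])
      also have "norm \<dots> \<le> (C * norm x) * (C * norm y) * (t - 0)"
      proof (rule integral_bound[OF t])
        show "continuous_on {0..t} (\<lambda>s. inner (noise_adj x s) (noise_adj y s))"
          by (intro continuous_intros continuous_on_subset[OF noise_adj_continuous]) auto
        show "norm (inner (noise_adj x s) (noise_adj y s)) \<le> C * norm x * (C * norm y)" if "s \<in> {0..t}" for s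
          using that C0 unfolding real_norm_def
          by (intro order_trans[OF Cauchy_Schwarz_ineq2] mult_mono C) auto
      qed
      finally show "\<bar>inner y (Qop T G t x)\<bar> \<le> norm x * (C\<^sup>2 * t) * norm y"
        by (simp add: power2_eq_square mult_ac)
    qed (use t in auto)
  qed
qed

text \<open>The squared norm of Q_t^{1/2} h is <Q_t h, h>, which rewrites the damping factor exp (-
  q t h / 2) in the form that the Gaussian bounds require.\<close>

lemma op_sqrt_Qop:
  assumes t: "0 \<le> t"
  obtains R where "op_sqrt (Qop T G t) = blinfun_apply R" "\<And>x y. inner (R x) y = inner x (R y)"
    "\<And>h. (norm (R h))\<^sup>2 = q t h"
proof -
  define Q where "Q = Blinfun (Qop T G t)"
  have Q: "blinfun_apply Q = Qop T G t" unfolding Q_def by (rule bounded_linear_Blinfun_apply[OF Qop_bounded_linear[OF t]])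
  have sym: "inner (Q x) y = inner x (Q y)" for x y
    by (simp add: Q Qop_inner[OF t] inner_commute[of x] inner_commute[of "noise_adj x _"])
  have qq: "inner (Q x) x = q t x" for x
    by (simp add: Q Qop_inner[OF t] q_def power2_norm_eq_inner)
  have pos: "0 \<le> inner (Q x) x" for x
    unfolding qq q_def
    by (intro integral_nonneg integrable_continuous_interval continuous_on_subset[OF noise_adj_sq_continuous]) auto
  note R = op_sqrt_psd[OF sym pos]
  define R' where "R' = Blinfun (op_sqrt (Qop T G t))"
  have R': "op_sqrt (Qop T G t) = blinfun_apply R'"
    unfolding R'_def by (rule bounded_linear_Blinfun_apply[symmetric]) (use R(1) Q in simp)
  have sR: "inner (R' x) y = inner x (R' y)" for x y using R(2) by (simp add: Q R')
  have "(norm (R' h))\<^sup>2 = q t h" for h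
  proof -
    have "(norm (R' h))\<^sup>2 = inner (R' (R' h)) h" by (simp add: power2_norm_eq_inner sR)
    also have "R' (R' h) = Q h" using R(3) by (simp add: Q R')
    finally show ?thesis by (simp add: qq)
  qed
  then show ?thesis using that R' sR by blast
qed

text \<open>With u = B(y)/|B(y)| and k = \<Gamma>_t V u, the range condition gives T_t V u = R k for
  R the square root of Q_t. The drift is then |B(y)| times <k, R h>, so the derivative is in a
  direction covered by \<open>gaussian_derivative_bound\<close>. The inequality is in
  \<open>ennreal\<close> because the operator norm may be infinite.\<close>

lemma ou_drift_Gamma_bound:
  assumes t: "t > 0" and range: "range (T t) \<subseteq> range (op_sqrt (Qop T G t))" and l: "\<And>y. \<bar>trig l y\<bar> \<le> 1"
    and b: "b > 0"
  shows "ennreal (\<bar>ou_drift t l y\<bar> / b) \<le> opnorm_e (\<lambda>u. Gamma T G t (V u))"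
proof (cases "B y = 0")
  case True
  have "ou_drift t l y = 0" unfolding ou_drift_def drift_def True by (induction l) auto
  then show ?thesis by simp
next
  case False
  obtain R where R: "op_sqrt (Qop T G t) = blinfun_apply R" "\<And>x y. inner (R x) y = inner x (R y)"
    "\<And>h. (norm (R h))\<^sup>2 = q t h" using op_sqrt_Qop t by (metis less_imp_le)
  define u where "u = (1 / norm (B y)) *\<^sub>R B y"
  have u: "u \<in> cball 0 1" "B y = norm (B y) *\<^sub>R u" using False by (auto simp: u_def)
  define k where "k = Gamma T G t (V u)"
  have Rk: "R k = T t (V u)"
    unfolding k_def Gamma_def R(1) using range R(1)
    by (intro pinv_right_inverse blinfun.bounded_linear_right) auto
  have d: "drift t h y = norm (B y) * inner k (R h)" for h
  proof -
    have "drift t h y = norm (B y) * inner u (adj V (adj (T t) h))"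
      unfolding drift_def by (subst u(2)) simp
    also have "inner u (adj V (adj (T t) h)) = inner (T t (V u)) h" by (simp add: adj_inner)
    also have "\<dots> = inner k (R h)" by (simp add: R(2) flip: Rk)
    finally show ?thesis .
  qed
  have "ou_drift t l y = - (norm (B y) * (\<Sum>(a, h, c)\<leftarrow>l. a * inner k (R h) * exp (- (norm (R h))\<^sup>2 / 2) * sin (inner (T t y) h + c)))"
    unfolding ou_drift_def d R(3) adj_inner by (induction l) (auto simp: algebra_simps)
  then have "\<bar>ou_drift t l y\<bar> \<le> norm (B y) * (norm k * 1)"
    using gaussian_derivative_bound[OF l, of k R "T t y"] l by (simp add: abs_mult mult_left_mono)
  also have "\<dots> \<le> b * (norm k * 1)" by (intro mult_right_mono Bb) auto
  finally have "\<bar>ou_drift t l y\<bar> / b \<le> norm k" using b by (simp add: field_simps)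
  then have "ennreal (\<bar>ou_drift t l y\<bar> / b) \<le> ennreal (norm k)" by (rule ennreal_leI)
  also have "\<dots> \<le> opnorm_e (\<lambda>u. Gamma T G t (V u))"
    unfolding opnorm_e_def k_def using u(1) by (intro SUP_upper2[of u]) auto
  finally show ?thesis .
qed

end

section \<open>Laws of a solution on events of the past\<close>

context mild_solution
begin

text \<open>Unnormalised, with total mass the probability of \<open>E\<close>, so null events need
  no exception and conditioning on further times is plain restriction.\<close>

definition law :: "'a set \<Rightarrow> real \<Rightarrow> 'h measure" where
  "law E t = distr (density M (indicator E)) borel (X t)"

lemma sets_law [simp]: "sets (law E t) = sets borel"
  by (simp add: law_def)

lemma emeasure_law:
  assumes [measurable]: "E \<in> sets M" "A \<in> sets borel" and t: "0 \<le> t"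
  shows "emeasure (law E t) A = emeasure M (E \<inter> X t -` A \<inter> space M)"
proof -
  have [measurable]: "X t \<in> borel_measurable M" using X_measurable t by simp
  have [measurable]: "X t -` A \<inter> space M \<in> sets M" by (rule measurable_sets[of _ _ borel]) auto
  have "emeasure (law E t) A = emeasure (density M (indicator E)) (X t -` A \<inter> space M)"
    unfolding law_def by (subst emeasure_distr) auto
  also have "\<dots> = (\<integral>\<^sup>+ w. indicator E w * indicator (X t -` A \<inter> space M) w \<partial>M)"
    by (rule emeasure_density) auto
  also have "\<dots> = (\<integral>\<^sup>+ w. indicator (E \<inter> (X t -` A \<inter> space M)) w \<partial>M)"
    unfolding indicator_inter_arith ..
  also have "\<dots> = emeasure M (E \<inter> (X t -` A \<inter> space M))"
    by (intro nn_integral_indicator) simp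
  also have "E \<inter> (X t -` A \<inter> space M) = E \<inter> X t -` A \<inter> space M" by blast
  finally show ?thesis .
qed

lemma finite_measure_law:
  assumes "E \<in> sets M" "0 \<le> t"
  shows "finite_measure (law E t)"
  by (rule finite_measureI) (use assms sets_eq_imp_space_eq[OF sets_law] in "simp add: emeasure_law")

lemma integral_law:
  fixes f :: "'h \<Rightarrow> real"
  assumes [measurable]: "E \<in> sets M" "f \<in> borel_measurable borel" and t: "0 \<le> t"
  shows "(LINT y|law E t. f y) = (LINT w|M. indicator E w * f (X t w))"
proof -
  have [measurable]: "X t \<in> borel_measurable M" using X_measurable t by simp
  have "(LINT y|law E t. f y) = (\<integral>w. f (X t w) \<partial>density M (\<lambda>w. ennreal (indicator E w)))"
    unfolding law_def by (subst integral_distr) (auto simp: ennreal_indicator)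
  also have "\<dots> = (LINT w|M. indicator E w *\<^sub>R f (X t w))" by (rule integral_density) auto
  finally show ?thesis by simp
qed

text \<open>At time 0 the isometry against the zero step integrand makes the second moment of the
  noise term an integral over a single point, so the noise vanishes. Testing against the finitely
  many frequencies of \<open>l\<close> suffices.\<close>

lemma initial_law: "(LINT y|law (space M) 0. trig l y) = trig l x"
proof -
  have ini: "AE w in M. inner (X 0 w) h = inner x h" for h
  proof -
    obtain Y where Y: "is_wiener_integral M W 0 (\<lambda>s. noise_adj h (0 - s)) Y"
      "AE w in M. obs 0 h 0 w = inner (T 0 x) h + integral {0..0} (\<lambda>s. drift (0 - s) h (X s w)) + Y w"
      by (rule obs_representation[of 0 0 h]) auto
    have [measurable]: "Y \<in> borel_measurable M" using Y(1) by (simp add: is_wiener_integral_def)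
    have "\<forall>n ts us. ts 0 = 0 \<and> ts n = 0 \<and> (\<forall>i<n. ts i \<le> ts (Suc i)) \<longrightarrow>
        (\<integral>\<^sup>+ w. ennreal ((Y w - stepint W n ts us w)\<^sup>2) \<partial>M) =
        (\<integral>\<^sup>+ s\<in>{0..0}. ennreal ((norm (noise_adj h (0 - s) - stepfun n ts us s))\<^sup>2) \<partial>lborel)"
      using Y(1) unfolding is_wiener_integral_def by blast
    \<comment> \<open>No subintervals: the step integral and the step function are 0.\<close>
    from this[rule_format, of "\<lambda>_. 0" 0 "\<lambda>_. 0"]
    have "(\<integral>\<^sup>+ w. ennreal ((Y w)\<^sup>2) \<partial>M) = (\<integral>\<^sup>+ s\<in>{0::real}. ennreal ((norm (noise_adj h (0 - s)))\<^sup>2) \<partial>lborel)"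
      by (simp add: stepint_def stepfun_def)
    also have "\<dots> = (\<integral>\<^sup>+ s. 0 \<partial>(lborel :: real measure))"
    proof (rule nn_integral_cong_AE)
      show "AE s in lborel. ennreal ((norm (noise_adj h (0 - s)))\<^sup>2) * indicator {0} s = 0"
        using AE_lborel_singleton[of "0::real"] by eventually_elim auto
    qed
    finally have "(\<integral>\<^sup>+ w. ennreal ((Y w)\<^sup>2) \<partial>M) = 0" by simp
    then have "AE w in M. ennreal ((Y w)\<^sup>2) = 0" by (subst (asm) nn_integral_0_iff_AE) auto
    then show ?thesis using Y(2)
      by eventually_elim (simp add: obs_def semigroup_0[OF T] semigroup_0[OF T'])
  qed
  have "AE w in M. \<forall>z\<in>set l. inner (X 0 w) (fst (snd z)) = inner x (fst (snd z))"
    by (intro AE_finite_allI ini) auto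
  then have "AE w in M. trig l (X 0 w) = trig l x"
  proof eventually_elim
    case (elim w)
    then show ?case unfolding trig_def by (intro arg_cong[where f = sum_list] map_cong) auto
  qed
  then have "(LINT w|M. indicator (space M) w * trig l (X 0 w)) = (LINT w|M. trig l x)"
    using measurable_compose[OF X_measurable trig_measurable, of 0 l]
    by (intro integral_cong_AE) (auto simp: indicator_def)
  then show ?thesis by (simp add: integral_law prob_space)
qed

end

lemma (in mild_solution) integral_law_le_1:
  fixes f :: "'h \<Rightarrow> real"
  assumes [measurable]: "E \<in> sets M" "f \<in> borel_measurable borel" and f: "\<And>y. \<bar>f y\<bar> \<le> 1" and t: "0 \<le> t"
  shows "\<bar>LINT y|law E t. f y\<bar> \<le> 1"
proof -
  let ?g = "\<lambda>w. indicator E w * f (X t w)"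
  have [measurable]: "X t \<in> borel_measurable M" using X_measurable t by simp
  have g: "\<bar>?g w\<bar> \<le> 1" for w using f by (simp add: indicator_def)
  then have i: "integrable M ?g" by (intro integrable_const_bound[of _ 1]) auto
  have "\<bar>LINT w|M. ?g w\<bar> \<le> (LINT w|M. \<bar>?g w\<bar>)" by (rule integral_abs_bound)
  also have "\<dots> \<le> (LINT w|M. 1)" by (intro integral_mono integrable_abs i g) auto
  finally show ?thesis using t by (simp add: integral_law prob_space)
qed

section \<open>Comparison of two solutions\<close>

locale mild_pair = S1: mild_solution T V G B b M F W X x + S2: mild_solution T V G B b M' F' W' X' x
  for T :: "real \<Rightarrow> ('h::{real_inner,banach,second_countable_topology} \<Rightarrow>\<^sub>L 'h)"
    and V G :: "'u::{real_inner,banach,second_countable_topology} \<Rightarrow>\<^sub>L 'h" and B :: "'h \<Rightarrow> 'u" and b :: real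
    and M :: "'a measure" and F and W and X :: "real \<Rightarrow> 'a \<Rightarrow> 'h" and x :: 'h
    and M' :: "'b measure" and F' and W' and X' :: "real \<Rightarrow> 'b \<Rightarrow> 'h" +
  assumes b_pos: "b > 0"
    and range_T: "t > 0 \<Longrightarrow> range (T t) \<subseteq> range (op_sqrt (Qop T G t))"
    and Gamma_integrable: "(\<integral>\<^sup>+ s\<in>{0<..1}. opnorm_e (\<lambda>u. Gamma T G s (V u)) \<partial>lborel) < \<infinity>"
begin

definition gap :: "'a set \<Rightarrow> 'b set \<Rightarrow> real \<Rightarrow> ('h \<Rightarrow> real) \<Rightarrow> real" where
  "gap E E' r f = (LINT y|S1.law E r. f y) - (LINT y|S2.law E' r. f y)"

text \<open>By \<open>trig_norming\<close> this bounds the total variation norm of the difference of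
  the laws, without a signed measure or a supremum.\<close>

definition trig_gap_le :: "'a set \<Rightarrow> 'b set \<Rightarrow> real \<Rightarrow> real \<Rightarrow> bool" where
  "trig_gap_le E E' r K \<longleftrightarrow> (\<forall>l. (\<forall>y. \<bar>trig l y\<bar> \<le> 1) \<longrightarrow> \<bar>gap E E' r (trig l)\<bar> \<le> K)"

lemma gap_le:
  assumes E: "E \<in> sets M" "E' \<in> sets M'" "0 \<le> r" and K: "trig_gap_le E E' r K" "K \<ge> 0"
    and \<psi>: "continuous_on UNIV \<psi>" "\<And>y. \<bar>\<psi> y\<bar> \<le> c"
  shows "\<bar>gap E E' r \<psi>\<bar> \<le> c * K"
proof (cases "c > 0")
  case True
  show ?thesis unfolding gap_def
    by (rule trig_norming[OF S1.finite_measure_law S2.finite_measure_law])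
       (use E K \<psi> True in "auto simp: trig_gap_le_def gap_def")
next
  case False
  then have "\<psi> y = 0" for y using \<psi>(2)[of y] by linarith
  moreover have "c = 0" using False \<psi>(2)[of 0] by linarith
  ultimately show ?thesis by (simp add: gap_def)
qed

lemma trig_gap_le_2:
  assumes E: "E \<in> sets M" "E' \<in> sets M'" "0 \<le> r"
  shows "trig_gap_le E E' r 2"
  unfolding trig_gap_le_def
proof (intro allI impI)
  fix l :: "(real \<times> 'h \<times> real) list" assume l: "\<forall>y. \<bar>trig l y\<bar> \<le> 1"
  have "\<bar>LINT y|S1.law E r. trig l y\<bar> \<le> 1" "\<bar>LINT y|S2.law E' r. trig l y\<bar> \<le> 1"
    using E l by (auto intro!: S1.integral_law_le_1 S2.integral_law_le_1)
  then show "\<bar>gap E E' r (trig l)\<bar> \<le> 2" unfolding gap_def by linarith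
qed

text \<open>The semigroup terms at time \<open>s\<close> cancel because the laws agree there; only
  the two drift integrals remain.\<close>

lemma gap_duhamel:
  assumes st: "0 \<le> s" "s \<le> t" and E: "E \<in> sets (F s)" "E' \<in> sets (F' s)" and eq: "S1.law E s = S2.law E' s"
  shows "((\<lambda>r. gap E E' r (S1.ou_drift (t - r) l)) has_integral gap E E' t (trig l)) {s..t}"
    and "continuous_on {s..t} (\<lambda>r. gap E E' r (S1.ou_drift (t - r) l))"
proof -
  have EM: "E \<in> sets M" "E' \<in> sets M'" using E S1.sets_F_M S2.sets_F_M by blast+
  let ?a = "\<lambda>f r. LINT w|M. indicator E w * f (X r w)" and ?b = "\<lambda>f r. \<integral>w. indicator E' w * f (X' r w) \<partial>M'"
  let ?\<psi> = "\<lambda>r. S1.ou_drift (t - r) l" and ?\<phi> = "trig (S1.ou (t - s) l)"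
  have g: "?a f r - ?b f r = gap E E' r f" if "f \<in> borel_measurable borel" "0 \<le> r" for f r
    using that by (simp add: gap_def S1.integral_law[OF EM(1)] S2.integral_law[OF EM(2)])
  have D: "?a (?\<psi> r) r - ?b (?\<psi> r) r = gap E E' r (?\<psi> r)" if "r \<in> {s..t}" for r
    using that st by (intro g borel_measurable_continuous_onI S1.ou_drift_continuous) auto
  have "?a ?\<phi> s - ?b ?\<phi> s = 0" "?a (trig l) t - ?b (trig l) t = gap E E' t (trig l)"
    using st g[of ?\<phi> s] g[of "trig l" t] by (simp_all add: gap_def eq)
  then have e: "(?a (trig l) t - ?a ?\<phi> s) - (?b (trig l) t - ?b ?\<phi> s) = gap E E' t (trig l)" by simp
  show "((\<lambda>r. gap E E' r (?\<psi> r)) has_integral gap E E' t (trig l)) {s..t}"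
    using has_integral_diff[OF S1.duhamel(1)[OF st E(1)] S2.duhamel(1)[OF st E(2)], of l l]
    unfolding e by (rule has_integral_eq[rotated]) (rule D)
  have "continuous_on {s..t} (\<lambda>r. ?a (?\<psi> r) r - ?b (?\<psi> r) r)"
    by (intro continuous_on_diff S1.duhamel(2)[OF st E(1)] S2.duhamel(2)[OF st E(2)])
  then show "continuous_on {s..t} (\<lambda>r. gap E E' r (?\<psi> r))" by (rule continuous_on_eq) (rule D)
qed

text \<open>One step of the Volterra argument, with \<open>d\<close> uniform in the starting time,
  the events and \<open>K\<close>, so that it can be both iterated and restarted.\<close>

definition halving :: "real \<Rightarrow> bool" where
  "halving d \<longleftrightarrow> (\<forall>s\<ge>0. \<forall>E\<in>sets (F s). \<forall>E'\<in>sets (F' s). \<forall>K>0. S1.law E s = S2.law E' s \<longrightarrow>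
    (\<forall>r\<in>{s..s + d}. trig_gap_le E E' r K) \<longrightarrow> (\<forall>r\<in>{s..s + d}. trig_gap_le E E' r (K / 2)))"

lemma trig_gap_halving: "\<exists>d>0. halving d"
proof -
  let ?\<kappa> = "\<lambda>s. opnorm_e (\<lambda>u. Gamma T G s (V u))"
  \<comment> \<open>The threshold 1 / (2 * b), multiplied by the bound \<open>b\<close> of
    \<open>B\<close> and by \<open>K\<close>, gives K / 2.\<close>
  obtain d where d: "0 < d" "d \<le> 1" and small:
    "\<And>p. p \<in> borel_measurable borel \<Longrightarrow> (\<And>s. 0 < s \<Longrightarrow> s \<le> d \<Longrightarrow> p s \<le> ?\<kappa> s) \<Longrightarrow>
      (\<integral>\<^sup>+ s\<in>{0<..d}. p s \<partial>lborel) \<le> ennreal (1 / (2 * b))"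
    by (rule lower_integral_small_near_0[OF Gamma_integrable, of "1 / (2 * b)"]) (use b_pos in auto)
  have "trig_gap_le E E' t (K / 2)"
    if s: "0 \<le> s" and E: "E \<in> sets (F s)" "E' \<in> sets (F' s)" and eq: "S1.law E s = S2.law E' s" and K: "K > 0"
      and hyp: "\<forall>r\<in>{s..s + d}. trig_gap_le E E' r K" and t: "s \<le> t" "t \<le> s + d" for E E' s K t
    unfolding trig_gap_le_def
  proof (intro allI impI)
    fix l :: "(real \<times> 'h \<times> real) list" assume l: "\<forall>y. \<bar>trig l y\<bar> \<le> 1"
    have EM: "E \<in> sets M" "E' \<in> sets M'" using E S1.sets_F_M S2.sets_F_M by blast+
    define D where "D r = gap E E' r (S1.ou_drift (t - r) l)" for r
    note Dint = gap_duhamel(1)[OF s t(1) E eq, of l, folded D_def]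
    have Dc: "continuous_on {s..t} D" unfolding D_def by (rule gap_duhamel(2)[OF s t(1) E eq])
    \<comment> \<open>At elapsed time \<open>r\<close> the tested function is at most b * k in sup
      norm, \<open>k\<close> being the kernel value, so norming bounds its gap by b * k * K; an
      infinite kernel value leaves nothing to prove.\<close>
    have Db: "ennreal (\<bar>D (t - r)\<bar> / (b * K)) \<le> ?\<kappa> r" if r: "0 < r" "r \<le> t - s" for r
    proof (cases "?\<kappa> r = \<top>")
      case False
      define k where "k = enn2real (?\<kappa> r)"
      have k: "?\<kappa> r = ennreal k" "k \<ge> 0" using False by (auto simp: k_def less_top)
      have "\<bar>S1.ou_drift r l y\<bar> \<le> b * k" for y
      proof -
        have "ennreal (\<bar>S1.ou_drift r l y\<bar> / b) \<le> ennreal k"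
          using S1.ou_drift_Gamma_bound[OF r(1) range_T[OF r(1)] _ b_pos, of l y] l k(1) by simp
        then have "\<bar>S1.ou_drift r l y\<bar> / b \<le> k" using k(2) by simp
        then show ?thesis using b_pos by (simp add: field_simps)
      qed
      then have "\<bar>gap E E' (t - r) (S1.ou_drift r l)\<bar> \<le> (b * k) * K"
        using r s t K by (intro gap_le EM hyp[rule_format] S1.ou_drift_continuous) auto
      then have "\<bar>D (t - r)\<bar> / (b * K) \<le> k" using b_pos K by (simp add: D_def field_simps)
      then show ?thesis unfolding k(1) by (rule ennreal_leI)
    qed simp
    \<comment> \<open>A minorant of the kernel on (0,d], extended by 0 and measurable since
      \<open>D\<close> is continuous on [s,t]; only for measurable minorants is the smallness of the
      lower integral available.\<close>
    define p where "p r = ennreal (\<bar>indicator {0..t - s} r *\<^sub>R D (t - r)\<bar> / (b * K))" for r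
    have Dr: "continuous_on {0..t - s} (\<lambda>r. D (t - r))"
      by (intro continuous_on_compose2[OF Dc] continuous_intros) auto
    have mD: "(\<lambda>r. indicator {0..t - s} r *\<^sub>R D (t - r)) \<in> borel_measurable borel"
      using Dr by (intro borel_measurable_continuous_on_indicator) auto
    then have pm: "p \<in> borel_measurable borel" unfolding p_def by measurable
    have "p r \<le> ?\<kappa> r" if "0 < r" "r \<le> d" for r
      using Db[of r] that by (auto simp: p_def split: split_indicator)
    from small[OF pm this] have pI: "(\<integral>\<^sup>+ r\<in>{0<..d}. p r \<partial>lborel) \<le> ennreal (1 / (2 * b))" by simp
    let ?I = "integral {0..t - s} (\<lambda>r. \<bar>D (t - r)\<bar>)"
    have absc: "continuous_on {0..t - s} (\<lambda>r. \<bar>D (t - r)\<bar>)" using Dr by (intro continuous_intros)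
    have sint: "set_integrable lborel {0..t - s} (\<lambda>r. \<bar>D (t - r)\<bar>)" by (rule borel_integrable_atLeastAtMost'[OF absc])
    have "\<bar>gap E E' t (trig l)\<bar> = norm (integral {s..t} D)" using Dint by (simp add: integral_unique)
    also have "\<dots> \<le> integral {s..t} (\<lambda>r. \<bar>D r\<bar>)"
      using Dc by (intro integral_norm_bound_integral integrable_continuous_interval continuous_intros) auto
    also have "\<dots> = ?I"
      using integral_reflect_shift[of t "t - s" 0 "\<lambda>r. \<bar>D r\<bar>"] Dc t by (simp add: continuous_on_rabs)
    also have "?I \<le> (b * K) * (1 / (2 * b))"
    proof -
      have "ennreal ?I = ennreal (LINT r:{0..t - s}|lborel. \<bar>D (t - r)\<bar>)"
        using set_borel_integral_eq_integral(2)[OF sint] by simp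
      also have "\<dots> = (\<integral>\<^sup>+ r. ennreal (indicator {0..t - s} r *\<^sub>R \<bar>D (t - r)\<bar>) \<partial>lborel)"
        using sint unfolding set_lebesgue_integral_def set_integrable_def by (intro nn_integral_eq_integral[symmetric]) auto
      also have "\<dots> \<le> (\<integral>\<^sup>+ r. ennreal (b * K) * (p r * indicator {0<..d} r) \<partial>lborel)"
      proof (rule nn_integral_mono_AE)
        show "AE r in lborel. ennreal (indicator {0..t - s} r *\<^sub>R \<bar>D (t - r)\<bar>) \<le> ennreal (b * K) * (p r * indicator {0<..d} r)"
          using AE_lborel_singleton[of "0::real"]
          by eventually_elim (use t b_pos K in "auto simp: p_def ennreal_mult'[symmetric] split: split_indicator")
      qed
      also have "\<dots> = ennreal (b * K) * (\<integral>\<^sup>+ r\<in>{0<..d}. p r \<partial>lborel)"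
        using pm by (intro nn_integral_cmult) auto
      also have "\<dots> \<le> ennreal (b * K) * ennreal (1 / (2 * b))" by (intro mult_left_mono pI) auto
      also have "\<dots> = ennreal ((b * K) * (1 / (2 * b)))" using b_pos K by (intro ennreal_mult[symmetric]) auto
      finally show ?thesis using b_pos K by (subst (asm) ennreal_le_iff) auto
    qed
    also have "\<dots> = K / 2" using b_pos by (simp add: field_simps)
    finally show "\<bar>gap E E' t (trig l)\<bar> \<le> K / 2" .
  qed
  then have "halving d" unfolding halving_def by (auto simp: Ball_def)
  with d(1) show ?thesis by blast
qed

text \<open>From the trivial bound 2, repeated halving forces the gap to 0 on an interval of length
  \<open>d\<close>; equality at its right end restarts the argument with the same events, which stay
  in the filtration.\<close>

lemma law_propagates:
  assumes s: "0 \<le> s" and E: "E \<in> sets (F s)" "E' \<in> sets (F' s)" and eq: "S1.law E s = S2.law E' s" and t: "s \<le> t"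
  shows "S1.law E t = S2.law E' t"
proof -
  obtain d where d: "d > 0" "halving d" using trig_gap_halving by blast
  have EM: "E \<in> sets M" "E' \<in> sets M'" using E S1.sets_F_M S2.sets_F_M by blast+
  have local: "S1.law E r = S2.law E' r" if v: "s \<le> v" "S1.law E v = S2.law E' v" "v \<le> r" "r \<le> v + d" for v r
  proof -
    have Ev: "E \<in> sets (F v)" "E' \<in> sets (F' v)" using E S1.sets_F_mono[OF v(1)] S2.sets_F_mono[OF v(1)] by blast+
    have v0: "0 \<le> v" using s v by simp
    have pow: "\<forall>r\<in>{v..v + d}. trig_gap_le E E' r (2 * (1 / 2) ^ n)" for n
    proof (induction n)
      case 0
      then show ?case using trig_gap_le_2[OF EM] v0 by simp
    next
      case (Suc n)
      then show ?case
        using d(2)[unfolded halving_def, rule_format, OF v0 Ev, of "2 * (1 / 2) ^ n"] v(2) by simp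
    qed
    have zero: "gap E E' r (trig l) = 0" if l: "\<And>y. \<bar>trig l y\<bar> \<le> 1" for l
    proof -
      have le: "\<bar>gap E E' r (trig l)\<bar> \<le> 2 * (1 / 2) ^ n" for n
        using pow v(3,4) l by (simp add: trig_gap_le_def)
      have "(\<lambda>n. 2 * (1 / 2) ^ n :: real) \<longlonglongrightarrow> 2 * 0" by (intro tendsto_intros LIMSEQ_power_zero) auto
      then have "\<bar>gap E E' r (trig l)\<bar> \<le> 2 * 0" by (rule LIMSEQ_le_const) (use le in auto)
      then show ?thesis by simp
    qed
    have "gap E E' r (trig l) = 0" for l
    proof -
      obtain C where C: "\<And>y. \<bar>trig l y\<bar> \<le> C" using trig_bounded by blast
      have C0: "C \<ge> 0" using C[of 0] by linarith
      \<comment> \<open>Rescales to sup norm at most 1; C + 1 instead of C avoids division by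
        0.\<close>
      let ?l = "map (\<lambda>(a, h, c). (1 / (C + 1) * a, h, c)) l"
      have e: "trig ?l = (\<lambda>y. 1 / (C + 1) * trig l y)" by (rule ext) (rule trig_scale)
      have "gap E E' r (trig ?l) = 0"
      proof (rule zero)
        fix y show "\<bar>trig ?l y\<bar> \<le> 1"
          unfolding e using C[of y] C0 by (simp add: abs_mult field_simps)
      qed
      moreover have "gap E E' r (trig ?l) = 1 / (C + 1) * gap E E' r (trig l)"
        unfolding gap_def e integral_mult_right_zero by (simp only: right_diff_distrib)
      ultimately show ?thesis using C0 by simp
    qed
    then show ?thesis
      using EM v0 v(3) by (intro measure_eqI_trig S1.finite_measure_law S2.finite_measure_law) (auto simp: gap_def)
  qed
  have "s \<le> r \<Longrightarrow> r \<le> s + real n * d \<Longrightarrow> S1.law E r = S2.law E' r" for n r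
  proof (induction n arbitrary: r)
    case 0
    then show ?case using eq by simp
  next
    case (Suc n)
    show ?case
    proof (cases "r \<le> s + real n * d")
      case True then show ?thesis using Suc by blast
    next
      case False
      let ?v = "s + real n * d"
      have "s \<le> ?v" using d by simp
      moreover from this have "S1.law E ?v = S2.law E' ?v" by (rule Suc.IH) simp
      moreover have "?v \<le> r" "r \<le> ?v + d" using False Suc.prems by (auto simp: algebra_simps)
      ultimately show ?thesis by (rule local)
    qed
  qed
  moreover obtain n where "(t - s) / d \<le> real n" using real_arch_simple by blast
  then have "t \<le> s + real n * d" using d by (simp add: field_simps)
  ultimately show ?thesis using t by blast
qed

text \<open>Induction adds the times in increasing order. It carries equality of the whole
  unnormalised law, not just of probabilities: at the new time \<open>j\<close> that law is
  restricted to \<open>A j\<close> and then propagated to \<open>t\<close>.\<close>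

lemma finite_dimensional_laws:
  assumes J: "finite J" "J \<subseteq> {0..}" and A: "\<And>j. j \<in> J \<Longrightarrow> A j \<in> sets borel" and t: "0 \<le> t" "\<And>j. j \<in> J \<Longrightarrow> j \<le> t"
  shows "{w \<in> space M. \<forall>j\<in>J. X j w \<in> A j} \<in> sets (F t)" "{w \<in> space M'. \<forall>j\<in>J. X' j w \<in> A j} \<in> sets (F' t)"
    "S1.law {w \<in> space M. \<forall>j\<in>J. X j w \<in> A j} t = S2.law {w \<in> space M'. \<forall>j\<in>J. X' j w \<in> A j} t"
proof -
  let ?E = "\<lambda>J. {w \<in> space M. \<forall>j\<in>J. X j w \<in> A j}" and ?E' = "\<lambda>J. {w \<in> space M'. \<forall>j\<in>J. X' j w \<in> A j}"
  have "?E J \<in> sets (F t) \<and> ?E' J \<in> sets (F' t) \<and> S1.law (?E J) t = S2.law (?E' J) t"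
    using J A t
  proof (induction J arbitrary: t rule: finite_linorder_max_induct)
    case empty
    have m: "space M \<in> sets (F r)" "space M' \<in> sets (F' r)" for r
      using sets.top[of "F r"] sets.top[of "F' r"] by simp_all
    \<comment> \<open>No past times: both solutions start at the point \<open>x\<close>.\<close>
    have "S1.law (space M) 0 = S2.law (space M') 0"
      by (intro measure_eqI_trig S1.finite_measure_law S2.finite_measure_law)
         (auto simp: S1.initial_law S2.initial_law)
    then have "S1.law (space M) t = S2.law (space M') t"
      using law_propagates[OF order_refl m] empty by blast
    then show ?case using m by simp
  next
    case (insert j J)
    have j: "0 \<le> j" "j \<le> t" "A j \<in> sets borel" using insert by auto
    have IH: "?E J \<in> sets (F j)" "?E' J \<in> sets (F' j)" "S1.law (?E J) j = S2.law (?E' J) j"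
      using insert.IH[of j] insert.hyps insert.prems j by (auto intro: less_imp_le)
    have e: "?E (insert j J) = ?E J \<inter> (X j -` A j \<inter> space M)" "?E' (insert j J) = ?E' J \<inter> (X' j -` A j \<inter> space M')"
      by auto
    have "X j -` A j \<inter> space (F j) \<in> sets (F j)" "X' j -` A j \<inter> space (F' j) \<in> sets (F' j)"
      using measurable_sets[OF S1.X_measurable_F[OF j(1)] j(3)] measurable_sets[OF S2.X_measurable_F[OF j(1)] j(3)] by auto
    then have m: "?E (insert j J) \<in> sets (F j)" "?E' (insert j J) \<in> sets (F' j)"
      unfolding e using IH by auto
    have mM: "?E (insert j J) \<in> sets M" "?E' (insert j J) \<in> sets M'" "?E J \<in> sets M" "?E' J \<in> sets M'"
      using m IH S1.sets_F_M S2.sets_F_M by blast+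
    have "S1.law (?E (insert j J)) j = S2.law (?E' (insert j J)) j"
    proof (rule measure_eqI)
      fix C assume "C \<in> sets (S1.law (?E (insert j J)) j)"
      then have C: "C \<in> sets borel" by simp
      then have AC: "A j \<inter> C \<in> sets borel" using j by auto
      have "emeasure (S1.law (?E (insert j J)) j) C = emeasure (S1.law (?E J) j) (A j \<inter> C)"
        unfolding S1.emeasure_law[OF mM(1) C j(1)] S1.emeasure_law[OF mM(3) AC j(1)]
        by (intro arg_cong[where f = "emeasure M"]) auto
      also have "\<dots> = emeasure (S2.law (?E' J) j) (A j \<inter> C)" by (simp add: IH)
      also have "\<dots> = emeasure (S2.law (?E' (insert j J)) j) C"
        unfolding S2.emeasure_law[OF mM(2) C j(1)] S2.emeasure_law[OF mM(4) AC j(1)]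
        by (intro arg_cong[where f = "emeasure M'"]) auto
      finally show "emeasure (S1.law (?E (insert j J)) j) C = emeasure (S2.law (?E' (insert j J)) j) C" .
    qed simp
    then have "S1.law (?E (insert j J)) t = S2.law (?E' (insert j J)) t"
      by (rule law_propagates[OF j(1) m]) (rule j(2))
    then show ?case using m S1.sets_F_mono[OF j(2)] S2.sets_F_mono[OF j(2)] by blast
  qed
  then show "?E J \<in> sets (F t)" "?E' J \<in> sets (F' t)" "S1.law (?E J) t = S2.law (?E' J) t" by auto
qed

text \<open>Cylinder sets determine a finite measure on the path space, and the probability of a
  cylinder is the total mass of the law, restricted to it, at a time no earlier than any of its
  coordinates.\<close>

lemma path_law_eq: "path_law M X = path_law M' X'"
  unfolding path_law_def
proof (rule measure_eqI_PiM_infinite)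
  let ?X = "\<lambda>w. \<lambda>t\<in>{0..}. X t w" and ?X' = "\<lambda>w. \<lambda>t\<in>{0..}. X' t w"
  have mX: "?X \<in> measurable M (PiM {0..} (\<lambda>_. borel))"
    by (intro measurable_restrict S1.X_measurable) simp
  have mX': "?X' \<in> measurable M' (PiM {0..} (\<lambda>_. borel))"
    by (intro measurable_restrict S2.X_measurable) simp
  show "finite_measure (distr M (PiM {0..} (\<lambda>_. borel)) ?X)"
    using S1.prob_space_distr[OF mX] by (simp add: prob_space_def)
  fix A :: "real \<Rightarrow> 'h set" and J assume J: "finite J" "J \<subseteq> {0..}" and A: "\<And>i. i \<in> J \<Longrightarrow> A i \<in> sets borel"
  let ?C = "prod_emb {0..} (\<lambda>_. borel) J (Pi\<^sub>E J A)"
  let ?E = "{w \<in> space M. \<forall>j\<in>J. X j w \<in> A j}" and ?E' = "{w \<in> space M'. \<forall>j\<in>J. X' j w \<in> A j}"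
  have C: "?C \<in> sets (PiM {0..} (\<lambda>_. borel))" using J A by (intro sets_PiM_I) auto
  have "?X -` ?C \<inter> space M = ?E" "?X' -` ?C \<inter> space M' = ?E'"
    using J by (auto simp: prod_emb_def PiE_iff subset_iff)
  then have em: "emeasure (distr M (PiM {0..} (\<lambda>_. borel)) ?X) ?C = emeasure M ?E"
    "emeasure (distr M' (PiM {0..} (\<lambda>_. borel)) ?X') ?C = emeasure M' ?E'"
    using emeasure_distr[OF mX C] emeasure_distr[OF mX' C] by simp_all
  \<comment> \<open>Inserting 0 covers an empty \<open>J\<close> and keeps \<open>t\<close>
    nonnegative.\<close>
  define t where "t = Max (insert 0 J)"
  have t: "0 \<le> t" "\<And>j. j \<in> J \<Longrightarrow> j \<le> t" using J by (auto simp: t_def)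
  have f: "?E \<in> sets (F t)" "?E' \<in> sets (F' t)" "S1.law ?E t = S2.law ?E' t"
    by (rule finite_dimensional_laws[where A = A, OF J _ t]; use A in blast)+
  have E: "?E \<in> sets M" "?E' \<in> sets M'" using S1.sets_F_M[OF f(1)] S2.sets_F_M[OF f(2)] .
  have "emeasure (S1.law ?E t) UNIV = emeasure M (?E \<inter> X t -` UNIV \<inter> space M)"
    by (rule S1.emeasure_law[OF E(1) _ t(1)]) simp
  also have "?E \<inter> X t -` UNIV \<inter> space M = ?E" by blast
  finally have e1: "emeasure (S1.law ?E t) UNIV = emeasure M ?E" .
  have "emeasure (S2.law ?E' t) UNIV = emeasure M' (?E' \<inter> X' t -` UNIV \<inter> space M')"
    by (rule S2.emeasure_law[OF E(2) _ t(1)]) simp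
  also have "?E' \<inter> X' t -` UNIV \<inter> space M' = ?E'" by blast
  finally have e2: "emeasure (S2.law ?E' t) UNIV = emeasure M' ?E'" .
  show "emeasure (distr M (PiM {0..} (\<lambda>_. borel)) ?X) ?C = emeasure (distr M' (PiM {0..} (\<lambda>_. borel)) ?X') ?C"
    unfolding em e1[symmetric] e2[symmetric] f(3) ..
qed simp_all

end

theorem mainTheorem2:
  fixes DA :: "'h::{real_inner,banach,second_countable_topology} set"
    and A :: "'h \<Rightarrow> 'h"
    and T :: "real \<Rightarrow> ('h \<Rightarrow>\<^sub>L 'h)"
    and V G :: "'u::{real_inner,banach,second_countable_topology} \<Rightarrow>\<^sub>L 'h"
    and B :: "'h \<Rightarrow> 'u"
    and x :: 'h
    and M :: "'a measure" and F :: "real \<Rightarrow> 'a measure"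
    and W :: "real \<Rightarrow> 'u \<Rightarrow> 'a \<Rightarrow> real" and X :: "real \<Rightarrow> 'a \<Rightarrow> 'h"
    and M' :: "'b measure" and F' :: "real \<Rightarrow> 'b measure"
    and W' :: "real \<Rightarrow> 'u \<Rightarrow> 'b \<Rightarrow> real" and X' :: "real \<Rightarrow> 'b \<Rightarrow> 'h"
  assumes "H2 DA A T V G B"
    and "bounded (range B)"
    and "weak_mild_solution M F W X T V G B x"
    and "weak_mild_solution M' F' W' X' T V G B x"
  shows "path_law M X = path_law M' X'"
proof -
  have h1: "H1 DA A T V G B" using assms(1) by (simp add: H2_def)
  have T: "strongly_cont_semigroup T" and gen: "is_generator T DA A" and ucB: "uniformly_continuous_on UNIV B"
    using h1 by (simp_all add: H1_def)
  have B: "continuous_on UNIV B" by (rule uniformly_continuous_imp_continuous[OF ucB])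
  have G: "range (T t) \<subseteq> range (op_sqrt (Qop T G t))"
    "(\<integral>\<^sup>+ s\<in>{0<..t}. opnorm_e (\<lambda>u. Gamma T G s (blinfun_apply V u)) \<partial>lborel) < \<infinity>" if "t > 0" for t
    using assms(1) that by (simp_all add: H2_def)
  from assms(1)[unfolded H2_def, THEN conjunct2, THEN conjunct1]
  obtain Hs :: "nat \<Rightarrow> 'h set" where Hs: "\<forall>n. Hs n \<subseteq> DA \<inter> adj_domain DA A" "closure (\<Union>n. Hs n) = UNIV"
    by - (elim exE conjE, rule that, assumption+)
  \<comment> \<open>The subspaces make both domains dense; density of \<open>adj_domain DA A\<close>
    is what yields strong continuity of the adjoint semigroup.\<close>
  have "(\<Union>n. Hs n) \<subseteq> DA" "(\<Union>n. Hs n) \<subseteq> adj_domain DA A" using Hs(1) by auto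
  then have dense: "closure DA = UNIV" "closure (adj_domain DA A) = UNIV"
    using closure_mono[of "\<Union>n. Hs n" DA] closure_mono[of "\<Union>n. Hs n" "adj_domain DA A"] Hs(2) by auto
  obtain b where b: "b > 0" "\<And>y. norm (B y) \<le> b"
    using assms(2) unfolding bounded_pos by auto
  interpret D: mild_data T V G B b
    by unfold_locales (use T adj_semigroup[OF T gen dense] B b in auto)
  interpret S1: mild_solution T V G B b M F W X x
    by unfold_locales (use assms(3) in \<open>auto simp: weak_mild_solution_def\<close>)
  interpret S2: mild_solution T V G B b M' F' W' X' x
    by unfold_locales (use assms(4) in \<open>auto simp: weak_mild_solution_def\<close>)
  interpret mild_pair T V G B b M F W X x M' F' W' X'
    by unfold_locales (use b G[of 1] G(1) in auto)
  show ?thesis by (rule path_law_eq)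
qed

end
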